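(* Let $\alpha$ be a Cartan action of rank $n-1$ on $\mathbb T^n$, $n\ge3$. Then $$sh(\alpha)=C(n)\,R^{\frac1{n-1}},$$ where $C(n)$ depends only on $n$ and satisfies $\frac{n-1}{2}\le C(n)\le n-1$, and $R=\big|\det(\log|\lambda_j(A_i)|)_{1\le i,j\le n-1}\big|=kR_K$, with $R_K$ the regulator of $K$ and $k$ the index in $\mathcal U_K/\{\pm1\}$ of the subgroup generated by the units corresponding to $A_1,\dots,A_{n-1}$.
   Context: A Cartan action of rank $n-1$ on $\mathbb T^n$ is a $\mathbb Z^{n-1}$ action by automorphisms generated by commuting $A_1,\dots,A_{n-1}\in GL(n,\mathbb Z)$ generating a free abelian group of rank $n-1$, $A_1$ having irreducible characteristic polynomial; for an eigenvalue $\lambda$ of $A_1$, $K=\mathbb Q(\lambda)$ is totally real of degree $n$, $A_i=p_i(A_1)$ with $p_i\in\mathbb Q[x]$, $\varepsilon_i=p_i(\lambda)$ is a unit, and the eigenvalues of $A_i$ are $\lambda_j(A_i)=\varphi_j(\varepsilon_i)$ for the embeddings $\varphi_j$ of $K$; $\mathcal U_K$ is the unit group of its ring of integers. The measure is Lebesgue. Slow entropy: for a norm $p$ on $\mathbb R^{n-1}$, $sh(p,\alpha)=\lim_{\epsilon,\delta\to0}\limsup_{s\to\infty}\frac1s\log S_d(\alpha,F^p_s,\epsilon,\delta)$, where $F^p_s=\{\mathbf t\in\mathbb Z^{n-1}:p(\mathbf t)\le s\}$, $d$ is the translation-invariant metric on $\mathbb T^n$ induced by the max norm with respect to a common eigenbasis,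 $d_F=\max_{\mathbf t\in F}d\circ\alpha(\mathbf t)$, and $S_d(\alpha,F,\epsilon,\delta)$ is the minimal number of $\epsilon$-balls of $d_F$ covering a set of measure $\ge1-\delta$; $sh(\alpha)=\inf\{sh(p,\alpha):p\text{ a norm with unit ball of volume }1\}$. *)

theory Defs
  imports "HOL-Analysis.Analysis" "HOL-Computational_Algebra.Computational_Algebra"
begin

text \<open>Integer matrices are elements of int^'n^'n; GL(n,Z) membership is
  invertibility over int (integer inverse).\<close>

definition rmat :: "int^'n^'m \<Rightarrow> real^'n^'m" where
  "rmat M = (\<chi> a b. real_of_int (M $ a $ b))"

definition charpoly :: "int^'n^'n \<Rightarrow> int poly" where
  "charpoly M = det (\<chi> a b. (if a = b then [:0, 1:] else 0) - [:M $ a $ b:])"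

primrec mpow_nat :: "int^'n^'n \<Rightarrow> nat \<Rightarrow> int^'n^'n" where
  "mpow_nat M 0 = mat 1"
| "mpow_nat M (Suc k) = M ** mpow_nat M k"

definition mpow_int :: "int^'n^'n \<Rightarrow> int \<Rightarrow> int^'n^'n" where
  "mpow_int M k = (if 0 \<le> k then mpow_nat M (nat k) else mpow_nat (matrix_inv M) (nat (- k)))"

text \<open>The matrix of alpha(t) = A_1^(t_1) ... A_(n-1)^(t_(n-1)) (the factors commute).\<close>
definition act_mat :: "('m::finite \<Rightarrow> int^'n^'n) \<Rightarrow> int^'m \<Rightarrow> int^'n^'n" where
  "act_mat A t = Finite_Set.fold (\<lambda>i M. mpow_int (A i) (t $ i) ** M) (mat 1) (UNIV :: 'm set)"

text \<open>Cartan action of rank n-1 on T^n (n = CARD('n), n-1 = CARD('m)),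
  with distinguished generator A i0 (the paper's A_1).\<close>
definition cartan_action :: "('m::finite \<Rightarrow> int^'n::finite^'n) \<Rightarrow> 'm \<Rightarrow> bool" where
  "cartan_action A i0 \<longleftrightarrow>
     (\<forall>i. invertible (A i)) \<and>
     (\<forall>i j. A i ** A j = A j ** A i) \<and>
     inj (act_mat A) \<and>
     irreducible (map_poly rat_of_int (charpoly (A i0)))"

definition eigmat :: "('n \<Rightarrow> real^'n) \<Rightarrow> real^'n^'n" where
  "eigmat v = (\<chi> a b. v b $ a)"

definition common_eigenbasis ::
  "('m::finite \<Rightarrow> int^'n::finite^'n) \<Rightarrow> ('n \<Rightarrow> real^'n) \<Rightarrow> ('m \<Rightarrow> 'n \<Rightarrow> real) \<Rightarrow> bool" where
  "common_eigenbasis A v mu \<longleftrightarrow>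
     invertible (eigmat v) \<and> (\<forall>i j. rmat (A i) *v v j = mu i j *\<^sub>R v j)"

text \<open>The torus T^n is modelled by the fundamental domain [0,1)^n, with Lebesgue measure.\<close>
definition tcube :: "(real^'n) set" where
  "tcube = {x. \<forall>j. 0 \<le> x $ j \<and> x $ j < 1}"

definition tmeas :: "(real^'n::finite) measure" where
  "tmeas = restrict_space lborel tcube"

definition tor_act :: "('m::finite \<Rightarrow> int^'n::finite^'n) \<Rightarrow> int^'m \<Rightarrow> real^'n \<Rightarrow> real^'n" where
  "tor_act A t x = (\<chi> j. frac ((rmat (act_mat A t) *v x) $ j))"

definition eig_norm :: "('n::finite \<Rightarrow> real^'n) \<Rightarrow> real^'n \<Rightarrow> real" where
  "eig_norm v x = Max (range (\<lambda>j. \<bar>(matrix_inv (eigmat v) *v x) $ j\<bar>))"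

definition tdist :: "('n::finite \<Rightarrow> real^'n) \<Rightarrow> real^'n \<Rightarrow> real^'n \<Rightarrow> real" where
  "tdist v x y = Inf {eig_norm v (x - y - (\<chi> j. real_of_int (m $ j))) | m :: int^'n. True}"

definition dF :: "('n::finite \<Rightarrow> real^'n) \<Rightarrow> ('m::finite \<Rightarrow> int^'n^'n) \<Rightarrow> (int^'m) set
    \<Rightarrow> real^'n \<Rightarrow> real^'n \<Rightarrow> real" where
  "dF v A F x y = Max ((\<lambda>t. tdist v (tor_act A t x) (tor_act A t y)) ` F)"

definition covnum :: "('n::finite \<Rightarrow> real^'n) \<Rightarrow> ('m::finite \<Rightarrow> int^'n^'n) \<Rightarrow> (int^'m) set
    \<Rightarrow> real \<Rightarrow> real \<Rightarrow> nat" where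
  "covnum v A F eps delta = (LEAST N. \<exists>X. X \<subseteq> tcube \<and> finite X \<and> card X = N \<and>
      (\<exists>E \<in> sets tmeas. measure tmeas E \<ge> 1 - delta \<and>
          E \<subseteq> (\<Union>x\<in>X. {y \<in> tcube. dF v A F x y < eps})))"

definition Fset :: "(real^'m::finite \<Rightarrow> real) \<Rightarrow> real \<Rightarrow> (int^'m) set" where
  "Fset p s = {t. p (\<chi> i. real_of_int (t $ i)) \<le> s}"

definition sh_norm :: "('n::finite \<Rightarrow> real^'n) \<Rightarrow> ('m::finite \<Rightarrow> int^'n^'n)
    \<Rightarrow> (real^'m \<Rightarrow> real) \<Rightarrow> ereal" where
  "sh_norm v A p = Lim (at_right 0 \<times>\<^sub>F at_right 0)
     (\<lambda>(eps::real, delta::real). Limsup at_top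
        (\<lambda>s::real. ereal (ln (real (covnum v A (Fset p s) eps delta)) / s)))"

definition is_norm :: "('a::real_vector \<Rightarrow> real) \<Rightarrow> bool" where
  "is_norm p \<longleftrightarrow> (\<forall>x. 0 \<le> p x) \<and> (\<forall>x. p x = 0 \<longrightarrow> x = 0) \<and>
     (\<forall>c x. p (c *\<^sub>R x) = \<bar>c\<bar> * p x) \<and> (\<forall>x y. p (x + y) \<le> p x + p y)"

definition sh_alpha :: "('n::finite \<Rightarrow> real^'n) \<Rightarrow> ('m::finite \<Rightarrow> int^'n^'n) \<Rightarrow> ereal" where
  "sh_alpha v A = (INF p \<in> {p :: real^'m \<Rightarrow> real. is_norm p \<and> emeasure lborel {x. p x \<le> 1} = 1}.
                      sh_norm v A p)"

definition nf_field :: "real \<Rightarrow> real set" where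
  "nf_field lam = {poly (map_poly of_rat p) lam | p :: rat poly. True}"

definition nf_units :: "real \<Rightarrow> real set" where
  "nf_units lam = {x \<in> nf_field lam. x \<noteq> 0 \<and> algebraic_int x \<and> algebraic_int (inverse x)}"

text \<open>The embedding of K = Q(lam) sending lam to its conjugate lam'.\<close>
definition nf_emb :: "real \<Rightarrow> real \<Rightarrow> real \<Rightarrow> real" where
  "nf_emb lam lam' x = poly (map_poly of_rat (SOME p :: rat poly. x = poly (map_poly of_rat p) lam)) lam'"

definition fund_system :: "real \<Rightarrow> ('m::finite \<Rightarrow> real) \<Rightarrow> bool" where
  "fund_system lam u \<longleftrightarrow> (\<forall>i. u i \<in> nf_units lam) \<and>
     (\<forall>x \<in> nf_units lam. \<exists>s \<in> {1, -1}. \<exists>m :: 'm \<Rightarrow> int. x = s * (\<Prod>i\<in>UNIV. u i powi m i))"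

definition regulator :: "real \<Rightarrow> ('m::finite \<Rightarrow> real) \<Rightarrow> real" where
  "regulator lam cj = (let u = (SOME u :: 'm \<Rightarrow> real. fund_system lam u) in
      \<bar>det (\<chi> i k. ln \<bar>nf_emb lam (cj k) (u i)\<bar>)\<bar>)"

definition unit_index :: "real \<Rightarrow> ('m::finite \<Rightarrow> real) \<Rightarrow> nat" where
  "unit_index lam eps = (let H = {s * (\<Prod>i\<in>UNIV. eps i powi m i) | s m. s \<in> {1, -1::real}} in
      card ((\<lambda>x. (\<lambda>y. x * y) ` H) ` nf_units lam))"

end

theory Submission
  imports Defs "HOL-Computational_Algebra.Field_as_Ring"
begin

text \<open>
  In coordinates with respect to the common eigenbasis, a ball of the metric \<^const>\<open>dF\<close> for
  \<^term>\<open>Fset p s\<close> is, up to constants, a box whose \<open>j\<close>-th side is \<open>exp (- s p*(\<chi>\<^sub>j))\<close>, where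
  \<open>\<chi>\<^sub>j\<close> is the \<open>j\<close>-th Lyapunov functional and \<open>p*\<close> the dual norm. Comparing volumes, the slow
  entropy for \<open>p\<close> is the sum of the numbers \<open>p*(\<chi>\<^sub>j)\<close>. The functionals add up to zero and any
  \<open>n - 1\<close> of them are independent, so a linear change of variables carries them to the coordinate
  functionals and minus their sum; this scales the infimum over norms of volume one by
  \<open>R\<^bsup>1/(n-1)\<^esup>\<close> and leaves a constant depending only on \<open>n\<close>. It is at least \<open>(n-1)/2\<close> by
  the inequality of arithmetic and geometric means, and at most \<open>n - 1\<close> by the choice of a cube.

  For the second formula, the logarithms of the conjugates map the units, with kernel \<open>{1, -1}\<close>, onto
  a discrete subgroup of \<open>\<real>\<^bsup>n-1\<^esup>\<close>. It has full rank because the given units are independent, so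
  it is a lattice, and the index of a sublattice is a quotient of covolumes.
\<close>

text \<open>Only the exponential rate in \<open>s\<close> matters, so bounded shifts of
  \<open>s\<close> and factors depending on \<open>eps\<close> and \<open>delta\<close> are
  harmless: between two constant multiples of one exponential the limsup is a limit, the same for
  all small \<open>eps\<close> and all \<open>delta\<close> below 1. The delicate half is the lower
  bound on the covering number. On the torus, nearness at different times may be witnessed by
  different integer translates, which could make a ball larger than a few boxes; ruling this out
  takes small steps between times and costs a constant in \<open>s\<close>.

  The number theory is carried out in matrices. A field element is a rational polynomial at an
  eigenvalue of \<open>A i0\<close>, its conjugates are the values at the other eigenvalues, and
  together they form the spectrum of one rational matrix diagonal in \<open>v\<close>. Integrality
  gives similarity to an integer matrix, hence integer norms and integer characteristic polynomials
  with bounded coefficients. The independence of the given units comes from the injectivity of the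
  action: only finitely many integer matrices diagonal in \<open>v\<close> have eigenvalues below a
  given bound.\<close>

no_notation fps_nth (infixl "$" 75)

section \<open>Volumes of linear images\<close>

text \<open>The library proves the volume formula for linear images only over well-ordered index types.
  An arbitrary finite index type has an order-carrying copy, to which the formula is transported.\<close>

typedef 'a ord_copy = "{..<CARD('a::finite)}"
  by (auto intro!: exI[of _ 0])

instance ord_copy :: (finite) finite
proof
  have "(UNIV :: 'a ord_copy set) = Abs_ord_copy ` {..<CARD('a)}"
    by (rule type_definition.univ[OF type_definition_ord_copy])
  then show "finite (UNIV :: 'a ord_copy set)" by (metis finite_imageI finite_lessThan)
qed

instantiation ord_copy :: (finite) wellorder
begin

definition less_eq_ord_copy :: "'a ord_copy \<Rightarrow> 'a ord_copy \<Rightarrow> bool" where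
  "less_eq_ord_copy x y \<longleftrightarrow> Rep_ord_copy x \<le> Rep_ord_copy y"

definition less_ord_copy :: "'a ord_copy \<Rightarrow> 'a ord_copy \<Rightarrow> bool" where
  "less_ord_copy x y \<longleftrightarrow> Rep_ord_copy x < Rep_ord_copy y"

instance
proof
  fix P :: "'a ord_copy \<Rightarrow> bool" and a
  assume step: "\<And>x. (\<And>y. y < x \<Longrightarrow> P y) \<Longrightarrow> P x"
  show "P a"
    by (induction a rule: measure_induct_rule[where f=Rep_ord_copy])
       (auto intro: step simp: less_ord_copy_def)
qed (auto simp: less_eq_ord_copy_def less_ord_copy_def Rep_ord_copy_inject)

end

lemma card_ord_copy: "CARD('a::finite ord_copy) = CARD('a)"
  using type_definition.card[OF type_definition_ord_copy] by simp

text \<open>Conjugation by \<open>\<sigma>\<close> carries the permutations of one index type onto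
  those of the other and preserves the sign, so the two Leibniz sums agree term by term.\<close>

lemma det_reindex:
  fixes A :: "'a::comm_ring_1^'n^'n" and \<sigma> :: "'k::finite \<Rightarrow> 'n::finite"
  assumes "bij \<sigma>"
  shows "det (\<chi> i j. A $ \<sigma> i $ \<sigma> j) = det A"
proof -
  have inj: "inj_on \<sigma> UNIV" using assms by (simp add: bij_is_inj)
  have img: "\<sigma> ` UNIV = UNIV" using assms by (simp add: bij_is_surj)
  let ?F = "map_permutation UNIV \<sigma>"
  have ap: "?F p (\<sigma> i) = \<sigma> (p i)" for p i by (rule map_permutation_apply[OF inj]) simp
  have perm: "?F p permutes UNIV" if "p permutes UNIV" for p
    using map_permutation_permutes[of \<sigma> UNIV UNIV p] assms that by (simp add: img)
  have bij: "bij_betw ?F {p. p permutes UNIV} {p. p permutes UNIV}"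
  proof (rule bij_betw_imageI)
    show "inj_on ?F {p. p permutes UNIV}"
    proof (rule inj_onI, rule ext)
      fix p q i assume "?F p = ?F q"
      then have "\<sigma> (p i) = \<sigma> (q i)" by (metis ap)
      then show "p i = q i" using inj by (simp add: inj_on_eq_iff)
    qed
    show "?F ` {p. p permutes UNIV} = {p. p permutes UNIV}"
    proof (intro equalityI subsetI)
      fix q assume "q \<in> {p. p permutes (UNIV::'n set)}"
      then have "bij q" by (simp add: permutes_bij)
      define p where "p = inv \<sigma> \<circ> q \<circ> \<sigma>"
      have "bij p" unfolding p_def using \<open>bij q\<close> assms by (intro bij_comp bij_imp_bij_inv)
      then have p: "p permutes UNIV" by (intro bij_imp_permutes) auto
      have "?F p = q"
      proof
        fix x
        obtain i where "x = \<sigma> i" using assms by (meson bij_pointE)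
        then show "?F p x = q x" using assms by (simp add: ap p_def bij_is_surj surj_f_inv_f)
      qed
      then show "q \<in> ?F ` {p. p permutes UNIV}" using p by blast
    qed (use perm in auto)
  qed
  have "det A = (\<Sum>p | p permutes UNIV. of_int (sign (?F p)) * (\<Prod>i\<in>UNIV. A $ i $ ?F p i))"
    unfolding det_def by (rule sum.reindex_bij_betw[OF bij, symmetric])
  also have "\<dots> = (\<Sum>p | p permutes UNIV. of_int (sign p) * (\<Prod>i\<in>UNIV. A $ \<sigma> i $ \<sigma> (p i)))"
  proof (rule sum.cong[OF refl])
    fix p :: "'k \<Rightarrow> 'k" assume "p \<in> {p. p permutes UNIV}"
    then have "sign (?F p) = sign p" using sign_map_permutation[OF inj] by simp
    moreover have "(\<Prod>i\<in>UNIV. A $ i $ ?F p i) = (\<Prod>i\<in>UNIV. A $ \<sigma> i $ ?F p (\<sigma> i))"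
      by (rule prod.reindex_bij_betw[symmetric, OF assms])
    ultimately show "of_int (sign (?F p)) * (\<Prod>i\<in>UNIV. A $ i $ ?F p i)
        = of_int (sign p) * (\<Prod>i\<in>UNIV. A $ \<sigma> i $ \<sigma> (p i))" by (simp add: ap)
  qed
  finally show ?thesis by (simp add: det_def)
qed

text \<open>Lebesgue measure is characterised by its values on open boxes, and renaming coordinates
  turns a box into a box with the same product of side lengths.\<close>

lemma emeasure_lborel_reindex:
  fixes \<sigma> :: "'k::finite \<Rightarrow> 'n::finite"
  assumes \<sigma>: "bij \<sigma>" and S: "S \<in> sets (borel :: (real^'n) measure)"
  shows "emeasure lborel ((\<lambda>x. (\<chi> k. x $ \<sigma> k) :: real^'k) ` S) = emeasure lborel S"
proof -
  let ?P = "\<lambda>x::real^'n. (\<chi> k. x $ \<sigma> k) :: real^'k"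
  let ?Q = "\<lambda>y::real^'k. (\<chi> i. y $ inv \<sigma> i) :: real^'n"
  have QP: "?Q (?P x) = x" and PQ: "?P (?Q y) = y" for x y
    using \<sigma> by (simp_all add: vec_eq_iff bij_is_inj bij_is_surj surj_f_inv_f)
  have im: "?P ` T = ?Q -` T" for T
  proof (intro equalityI subsetI)
    fix y assume "y \<in> ?Q -` T"
    then show "y \<in> ?P ` T" using PQ[of y] by (intro image_eqI[of y ?P "?Q y"]) simp_all
  qed (use \<sigma> in \<open>auto simp: bij_is_surj surj_f_inv_f\<close>)
  have lin: "linear ?Q" by (rule linearI) (simp_all add: vec_eq_iff)
  have mQ: "?Q \<in> borel_measurable borel"
    by (intro borel_measurable_continuous_onI linear_continuous_on linear_conv_bounded_linear[THEN iffD1] lin)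
  have bp: "(\<Prod>b\<in>Basis. f b) = (\<Prod>i\<in>UNIV. f (axis i 1))" for f :: "real^'a::finite \<Rightarrow> real"
  proof -
    have B: "(Basis :: (real^'a) set) = (\<lambda>i. axis i 1) ` UNIV"
      by (auto simp: Basis_vec_def)
    show ?thesis unfolding B by (subst prod.reindex) (auto simp: inj_on_def axis_eq_axis)
  qed
  have "lborel = distr lborel borel ?Q"
  proof (rule lborel_eqI)
    fix l u :: "real^'n" assume lu: "\<And>b. b \<in> Basis \<Longrightarrow> l \<bullet> b \<le> u \<bullet> b"
    then have lu': "l $ i \<le> u $ i" for i
      using lu[of "axis i 1"] by (simp add: inner_axis Basis_vec_def) blast
    have "?Q -` box l u = box (?P l) (?P u)"
    proof -
      have "(\<forall>i. R i (inv \<sigma> i)) \<longleftrightarrow> (\<forall>k. R (\<sigma> k) k)" for R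
        using \<sigma> by (metis bij_inv_eq_iff)
      from this[of "\<lambda>i k. l $ i < _ $ k \<and> _ $ k < u $ i"] show ?thesis
        by (auto simp: mem_box_cart)
    qed
    then have "emeasure (distr lborel borel ?Q) (box l u) = emeasure lborel (box (?P l) (?P u))"
      using mQ by (simp add: emeasure_distr)
    also have "\<dots> = ennreal (\<Prod>b\<in>Basis. (?P u - ?P l) \<bullet> b)"
      using lu' by (auto simp: emeasure_lborel_box_eq Basis_vec_def inner_axis)
    also have "(\<Prod>b\<in>Basis. (?P u - ?P l) \<bullet> b) = (\<Prod>k\<in>UNIV. u $ \<sigma> k - l $ \<sigma> k)"
      by (subst bp) (simp add: inner_axis)
    also have "\<dots> = (\<Prod>i\<in>UNIV. u $ i - l $ i)" by (rule prod.reindex_bij_betw[OF \<sigma>])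
    also have "\<dots> = (\<Prod>b\<in>Basis. (u - l) \<bullet> b)" by (subst bp) (simp add: inner_axis)
    finally show "emeasure (distr lborel borel ?Q) (box l u) = ennreal (\<Prod>b\<in>Basis. (u - l) \<bullet> b)" .
  qed simp
  then have "emeasure lborel S = emeasure (distr lborel borel ?Q) S" by metis
  also have "\<dots> = emeasure lborel (?P ` S)" using mQ S by (simp add: emeasure_distr im)
  finally show ?thesis by simp
qed

text \<open>It suffices to treat boxes. Their linear images are compact, hence Borel, as the
  transport to the ordered copy requires; there \<open>M\<close> becomes \<open>M'\<close>, which
  has the same determinant.\<close>

lemma lmeasurable_matrix_image:
  fixes M :: "real^'n::finite^'n" and S :: "(real^'n) set"
  assumes S: "S \<in> lmeasurable"
  shows "(*v) M ` S \<in> lmeasurable" (is ?A)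
    and measure_matrix_image: "measure lebesgue ((*v) M ` S) = \<bar>det M\<bar> * measure lebesgue S" (is ?B)
proof -
  obtain \<sigma> :: "'n ord_copy \<Rightarrow> 'n" where \<sigma>: "bij \<sigma>"
    using finite_same_card_bij[of "UNIV :: 'n ord_copy set" "UNIV :: 'n set"] by (auto simp: card_ord_copy)
  let ?P = "\<lambda>x::real^'n. (\<chi> k. x $ \<sigma> k) :: real^'n ord_copy"
  define M' :: "real^'n ord_copy^'n ord_copy" where "M' = (\<chi> i j. M $ \<sigma> i $ \<sigma> j)"
  have PM: "?P (M *v x) = M' *v ?P x" for x
    using sum.reindex_bij_betw[OF \<sigma>, of "\<lambda>j. M $ \<sigma> _ $ j * x $ j"]
    by (simp add: vec_eq_iff matrix_vector_mult_def M'_def)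
  have im: "?P ` (*v) M ` T = (*v) M' ` ?P ` T" for T
    by (simp add: image_image PM)
  have meq: "measure lebesgue (?P ` K) = measure lebesgue K" if "compact K" for K
  proof -
    have K: "K \<in> sets borel" using that by (simp add: compact_imp_closed borel_closed)
    have "linear ?P" by (rule linearI) (simp_all add: vec_eq_iff)
    then have "compact (?P ` K)"
      using that by (intro compact_continuous_image linear_continuous_on linear_conv_bounded_linear[THEN iffD1])
    then have "?P ` K \<in> sets borel" by (simp add: compact_imp_closed borel_closed)
    then show ?thesis using emeasure_lborel_reindex[OF \<sigma> K] K by (simp add: measure_def)
  qed
  have "measure lebesgue ((*v) M ` cbox a b) = \<bar>det M\<bar> * measure lebesgue (cbox a b)" for a b
  proof -
    have c: "compact ((*v) M ` cbox a b)"
      by (intro compact_continuous_image linear_continuous_on compact_cbox matrix_vector_mul_bounded_linear)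
    have c': "compact (?P ` cbox a b)"
    proof -
      have "linear ?P" by (rule linearI) (simp_all add: vec_eq_iff)
      then show ?thesis
        by (intro compact_continuous_image linear_continuous_on linear_conv_bounded_linear[THEN iffD1] compact_cbox)
    qed
    have "measure lebesgue ((*v) M ` cbox a b) = measure lebesgue ((*v) M' ` ?P ` cbox a b)"
      using meq[OF c] by (simp add: im)
    also have "\<dots> = \<bar>det M'\<bar> * measure lebesgue (?P ` cbox a b)"
      using measure_linear_image[OF matrix_vector_mul_linear lmeasurable_compact[OF c'], of M']
      by (simp add: matrix_of_matrix_vector_mul)
    also have "det M' = det M" unfolding M'_def by (rule det_reindex[OF \<sigma>])
    finally show ?thesis using meq[OF compact_cbox] by simp
  qed
  from measure_linear_sufficient[OF matrix_vector_mul_linear S this] show ?A ?B by auto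
qed

section \<open>Lattices\<close>

lemma matrix_inv_right: "invertible M \<Longrightarrow> M ** matrix_inv M = mat 1"
  and matrix_inv_left: "invertible M \<Longrightarrow> matrix_inv M ** M = mat 1"
  for M :: "'a::semiring_1^'n^'m"
proof -
  assume "invertible M"
  then have "\<exists>B. M ** B = mat 1 \<and> B ** M = mat 1"
    unfolding invertible_def .
  then have "M ** matrix_inv M = mat 1 \<and> matrix_inv M ** M = mat 1"
    unfolding matrix_inv_def by (rule someI_ex)
  then show "M ** matrix_inv M = mat 1" "matrix_inv M ** M = mat 1" by auto
qed

lemma matrix_inv_mult_vec:
  fixes M :: "'a::comm_semiring_1^'n^'n"
  assumes "invertible M"
  shows "M *v (matrix_inv M *v x) = x" "matrix_inv M *v (M *v x) = x"
  using assms by (simp_all add: matrix_vector_mul_assoc matrix_inv_left matrix_inv_right)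

lemma eigmat_mult_vec: "eigmat b *v c = (\<Sum>i\<in>UNIV. c $ i *\<^sub>R b i)"
  by (simp add: eigmat_def matrix_vector_mult_def vec_eq_iff mult.commute)

lemma eigmat_axis: "eigmat b *v axis i 1 = b i"
  by (simp add: eigmat_mult_vec axis_def if_distrib[where f="\<lambda>c. c *\<^sub>R _"] cong: if_cong)

lemma eigmat_mult: "M ** eigmat b = eigmat (\<lambda>j. M *v b j)"
  by (simp add: vec_eq_iff eigmat_def matrix_matrix_mult_def matrix_vector_mult_def)

definition int_vec :: "int^'m \<Rightarrow> real^'m" where
  "int_vec m = (\<chi> j. real_of_int (m $ j))"

lemma int_vec_nth [simp]: "int_vec m $ j = real_of_int (m $ j)"
  by (simp add: int_vec_def)

lemma int_vec_add: "int_vec (m + k) = int_vec m + int_vec k"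
  and int_vec_diff: "int_vec (m - k) = int_vec m - int_vec k"
  and int_vec_0: "int_vec 0 = 0"
  by (simp_all add: vec_eq_iff)

lemma int_vec_mult: "int_vec (M *v k) = rmat M *v int_vec k"
  by (simp add: vec_eq_iff rmat_def matrix_vector_mult_def)

lemma int_vec_axis: "int_vec (axis i 1) = axis i 1"
  by (simp add: vec_eq_iff axis_def)

lemma finite_int_vec_bounded: "finite {m :: int^'m. \<forall>j. \<bar>int_vec m $ j\<bar> \<le> C}"
proof -
  have "{m :: int^'m. \<forall>j. \<bar>int_vec m $ j\<bar> \<le> C} \<subseteq> vec_lambda ` (UNIV \<rightarrow> {- \<lfloor>C\<rfloor> .. \<lfloor>C\<rfloor>})"
  proof
    fix m :: "int^'m" assume m: "m \<in> {m. \<forall>j. \<bar>int_vec m $ j\<bar> \<le> C}"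
    have "m $ j \<in> {- \<lfloor>C\<rfloor> .. \<lfloor>C\<rfloor>}" for j
    proof -
      have "\<bar>real_of_int (m $ j)\<bar> \<le> C" using m by simp
      then have "m $ j \<le> \<lfloor>C\<rfloor>" "- (m $ j) \<le> \<lfloor>C\<rfloor>" by linarith+
      then show ?thesis by simp
    qed
    then have "vec_nth m \<in> UNIV \<rightarrow> {- \<lfloor>C\<rfloor> .. \<lfloor>C\<rfloor>}" by auto
    then show "m \<in> vec_lambda ` (UNIV \<rightarrow> {- \<lfloor>C\<rfloor> .. \<lfloor>C\<rfloor>})"
      by (metis image_eqI vec_nth_inverse)
  qed
  moreover have "finite (UNIV \<rightarrow> {- \<lfloor>C\<rfloor> .. \<lfloor>C\<rfloor>} :: ('m \<Rightarrow> int) set)"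
    using finite_PiE[of "UNIV :: 'm set" "\<lambda>_. {- \<lfloor>C\<rfloor> .. \<lfloor>C\<rfloor>}"] by (simp add: PiE_UNIV_domain)
  ultimately show ?thesis by (meson finite_imageI finite_subset)
qed

definition zspan :: "('m \<Rightarrow> real^'m) \<Rightarrow> (real^'m) set" where
  "zspan b = range (\<lambda>m. eigmat b *v int_vec m)"

text \<open>Half-open like \<open>tcube\<close>, so that the translates by \<open>zspan b\<close>
  tile without overlapping on the boundary.\<close>

definition fund_box :: "('m \<Rightarrow> real^'m) \<Rightarrow> (real^'m) set" where
  "fund_box b = (\<lambda>c. eigmat b *v c) ` tcube"

lemma zspan_0: "0 \<in> zspan b"
  unfolding zspan_def by (auto intro!: image_eqI[where x=0] simp: int_vec_0)

lemma zspan_diff: "x \<in> zspan b \<Longrightarrow> y \<in> zspan b \<Longrightarrow> x - y \<in> zspan b"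
  unfolding zspan_def by (auto simp: matrix_vector_mult_diff_distrib[symmetric] int_vec_diff[symmetric])

lemma zspan_minus: "x \<in> zspan b \<Longrightarrow> - x \<in> zspan b"
  using zspan_diff[OF zspan_0, of x b] by simp

lemma zspan_add: "x \<in> zspan b \<Longrightarrow> y \<in> zspan b \<Longrightarrow> x + y \<in> zspan b"
  using zspan_diff[OF _ zspan_minus, of x b y] by simp

lemma countable_zspan: "countable (zspan b)"
  unfolding zspan_def by simp

lemma subgroup_sum:
  fixes L :: "'a::ab_group_add set"
  assumes "0 \<in> L" "\<And>x y. x \<in> L \<Longrightarrow> y \<in> L \<Longrightarrow> x - y \<in> L" "\<And>i. i \<in> S \<Longrightarrow> f i \<in> L"
  shows "sum f S \<in> L"
proof -
  have add: "x + y \<in> L" if "x \<in> L" "y \<in> L" for x y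
    using assms(2)[OF that(1) assms(2)[OF assms(1) that(2)]] by simp
  from assms(3) show ?thesis
    by (induction S rule: infinite_finite_induct) (auto simp: assms(1) add)
qed

lemma subgroup_scaleR_int:
  fixes L :: "'a::real_vector set"
  assumes 0: "0 \<in> L" and diff: "\<And>x y. x \<in> L \<Longrightarrow> y \<in> L \<Longrightarrow> x - y \<in> L" and x: "x \<in> L"
  shows "real_of_int k *\<^sub>R x \<in> L"
proof (cases k)
  case (nonneg n)
  have "real n *\<^sub>R x = (\<Sum>i<n. x)" by (simp add: sum_constant_scaleR)
  then show ?thesis using subgroup_sum[OF 0 diff, of "{..<n}" "\<lambda>_. x"] x nonneg by simp
next
  case (neg n)
  have "real (Suc n) *\<^sub>R x = (\<Sum>i<Suc n. x)" by (simp only: sum_constant_scaleR card_lessThan)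
  then have "real (Suc n) *\<^sub>R x \<in> L" using subgroup_sum[OF 0 diff, of "{..<Suc n}" "\<lambda>_. x"] x by metis
  then have "0 - real (Suc n) *\<^sub>R x \<in> L" by (intro diff 0)
  moreover have "real_of_int k *\<^sub>R x = 0 - real (Suc n) *\<^sub>R x" by (simp add: neg algebra_simps)
  ultimately show ?thesis by simp
qed

lemma zspan_subset:
  assumes "0 \<in> L" "\<And>x y. x \<in> L \<Longrightarrow> y \<in> L \<Longrightarrow> x - y \<in> L" "\<And>i. b i \<in> L"
  shows "zspan b \<subseteq> L"
  unfolding zspan_def eigmat_mult_vec
  by (auto intro!: subgroup_sum[OF assms(1,2)] subgroup_scaleR_int[OF assms(1,2)] assms(3))

lemma tcube_tiling: "\<exists>!m. x - int_vec m \<in> tcube"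
proof (rule ex1I[where a="\<chi> j. \<lfloor>x $ j\<rfloor>"])
  show "x - int_vec (\<chi> j. \<lfloor>x $ j\<rfloor>) \<in> tcube"
    by (simp add: tcube_def) linarith
next
  fix m assume "x - int_vec m \<in> tcube"
  then have "\<lfloor>x $ j\<rfloor> = m $ j" for j
    by (intro floor_unique) (auto simp: tcube_def algebra_simps dest!: spec[of _ j])
  then show "m = (\<chi> j. \<lfloor>x $ j\<rfloor>)" by (simp add: vec_eq_iff)
qed

lemma mem_fund_box_iff:
  assumes "invertible (eigmat b)"
  shows "x \<in> fund_box b \<longleftrightarrow> matrix_inv (eigmat b) *v x \<in> tcube"
  unfolding fund_box_def using matrix_inv_mult_vec[OF assms] by (auto intro: image_eqI[of x _ "matrix_inv (eigmat b) *v x"])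

lemma fund_box_tiling:
  assumes inv: "invertible (eigmat b)"
  shows "\<exists>!g. g \<in> zspan b \<and> x - g \<in> fund_box b"
proof -
  let ?c = "matrix_inv (eigmat b) *v x"
  have eq: "matrix_inv (eigmat b) *v (x - eigmat b *v int_vec m) = ?c - int_vec m" for m
    by (simp add: matrix_vector_mult_diff_distrib matrix_inv_mult_vec[OF inv])
  obtain m where m: "?c - int_vec m \<in> tcube" and u: "\<And>k. ?c - int_vec k \<in> tcube \<Longrightarrow> k = m"
    using tcube_tiling[of ?c] by blast
  show ?thesis
  proof (rule ex1I[where a="eigmat b *v int_vec m"])
    show "eigmat b *v int_vec m \<in> zspan b \<and> x - eigmat b *v int_vec m \<in> fund_box b"
      using m by (simp add: mem_fund_box_iff[OF inv] eq zspan_def)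
  next
    fix g assume "g \<in> zspan b \<and> x - g \<in> fund_box b"
    then show "g = eigmat b *v int_vec m"
      using u by (auto simp: mem_fund_box_iff[OF inv] eq zspan_def)
  qed
qed

lemma tcube_lmeasurable: "(tcube :: (real^'n) set) \<in> lmeasurable"
  and measure_tcube: "measure lebesgue (tcube :: (real^'n) set) = 1"
  and tcube_borel [measurable]: "(tcube :: (real^'n) set) \<in> sets borel"
  and bounded_tcube: "bounded (tcube :: (real^'n) set)"
proof -
  have eq: "(tcube :: (real^'n) set) = (\<Inter>j. {x. 0 \<le> x $ j} \<inter> {x. x $ j < 1})" by (auto simp: tcube_def)
  show B: "(tcube :: (real^'n) set) \<in> sets borel"
    unfolding eq
    by (intro sets.countable_INT' sets.Int)
       (auto intro: borel_closed[OF closed_Collect_le] borel_open[OF open_Collect_less] continuous_intros)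
  have sub: "(tcube :: (real^'n) set) \<subseteq> cbox 0 1" by (auto simp: tcube_def mem_box_cart less_imp_le)
  then show bd: "bounded (tcube :: (real^'n) set)" using bounded_cbox bounded_subset by blast
  have sub2: "box 0 1 \<subseteq> (tcube :: (real^'n) set)" by (auto simp: tcube_def mem_box_cart less_imp_le)
  have bt: "(0::real^'n) \<bullet> b \<le> 1 \<bullet> b" if "b \<in> Basis" for b
    using that by (auto simp: Basis_vec_def inner_axis)
  have e1: "emeasure lborel (cbox 0 (1::real^'n)) = 1"
    using bt by (auto simp: emeasure_lborel_cbox_eq Basis_vec_def inner_axis intro!: prod.neutral)
  have e2: "emeasure lborel (box 0 (1::real^'n)) = 1"
    using e1 bt by (simp add: emeasure_lborel_cbox_eq emeasure_lborel_box_eq)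
  have E: "emeasure lborel (tcube :: (real^'n) set) = 1"
  proof (rule antisym)
    show "emeasure lborel (tcube :: (real^'n) set) \<le> 1" using emeasure_mono[OF sub, of lborel] e1 by simp
    show "1 \<le> emeasure lborel (tcube :: (real^'n) set)" using emeasure_mono[OF sub2, of lborel] e2 B by simp
  qed
  have S: "(tcube :: (real^'n) set) \<in> sets lebesgue" using B by simp
  have E': "emeasure lebesgue (tcube :: (real^'n) set) = 1" using E B by simp
  show "(tcube :: (real^'n) set) \<in> lmeasurable"
    by (rule fmeasurableI[OF S]) (simp add: E')
  show "measure lebesgue (tcube :: (real^'n) set) = 1" by (simp add: measure_def E')
qed

lemma fund_box_lmeasurable: "fund_box b \<in> lmeasurable"
  unfolding fund_box_def by (intro lmeasurable_matrix_image tcube_lmeasurable)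

lemma measure_fund_box: "measure lebesgue (fund_box b) = \<bar>det (eigmat b)\<bar>"
  unfolding fund_box_def
  by (simp add: measure_matrix_image tcube_lmeasurable measure_tcube)

lemma bounded_fund_box: "bounded (fund_box b)"
  unfolding fund_box_def
  by (intro bounded_linear_image bounded_tcube) (rule matrix_vector_mul_bounded_linear)

text \<open>Cut \<open>F\<close> along the translates of \<open>G\<close> and move every piece back
  into \<open>G\<close>. Translation preserves measure, and the condition \<open>uniq\<close> keeps
  the moved pieces disjoint.\<close>

lemma emeasure_tiles_le:
  fixes F G :: "(real^'m) set"
  assumes cnt: "countable \<Gamma>"
    and FG: "F \<in> sets lebesgue" "G \<in> sets lebesgue"
    and cov: "\<And>x. \<exists>!g. g \<in> \<Gamma> \<and> x - g \<in> G"
    and uniq: "\<And>x g h. g \<in> \<Gamma> \<Longrightarrow> h \<in> \<Gamma> \<Longrightarrow> x + g \<in> F \<Longrightarrow> x + h \<in> F \<Longrightarrow> g = h"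
  shows "emeasure lebesgue F \<le> emeasure lebesgue G"
proof -
  define T where "T g = F \<inter> ((+) g ` G)" for g
  define U where "U g = ((+) (-g) ` F) \<inter> G" for g
  have sT: "T g \<in> sets lebesgue" and sU: "U g \<in> sets lebesgue" for g
    unfolding T_def U_def using FG by (blast intro: sets.Int lebesgue_sets_translation)+
  have TU: "T g = (+) g ` U g" for g
  proof -
    have "(+) g ` U g = (+) g ` (+) (-g) ` F \<inter> (+) g ` G"
      unfolding U_def by (rule image_Int) simp
    then show ?thesis by (simp add: T_def image_image)
  qed
  have eTU: "emeasure lebesgue (T g) = emeasure lebesgue (U g)" for g
    using emeasure_lebesgue_affine[of 1 g "U g"] unfolding TU by (simp add: add.commute)
  have "F \<subseteq> (\<Union>g\<in>\<Gamma>. T g)"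
  proof
    fix x assume "x \<in> F"
    obtain g where "g \<in> \<Gamma>" "x - g \<in> G" using cov by blast
    then have "x \<in> T g" using \<open>x \<in> F\<close> by (auto simp: T_def intro!: image_eqI[of x _ "x - g"])
    then show "x \<in> (\<Union>g\<in>\<Gamma>. T g)" using \<open>g \<in> \<Gamma>\<close> by blast
  qed
  then have "emeasure lebesgue F \<le> emeasure lebesgue (\<Union>g\<in>\<Gamma>. T g)"
    using sT cnt by (intro emeasure_mono sets.countable_UN') auto
  also have "\<dots> = (\<integral>\<^sup>+ g. emeasure lebesgue (T g) \<partial>count_space \<Gamma>)"
  proof (rule emeasure_UN_countable)
    show "disjoint_family_on T \<Gamma>"
      unfolding disjoint_family_on_def
    proof (intro ballI impI)
      fix g h assume gh: "g \<in> \<Gamma>" "h \<in> \<Gamma>" "g \<noteq> h"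
      show "T g \<inter> T h = {}"
      proof (rule ccontr)
        assume "T g \<inter> T h \<noteq> {}"
        then obtain x where "x \<in> T g" "x \<in> T h" by auto
        then have "x - g \<in> G" "x - h \<in> G" unfolding T_def by (metis IntD2 add_diff_cancel_left' imageE)+
        then show False using cov[of x] gh by blast
      qed
    qed
  qed (use sT cnt in auto)
  also have "\<dots> = (\<integral>\<^sup>+ g. emeasure lebesgue (U g) \<partial>count_space \<Gamma>)" by (simp add: eTU)
  also have "\<dots> = emeasure lebesgue (\<Union>g\<in>\<Gamma>. U g)"
  proof (rule emeasure_UN_countable[symmetric])
    show "disjoint_family_on U \<Gamma>"
      unfolding disjoint_family_on_def
    proof (intro ballI impI)
      fix g h assume gh: "g \<in> \<Gamma>" "h \<in> \<Gamma>" "g \<noteq> h"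
      show "U g \<inter> U h = {}"
      proof (rule ccontr)
        assume "U g \<inter> U h \<noteq> {}"
        then obtain x where "x \<in> U g" "x \<in> U h" by auto
        then have "x + g \<in> F" "x + h \<in> F"
          unfolding U_def by (metis IntD1 add.commute add_minus_cancel imageE)+
        then show False using uniq gh by blast
      qed
    qed
  qed (use sU cnt in auto)
  also have "\<dots> \<le> emeasure lebesgue G"
    using FG by (intro emeasure_mono) (auto simp: U_def)
  finally show ?thesis .
qed

text \<open>Cutting and moving works in both directions. Closure under negation turns the tiling
  condition, stated with \<open>x - g\<close>, into the packing condition, stated with
  \<open>x + g\<close>.\<close>

lemma measure_fund_domains_eq:
  fixes F G :: "(real^'m) set"
  assumes cnt: "countable \<Gamma>" and neg: "\<And>g. g \<in> \<Gamma> \<Longrightarrow> - g \<in> \<Gamma>"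
    and F: "F \<in> sets lebesgue" "\<And>x. \<exists>!g. g \<in> \<Gamma> \<and> x - g \<in> F"
    and G: "G \<in> sets lebesgue" "\<And>x. \<exists>!g. g \<in> \<Gamma> \<and> x - g \<in> G"
  shows "measure lebesgue F = measure lebesgue G"
proof -
  have u: "g = h" if H: "\<And>x. \<exists>!g. g \<in> \<Gamma> \<and> x - g \<in> H" "g \<in> \<Gamma>" "h \<in> \<Gamma>" "x + g \<in> H" "x + h \<in> H"
    for x g h and H :: "(real^'m) set"
  proof -
    have "- g \<in> \<Gamma> \<and> x - - g \<in> H" "- h \<in> \<Gamma> \<and> x - - h \<in> H" using H(2-) neg by simp_all
    then have "-g = -h" using H(1)[of x] by blast
    then show ?thesis by simp
  qed
  have "emeasure lebesgue F \<le> emeasure lebesgue G"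
  proof (rule emeasure_tiles_le[OF cnt F(1) G(1)])
    show "\<exists>!g. g \<in> \<Gamma> \<and> x - g \<in> G" for x by (rule G(2))
    show "g = h" if "g \<in> \<Gamma>" "h \<in> \<Gamma>" "x + g \<in> F" "x + h \<in> F" for x g h by (rule u[OF F(2) that])
  qed
  moreover have "emeasure lebesgue G \<le> emeasure lebesgue F"
  proof (rule emeasure_tiles_le[OF cnt G(1) F(1)])
    show "\<exists>!g. g \<in> \<Gamma> \<and> x - g \<in> F" for x by (rule F(2))
    show "g = h" if "g \<in> \<Gamma>" "h \<in> \<Gamma>" "x + g \<in> G" "x + h \<in> G" for x g h by (rule u[OF G(2) that])
  qed
  ultimately show ?thesis unfolding measure_def by (metis antisym)
qed

text \<open>The translates of \<^term>\<open>fund_box b\<close> by the lattice points in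
  \<^term>\<open>fund_box b0\<close> form a second fundamental domain of the sublattice.\<close>

lemma det_sublattice:
  fixes b b0 :: "'m \<Rightarrow> real^'m"
  assumes inv: "invertible (eigmat b)" and inv0: "invertible (eigmat b0)"
    and sub: "\<And>i. b0 i \<in> zspan b"
    and fin: "finite (zspan b \<inter> fund_box b0)"
  shows "\<bar>det (eigmat b0)\<bar> = real (card (zspan b \<inter> fund_box b0)) * \<bar>det (eigmat b)\<bar>"
proof -
  define D where "D = zspan b \<inter> fund_box b0"
  have sub': "zspan b0 \<subseteq> zspan b" by (rule zspan_subset[OF zspan_0 zspan_diff sub])
  define G where "G = (\<Union>d\<in>D. (+) d ` fund_box b)"
  have uD: "\<exists>!h. h \<in> zspan b0 \<and> g - h \<in> D" if "g \<in> zspan b" for g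

  proof -
    obtain h where h: "h \<in> zspan b0" "g - h \<in> fund_box b0"
      and u: "\<And>k. k \<in> zspan b0 \<Longrightarrow> g - k \<in> fund_box b0 \<Longrightarrow> k = h"
      using fund_box_tiling[OF inv0, of g] by blast
    have "g - h \<in> zspan b" using h sub' zspan_diff[OF that] by blast
    with h u show ?thesis unfolding D_def by blast
  qed
  have disj: "disjoint_family_on (\<lambda>d. (+) d ` fund_box b) D"
    unfolding disjoint_family_on_def
  proof (intro ballI impI)
    fix g h assume gh: "g \<in> D" "h \<in> D" "g \<noteq> h"
    show "(+) g ` fund_box b \<inter> (+) h ` fund_box b = {}"
    proof (rule ccontr)
      assume "(+) g ` fund_box b \<inter> (+) h ` fund_box b \<noteq> {}"
      then obtain x where "x \<in> (+) g ` fund_box b" "x \<in> (+) h ` fund_box b" by auto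
      then have "x - g \<in> fund_box b" "x - h \<in> fund_box b" by (metis add_diff_cancel_left' imageE)+
      then show False using fund_box_tiling[OF inv, of x] gh unfolding D_def by blast
    qed
  qed
  have lm: "(+) d ` fund_box b \<in> lmeasurable" for d
    by (intro measurable_translation fund_box_lmeasurable)
  have "measure lebesgue G = (\<Sum>d\<in>D. measure lebesgue ((+) d ` fund_box b))"
    unfolding G_def
  proof (rule measure_finite_Union[OF _ _ disj])
    show "finite D" using fin by (simp add: D_def)
    show "(\<lambda>d. (+) d ` fund_box b) ` D \<subseteq> sets lebesgue" using fmeasurableD[OF lm] by blast
    show "emeasure lebesgue ((+) d ` fund_box b) \<noteq> \<infinity>" for d using fmeasurableD2[OF lm] by simp
  qed
  also have "\<dots> = real (card D) * \<bar>det (eigmat b)\<bar>"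
    by (simp add: measure_translation measure_fund_box)
  finally have mG: "measure lebesgue G = real (card D) * \<bar>det (eigmat b)\<bar>" .
  have "measure lebesgue (fund_box b0) = measure lebesgue G"
  proof (rule measure_fund_domains_eq[OF countable_zspan[of b0] zspan_minus])
    show "fund_box b0 \<in> sets lebesgue" using fund_box_lmeasurable by blast
    show "\<exists>!g. g \<in> zspan b0 \<and> x - g \<in> fund_box b0" for x by (rule fund_box_tiling[OF inv0])
    show "G \<in> sets lebesgue" unfolding G_def
      by (rule sets.finite_UN) (use fin fmeasurableD[OF lm] in \<open>simp_all add: D_def\<close>)
    show "\<exists>!h. h \<in> zspan b0 \<and> x - h \<in> G" for x
    proof -
      \<comment> \<open>Division with remainder twice: \<open>x\<close> by the lattice, then the
        quotient \<open>g\<close> by the sublattice, with remainder in \<open>D\<close>.\<close>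
      obtain g where g: "g \<in> zspan b" "x - g \<in> fund_box b"
        and gu: "\<And>g'. g' \<in> zspan b \<Longrightarrow> x - g' \<in> fund_box b \<Longrightarrow> g' = g"
        using fund_box_tiling[OF inv, of x] by blast
      obtain h where h: "h \<in> zspan b0" "g - h \<in> D"
        and hu: "\<And>h'. h' \<in> zspan b0 \<Longrightarrow> g - h' \<in> D \<Longrightarrow> h' = h"
        using uD[OF g(1)] by blast
      show ?thesis
      proof (rule ex1I[where a=h])
        have "x - h \<in> (+) (g - h) ` fund_box b" using g(2) by (auto intro!: image_eqI[of _ _ "x - g"])
        then show "h \<in> zspan b0 \<and> x - h \<in> G" using h unfolding G_def by blast
      next
        fix h' assume h': "h' \<in> zspan b0 \<and> x - h' \<in> G"
        then obtain d y where d: "d \<in> D" "x - h' = d + y" "y \<in> fund_box b" unfolding G_def by blast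
        then have "d + h' \<in> zspan b" using h' sub' zspan_add[of d b h'] unfolding D_def by auto
        moreover have "x - (d + h') = y" using d(2) by (simp add: algebra_simps)
        ultimately have "d + h' = g" using d(3) gu[of "d + h'"] by simp
        then have "g - h' = d" by auto
        then show "h' = h" using hu[of h'] h' d by simp
      qed
    qed
  qed
  then show ?thesis by (simp add: measure_fund_box mG D_def)
qed

text \<open>Bridges two ways to express an index: by cosets, as in the definition of
  \<open>unit_index\<close>, and by lattice points in a box, as in the volume comparison
  \<open>det_sublattice\<close>.\<close>

lemma fund_box_coset_reps:
  assumes L: "\<And>x y. x \<in> L \<Longrightarrow> y \<in> L \<Longrightarrow> x - y \<in> L" "\<And>i. b0 i \<in> L" "0 \<in> L"
    and inv0: "invertible (eigmat b0)"
  shows "bij_betw (\<lambda>d. {y. y - d \<in> zspan b0}) (L \<inter> fund_box b0) ((\<lambda>x. {y. y - x \<in> zspan b0}) ` L)"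
proof -
  have sub: "zspan b0 \<subseteq> L" by (rule zspan_subset[OF L(3,1,2)])
  have eq: "{y. y - x \<in> zspan b0} = {y. y - z \<in> zspan b0}" if "x - z \<in> zspan b0" for x z
  proof (intro set_eqI iffI; simp)
    show "y - z \<in> zspan b0" if "y - x \<in> zspan b0" for y
      using zspan_add[OF that \<open>x - z \<in> zspan b0\<close>] by simp
    show "y - x \<in> zspan b0" if "y - z \<in> zspan b0" for y
      using zspan_diff[OF that \<open>x - z \<in> zspan b0\<close>] by simp
  qed
  show ?thesis
    unfolding bij_betw_def
  proof (intro conjI inj_onI equalityI subsetI)
    fix d d' assume d: "d \<in> L \<inter> fund_box b0" "d' \<in> L \<inter> fund_box b0"
      and e: "{y. y - d \<in> zspan b0} = {y. y - d' \<in> zspan b0}"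
    have "d - d \<in> zspan b0" using zspan_0 by simp
    then have "d - d' \<in> zspan b0" using e by blast
    moreover have "d - 0 \<in> fund_box b0" "d - (d - d') \<in> fund_box b0" using d by auto
    ultimately have "d - d' = 0" using fund_box_tiling[OF inv0, of d] zspan_0 by blast
    then show "d = d'" by simp
  next
    fix C assume "C \<in> (\<lambda>x. {y. y - x \<in> zspan b0}) ` L"
    then obtain x where x: "x \<in> L" "C = {y. y - x \<in> zspan b0}" by auto
    obtain g where g: "g \<in> zspan b0" "x - g \<in> fund_box b0" using fund_box_tiling[OF inv0, of x] by blast
    have "C = {y. y - (x - g) \<in> zspan b0}" unfolding x using g by (intro eq) simp
    moreover have "x - g \<in> L \<inter> fund_box b0" using L(1)[OF x(1) subsetD[OF sub g(1)]] g(2) by simp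
    ultimately show "C \<in> (\<lambda>d. {y. y - d \<in> zspan b0}) ` (L \<inter> fund_box b0)" by blast
  qed auto
qed

text \<open>Serves twice: for the inclusion of integer matrices into real ones, and for evaluating
  the polynomial entries of a characteristic matrix at a point.\<close>

lemma det_hom:
  fixes h :: "'a::comm_ring_1 \<Rightarrow> 'b::comm_ring_1" and M :: "'a^'n::finite^'n"
  assumes add: "\<And>x y. h (x + y) = h x + h y" and mult: "\<And>x y. h (x * y) = h x * h y" and one: "h 1 = 1"
  shows "h (det M) = det (\<chi> i j. h (M $ i $ j))"
proof -
  have zero: "h 0 = 0" using add[of 0 0] by simp
  have neg: "h (- x) = - h x" for x using add[of x "- x"] zero by (simp add: eq_neg_iff_add_eq_0 add.commute)
  have hs: "h (sum f S) = (\<Sum>x\<in>S. h (f x))" for f :: "('n \<Rightarrow> 'n) \<Rightarrow> 'a" and S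
    by (induction S rule: infinite_finite_induct) (simp_all add: zero add)
  have hp: "h (prod f S) = (\<Prod>x\<in>S. h (f x))" for f :: "'n \<Rightarrow> 'a" and S
    by (induction S rule: infinite_finite_induct) (simp_all add: one mult)
  have sgn: "h (of_int (sign p)) = of_int (sign p)" for p :: "'n \<Rightarrow> 'n"
    by (cases p rule: sign_cases) (simp_all add: one neg)
  show ?thesis by (simp add: det_def hs mult hp sgn)
qed

lemma det_rmat: "det (rmat M) = real_of_int (det M)"
  using det_hom[of real_of_int M] by (simp add: rmat_def)

lemma rmat_mult: "rmat (M ** N) = rmat M ** rmat N"
  by (simp add: vec_eq_iff rmat_def matrix_matrix_mult_def)

lemma rmat_1: "rmat (mat 1) = mat 1"
  by (simp add: vec_eq_iff rmat_def mat_def)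

lemma rmat_inject: "rmat M = rmat N \<longleftrightarrow> M = N"
  by (auto simp: vec_eq_iff rmat_def)

text \<open>A tuple of lattice vectors of least nonzero \<^const>\<open>det\<close> is a basis: otherwise some lattice vector
  in its fundamental box could replace one of its members. The minimum exists because the lattice
  has bounded denominators with respect to \<^term>\<open>b0\<close>.\<close>

theorem discrete_subgroup_basis:
  fixes L :: "(real^'m::finite) set" and b0 :: "'m \<Rightarrow> real^'m"
  assumes L0: "0 \<in> L" and Ld: "\<And>x y. x \<in> L \<Longrightarrow> y \<in> L \<Longrightarrow> x - y \<in> L"
    and fin: "\<And>C. finite {x \<in> L. norm x \<le> C}"
    and b0: "\<And>i. b0 i \<in> L" and inv0: "invertible (eigmat b0)"
  shows "\<exists>b. (\<forall>i. b i \<in> L) \<and> invertible (eigmat b) \<and> L = zspan b"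
proof -
  have finbox: "finite (L \<inter> fund_box b0)"
  proof -
    obtain C where "\<And>x. x \<in> fund_box b0 \<Longrightarrow> norm x \<le> C" using bounded_fund_box[of b0] by (auto simp: bounded_iff)
    then have "L \<inter> fund_box b0 \<subseteq> {x \<in> L. norm x \<le> C}" by auto
    then show ?thesis using fin finite_subset by blast
  qed
  define N where "N = card (L \<inter> fund_box b0)"
  \<comment> \<open>A common denominator: among the multiples of \<open>x\<close> by 0, ...,
    \<open>N\<close> two have equal remainders modulo \<open>b0\<close>, so \<open>d\<close> times
    \<open>x\<close> lies in \<open>zspan b0\<close> for some \<open>d\<close> between 1 and
    \<open>N\<close>, and such a \<open>d\<close> divides \<open>fact N\<close>.\<close>
  define q where "q = (fact N :: nat)"
  have q0: "q > 0" by (simp add: q_def)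
  have sub0: "zspan b0 \<subseteq> L" by (rule zspan_subset[OF L0 Ld b0])
  have den: "real q *\<^sub>R x \<in> zspan b0" if x: "x \<in> L" for x
  proof -
    define g where "g k = (THE g. g \<in> zspan b0 \<and> real k *\<^sub>R x - g \<in> fund_box b0)" for k :: nat
    have g: "g k \<in> zspan b0 \<and> real k *\<^sub>R x - g k \<in> fund_box b0" for k
      unfolding g_def by (rule theI'[OF fund_box_tiling[OF inv0]])
    define f where "f k = real k *\<^sub>R x - g k" for k
    have fP: "f k \<in> L \<inter> fund_box b0" for k
      using g[of k] Ld[OF subgroup_scaleR_int[OF L0 Ld x, of "int k"] subsetD[OF sub0], of "g k"]
      by (simp add: f_def)
    have "\<not> inj_on f {0..N}"
    proof
      assume "inj_on f {0..N}"
      then have "card {0..N} \<le> card (L \<inter> fund_box b0)"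
        using fP finbox by (intro card_inj_on_le) auto
      then show False by (simp add: N_def)
    qed
    then obtain i j where ij: "i < j" "j \<le> N" "f i = f j"
      unfolding inj_on_def by (metis atLeastAtMost_iff linorder_neqE_nat)
    define d where "d = j - i"
    have d: "1 \<le> d" "d \<le> N" using ij by (auto simp: d_def)
    have "real d *\<^sub>R x = g j - g i"
      using ij by (simp add: f_def d_def of_nat_diff algebra_simps)
    then have dz: "real d *\<^sub>R x \<in> zspan b0" using g zspan_diff by metis
    obtain e where e: "q = d * e" using d dvd_fact[of d N] by (auto simp: q_def)
    have "real q *\<^sub>R x = real_of_int (int e) *\<^sub>R (real d *\<^sub>R x)" by (simp add: e mult.commute)
    then show ?thesis using subgroup_scaleR_int[OF zspan_0 zspan_diff dz, of "int e"] by metis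
  qed
  \<comment> \<open>For tuples from \<open>L\<close> this is a natural number: after scaling by
    \<open>q\<close> the tuple has integer coordinates with respect to \<open>b0\<close>, and
    \<open>Q b\<close> is the absolute determinant of that integer matrix. Hence a minimum
    exists.\<close>
  define Q where "Q b = \<bar>det (eigmat b)\<bar> * real q ^ CARD('m) / \<bar>det (eigmat b0)\<bar>" for b :: "'m \<Rightarrow> real^'m"
  define h where "h b = nat \<lfloor>Q b\<rfloor>" for b
  have d0: "det (eigmat b0) \<noteq> 0" using inv0 invertible_det_nz by blast
  have h: "real (h b) = Q b" if b: "\<And>i. b i \<in> L" for b
  proof -
    have "\<exists>m. real q *\<^sub>R b i = eigmat b0 *v int_vec m" for i
      using den[OF b[of i]] by (auto simp: zspan_def)
    then obtain m where m: "\<And>i. real q *\<^sub>R b i = eigmat b0 *v int_vec (m i)" by metis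
    have "real q *\<^sub>R eigmat b = eigmat b0 ** rmat (\<chi> i j. m j $ i)"
    proof -
      have "real q *\<^sub>R eigmat b = eigmat (\<lambda>j. eigmat b0 *v int_vec (m j))"
        unfolding m[symmetric] by (simp add: eigmat_def vec_eq_iff)
      also have "\<dots> = eigmat b0 ** eigmat (\<lambda>j. int_vec (m j))" by (simp add: eigmat_mult)
      also have "eigmat (\<lambda>j. int_vec (m j)) = rmat (\<chi> i j. m j $ i)" by (simp add: eigmat_def rmat_def vec_eq_iff)
      finally show ?thesis .
    qed
    moreover have "det (real q *\<^sub>R eigmat b) = real q ^ CARD('m) * det (eigmat b)"
    proof -
      have "real q *\<^sub>R eigmat b = (\<chi> i. real q *s eigmat b $ i)" by (simp add: vec_eq_iff)
      then show ?thesis using det_rows_mul[of "\<lambda>_. real q" "\<lambda>i. eigmat b $ i"] by (simp)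
    qed
    ultimately have "real q ^ CARD('m) * det (eigmat b) = det (eigmat b0) * real_of_int (det (\<chi> i j. m j $ i))"
      by (simp add: det_mul det_rmat)
    then have "\<bar>real q ^ CARD('m) * det (eigmat b)\<bar> = \<bar>det (eigmat b0)\<bar> * \<bar>real_of_int (det (\<chi> i j. m j $ i))\<bar>"
      by (simp only: abs_mult)
    then have "Q b = real_of_int \<bar>det (\<chi> i j. m j $ i)\<bar>"
      using d0 by (simp add: Q_def abs_mult field_simps)
    then show ?thesis unfolding h_def by simp
  qed
  obtain b where b: "\<And>i. b i \<in> L" "det (eigmat b) \<noteq> 0"
    and bmin: "\<And>b'. (\<forall>i. b' i \<in> L) \<Longrightarrow> det (eigmat b') \<noteq> 0 \<Longrightarrow> h b \<le> h b'"
    using ex_has_least_nat[of "\<lambda>b. (\<forall>i. b i \<in> L) \<and> det (eigmat b) \<noteq> 0" b0 h] b0 d0 by blast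
  have invb: "invertible (eigmat b)" using b(2) invertible_det_nz by blast
  have sub: "zspan b \<subseteq> L" by (rule zspan_subset[OF L0 Ld b(1)])
  have "L \<subseteq> zspan b"
  proof
    fix x assume x: "x \<in> L"
    obtain g where g: "g \<in> zspan b" "x - g \<in> fund_box b" using fund_box_tiling[OF invb, of x] by blast
    then obtain c where c: "c \<in> tcube" "x - g = eigmat b *v c" by (auto simp: fund_box_def)
    have "c $ k = 0" for k
    proof (rule ccontr)
      assume ck: "c $ k \<noteq> 0"
      have "0 \<le> c $ k" "c $ k < 1" using c by (auto simp: tcube_def)
      define b' where "b' = b(k := x - g)"
      have "x - g \<in> L" using x g sub Ld by blast
      then have b'L: "\<And>i. b' i \<in> L" using b(1) by (simp add: b'_def)
      \<comment> \<open>By Cramer's rule the replacement multiplies the determinant by the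
        coordinate \<open>c $ k\<close>, which is strictly between 0 and 1.\<close>
      have "eigmat b' = (\<chi> i j. if j = k then (eigmat b *v c) $ i else eigmat b $ i $ j)"
        by (auto simp: eigmat_def vec_eq_iff b'_def c(2)[unfolded eigmat_def])
      then have db': "det (eigmat b') = c $ k * det (eigmat b)" by (simp add: cramer_lemma)
      then have nz: "det (eigmat b') \<noteq> 0" using ck b(2) by simp
      have "Q b' = c $ k * Q b" using db' \<open>0 \<le> c $ k\<close> by (simp add: Q_def abs_mult)
      moreover have "Q b > 0" using b(2) q0 d0 by (simp add: Q_def)
      ultimately have "Q b' < Q b" using \<open>c $ k < 1\<close> by simp
      then have "h b' < h b" using h[of b, OF b(1)] h[of b', OF b'L] by linarith
      then show False using bmin b'L nz by force
    qed
    then have "c = 0" by (simp add: vec_eq_iff)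
    then have "x = g" using c by simp
    then show "x \<in> zspan b" using g by simp
  qed
  then show ?thesis using b(1) invb sub by blast
qed

section \<open>Norms and their duals\<close>

definition dual_norm :: "('a::euclidean_space \<Rightarrow> real) \<Rightarrow> 'a \<Rightarrow> real" where
  "dual_norm p a = Sup ((\<lambda>x. a \<bullet> x) ` {x. p x \<le> 1})"

lemma is_normD:
  assumes "is_norm p"
  shows "0 \<le> p x" "p x = 0 \<Longrightarrow> x = 0" "p (c *\<^sub>R x) = \<bar>c\<bar> * p x" "p (x + y) \<le> p x + p y"
    "p 0 = 0" "p (- x) = p x" "p (x - y) \<le> p x + p y"
proof -
  show 1: "0 \<le> p x" "p x = 0 \<Longrightarrow> x = 0" "p (c *\<^sub>R x) = \<bar>c\<bar> * p x" "p (x + y) \<le> p x + p y"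
    using assms by (auto simp: is_norm_def)
  have sc: "p (c *\<^sub>R x) = \<bar>c\<bar> * p x" for c x using assms by (auto simp: is_norm_def)
  show "p 0 = 0" using sc[of 0 0] by simp
  have m: "p (- x) = p x" for x using sc[of "-1" x] by simp
  show "p (- x) = p x" by (rule m)
  have "p (x + (- y)) \<le> p x + p (- y)" using assms unfolding is_norm_def by blast
  then show "p (x - y) \<le> p x + p y" using m[of y] by simp
qed

lemma is_norm_sum_le:
  assumes "is_norm p" shows "p (sum f S) \<le> (\<Sum>i\<in>S. p (f i))"
proof (induction S rule: infinite_finite_induct)
  case (insert x S)
  then show ?case using is_normD(4)[OF assms, of "f x" "sum f S"] by simp
qed (simp_all add: is_normD(5)[OF assms])

lemma is_norm_upper:
  fixes p :: "'a::euclidean_space \<Rightarrow> real"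
  assumes p: "is_norm p"
  obtains K where "K > 0" "\<And>x. p x \<le> K * norm x"
proof
  define K where "K = 1 + (\<Sum>b\<in>(Basis::'a set). p b)"
  show "K > 0" unfolding K_def using is_normD(1)[OF p] by (simp add: add_pos_nonneg sum_nonneg)
  fix x :: 'a
  have "p x = p (\<Sum>b\<in>Basis. (x \<bullet> b) *\<^sub>R b)" by (simp add: euclidean_representation)
  also have "\<dots> \<le> (\<Sum>b\<in>Basis. p ((x \<bullet> b) *\<^sub>R b))" by (rule is_norm_sum_le[OF p])
  also have "\<dots> = (\<Sum>b\<in>Basis. \<bar>x \<bullet> b\<bar> * p b)" by (simp add: is_normD(3)[OF p])
  also have "\<dots> \<le> (\<Sum>b\<in>Basis. norm x * p b)"
    by (intro sum_mono mult_right_mono Basis_le_norm is_normD(1)[OF p])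
  also have "\<dots> = norm x * (\<Sum>b\<in>(Basis::'a set). p b)" by (simp add: sum_distrib_left)
  also have "\<dots> \<le> K * norm x" by (simp add: K_def algebra_simps)
  finally show "p x \<le> K * norm x" .
qed

lemma is_norm_continuous:
  fixes p :: "'a::euclidean_space \<Rightarrow> real"
  assumes p: "is_norm p"
  shows "continuous_on S p"
proof -
  obtain K where K: "K > 0" "\<And>x. p x \<le> K * norm x" using is_norm_upper[OF p] by metis
  have "dist (p x) (p y) \<le> K * dist x y" for x y
  proof -
    have "p x \<le> p y + p (x - y)" using is_normD(4)[OF p, of y "x - y"] by simp
    moreover have "p y \<le> p x + p (x - y)" using is_normD(7)[OF p, of x "x - y"] by simp
    ultimately have "\<bar>p x - p y\<bar> \<le> p (x - y)" by linarith
    also have "\<dots> \<le> K * norm (x - y)" by (rule K)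
    finally show ?thesis by (simp add: dist_norm)
  qed
  then have "K-lipschitz_on S p" using K(1) by (intro lipschitz_onI) auto
  then show ?thesis by (rule lipschitz_on_continuous_on)
qed

lemma is_norm_lower:
  fixes p :: "'a::euclidean_space \<Rightarrow> real"
  assumes p: "is_norm p"
  obtains k where "k > 0" "\<And>x. k * norm x \<le> p x"
proof -
  obtain z :: 'a where z: "norm z = 1" "\<And>x. norm x = 1 \<Longrightarrow> p z \<le> p x"
  proof -
    have "sphere 0 1 \<noteq> ({} :: 'a set)" by simp
    then obtain z :: 'a where "z \<in> sphere 0 1" "\<forall>y\<in>sphere 0 1. p z \<le> p y"
      using continuous_attains_inf[OF compact_sphere, of 0 1 p] is_norm_continuous[OF p] by blast
    then show ?thesis by (intro that[of z]) auto
  qed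
  have pz: "p z > 0" using is_normD(1,2)[OF p, of z] z(1) by force
  show ?thesis
  proof (rule that[OF pz])
    fix x :: 'a
    show "p z * norm x \<le> p x"
    proof (cases "x = 0")
      case False
      have "p z \<le> p ((1 / norm x) *\<^sub>R x)" using False by (intro z) simp
      also have "\<dots> = p x / norm x" by (simp add: is_normD(3)[OF p])
      finally show ?thesis using False by (simp add: field_simps)
    qed (simp add: is_normD(5)[OF p])
  qed
qed

lemma compact_norm_ball:
  fixes p :: "'a::euclidean_space \<Rightarrow> real"
  assumes p: "is_norm p"
  shows "compact {x. p x \<le> s}"
proof -
  obtain k where k: "k > 0" "\<And>x. k * norm x \<le> p x" using is_norm_lower[OF p] by metis
  have "norm x \<le> s / k" if "p x \<le> s" for x
    using order_trans[OF k(2)[of x] that] k(1) by (simp add: field_simps)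
  then have "bounded {x. p x \<le> s}" by (auto simp: bounded_iff)
  moreover have "closed {x. p x \<le> s}"
    by (intro closed_Collect_le is_norm_continuous[OF p] continuous_intros)
  ultimately show ?thesis by (simp add: compact_eq_bounded_closed)
qed

lemma dual_norm_attained:
  assumes p: "is_norm p"
  obtains x where "p x \<le> 1" "a \<bullet> x = dual_norm p a" "\<And>y. p y \<le> 1 \<Longrightarrow> a \<bullet> y \<le> dual_norm p a"
proof -
  have "{x. p x \<le> 1} \<noteq> {}" using is_normD(5)[OF p] by (auto intro!: exI[of _ 0])
  moreover have "continuous_on {x. p x \<le> 1} (\<lambda>x. a \<bullet> x)" by (intro continuous_intros)
  ultimately obtain x where x: "p x \<le> 1" "\<And>y. p y \<le> 1 \<Longrightarrow> a \<bullet> y \<le> a \<bullet> x"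
    using continuous_attains_sup[OF compact_norm_ball[OF p, of 1], of "\<lambda>x. a \<bullet> x"] by blast
  have "dual_norm p a = a \<bullet> x" unfolding dual_norm_def
    by (rule cSup_eq_maximum) (use x in auto)
  then show ?thesis using that[of x] x by simp
qed

lemma dual_norm_nonneg:
  assumes p: "is_norm p" shows "0 \<le> dual_norm p a"
proof -
  obtain x where "\<And>y. p y \<le> 1 \<Longrightarrow> a \<bullet> y \<le> dual_norm p a" using dual_norm_attained[OF p] by metis
  from this[of 0] show ?thesis by (simp add: is_normD(5)[OF p])
qed

lemma inner_le_dual_norm:
  assumes p: "is_norm p" shows "a \<bullet> x \<le> p x * dual_norm p a"
proof (cases "x = 0")
  case False
  obtain y where D: "\<And>y. p y \<le> 1 \<Longrightarrow> a \<bullet> y \<le> dual_norm p a" using dual_norm_attained[OF p] by metis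
  have px: "p x > 0" using is_normD(1,2)[OF p, of x] False by force
  have "p ((1 / p x) *\<^sub>R x) \<le> 1" using px by (simp add: is_normD(3)[OF p])
  from D[OF this] show ?thesis using px by (simp add: field_simps)
qed (simp add: is_normD(5)[OF p])

lemma inner_le_dual_norm_ball:
  assumes p: "is_norm p" and "p x \<le> s" shows "a \<bullet> x \<le> s * dual_norm p a"
  using inner_le_dual_norm[OF p, of a x] mult_right_mono[OF assms(2) dual_norm_nonneg[OF p, of a]] by linarith

lemma dual_norm_eqI:
  assumes p: "is_norm p" and "\<And>x. p x \<le> 1 \<Longrightarrow> a \<bullet> x \<le> c" and "p y \<le> 1" "a \<bullet> y = c"
  shows "dual_norm p a = c"
  unfolding dual_norm_def by (rule cSup_eq_maximum) (use assms in auto)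

lemma dual_norm_minus:
  assumes p: "is_norm p" shows "dual_norm p (- a) = dual_norm p a"
proof -
  obtain x where x: "p x \<le> 1" "a \<bullet> x = dual_norm p a" "\<And>y. p y \<le> 1 \<Longrightarrow> a \<bullet> y \<le> dual_norm p a"
    using dual_norm_attained[OF p] by metis
  show ?thesis
  proof (rule dual_norm_eqI[OF p, of _ _ "- x"])
    show "- a \<bullet> y \<le> dual_norm p a" if "p y \<le> 1" for y
      using x(3)[of "- y"] that by (simp add: is_normD(6)[OF p])
  qed (use x in \<open>simp_all add: is_normD(6)[OF p]\<close>)
qed

section \<open>The action in an eigenbasis\<close>

abbreviation eig_coord :: "('n::finite \<Rightarrow> real^'n) \<Rightarrow> real^'n \<Rightarrow> real^'n" where
  "eig_coord v x \<equiv> matrix_inv (eigmat v) *v x"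

lemma eig_coord_apply:
  assumes inv: "invertible (eigmat v)" and M: "\<And>j. M *v v j = c j *\<^sub>R v j"
  shows "eig_coord v (M *v x) $ j = c j * eig_coord v x $ j"
proof -
  let ?z = "eig_coord v x"
  have MV: "M *v (eigmat v *v z) = eigmat (\<lambda>j. c j *\<^sub>R v j) *v z" for z
    by (simp only: matrix_vector_mul_assoc eigmat_mult M)
  have "M *v x = M *v (eigmat v *v ?z)" by (simp add: matrix_inv_mult_vec[OF inv])
  also have "\<dots> = eigmat (\<lambda>j. c j *\<^sub>R v j) *v ?z"
    by (rule MV)
  also have "\<dots> = eigmat v *v (\<chi> j. c j * ?z $ j)"
    by (simp add: eigmat_mult_vec mult.commute)
  finally have "eig_coord v (M *v x) = (\<chi> j. c j * ?z $ j)"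
    by (simp add: matrix_inv_mult_vec[OF inv])
  then show ?thesis by simp
qed

lemma matrix_eq_on_eigenbasis:
  fixes M N :: "real^'n::finite^'n"
  assumes inv: "invertible (eigmat v)" and "\<And>j. M *v v j = N *v v j"
  shows "M = N"
proof -
  have "M ** eigmat v = N ** eigmat v" by (simp add: eigmat_mult assms(2))
  then have "M ** (eigmat v ** matrix_inv (eigmat v)) = N ** (eigmat v ** matrix_inv (eigmat v))"
    by (simp add: matrix_mul_assoc)
  then show ?thesis by (simp add: matrix_inv_right[OF inv])
qed

lemma eigvec_nonzero:
  assumes "invertible (eigmat v)" shows "v j \<noteq> 0"
proof
  assume "v j = 0"
  then have "axis j 1 = (0 :: real^'a)"
    using matrix_inv_mult_vec(2)[OF assms, of "axis j 1"] by (simp add: eigmat_axis)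
  then show False by (simp add: axis_eq_0_iff)
qed

locale torus_action =
  fixes A :: "'m::finite \<Rightarrow> int^'n::finite^'n" and v :: "'n \<Rightarrow> real^'n" and mu :: "'m \<Rightarrow> 'n \<Rightarrow> real"
  assumes A_invertible: "invertible (A i)"
    and eigenbasis: "common_eigenbasis A v mu"
begin

lemma inv_V: "invertible (eigmat v)"
  and A_eig: "rmat (A i) *v v j = mu i j *\<^sub>R v j"
  using eigenbasis by (auto simp: common_eigenbasis_def)

definition eigval :: "int^'m \<Rightarrow> 'n \<Rightarrow> real" where
  "eigval t j = (\<Prod>i\<in>UNIV. mu i j powi (t $ i))"

text \<open>The j-th Lyapunov functional as a vector: its inner product with
  \<open>int_vec t\<close> is the logarithm of \<open>\<bar>eigval t j\<bar>\<close>.\<close>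

definition lyap :: "'n \<Rightarrow> real^'m" where
  "lyap j = (\<chi> i. ln \<bar>mu i j\<bar>)"

lemma inverse_eig: "rmat (matrix_inv (A i)) *v v j = inverse (mu i j) *\<^sub>R v j"
  and mu_nonzero: "mu i j \<noteq> 0"
proof -
  have "rmat (matrix_inv (A i)) *v (rmat (A i) *v v j) = v j"
    by (simp add: matrix_vector_mul_assoc rmat_mult[symmetric] matrix_inv_left[OF A_invertible] rmat_1)
  then have e: "mu i j *\<^sub>R (rmat (matrix_inv (A i)) *v v j) = v j"
    by (simp add: A_eig scaleR_matrix_vector_assoc matrix_vector_mult_scaleR)
  then show nz: "mu i j \<noteq> 0" using eigvec_nonzero[OF inv_V, of j] by auto
  have "inverse (mu i j) *\<^sub>R (mu i j *\<^sub>R (rmat (matrix_inv (A i)) *v v j)) = inverse (mu i j) *\<^sub>R v j"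
    by (simp add: e)
  then show "rmat (matrix_inv (A i)) *v v j = inverse (mu i j) *\<^sub>R v j" using nz by simp
qed

lemma mpow_nat_eig:
  assumes "rmat M *v w = c *\<^sub>R w" shows "rmat (mpow_nat M k) *v w = (c ^ k) *\<^sub>R w"
  by (induction k) (simp_all add: rmat_1 rmat_mult matrix_vector_mul_assoc[symmetric] assms matrix_vector_mult_scaleR mult.commute)

lemma mpow_int_eig: "rmat (mpow_int (A i) k) *v v j = (mu i j powi k) *\<^sub>R v j"
  by (simp add: mpow_int_def power_int_def mpow_nat_eig[OF A_eig] mpow_nat_eig[OF inverse_eig])

lemma act_mat_eig: "rmat (act_mat A t) *v v j = eigval t j *\<^sub>R v j"
proof -
  let ?f = "\<lambda>i M. mpow_int (A i) (t $ i) ** M"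
  have comm: "mpow_int (A i) k ** mpow_int (A i') k' = mpow_int (A i') k' ** mpow_int (A i) k" for i i' k k'
    unfolding rmat_inject[symmetric]
    by (rule matrix_eq_on_eigenbasis[OF inv_V])
       (simp add: rmat_mult matrix_vector_mul_assoc[symmetric] mpow_int_eig matrix_vector_mult_scaleR mult.commute)
  interpret comp_fun_commute ?f
  proof
    show "?f i \<circ> ?f i' = ?f i' \<circ> ?f i" for i i'
      using comm[of i "t $ i" i' "t $ i'"] by (simp add: fun_eq_iff matrix_mul_assoc)
  qed
  have "rmat (Finite_Set.fold ?f (mat 1) S) *v v j = (\<Prod>i\<in>S. mu i j powi (t $ i)) *\<^sub>R v j" if "finite S" for S
    using that
    by induction (simp_all add: rmat_1 rmat_mult matrix_vector_mul_assoc[symmetric] mpow_int_eig matrix_vector_mult_scaleR mult.commute)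
  then show ?thesis unfolding act_mat_def eigval_def by simp
qed

lemma eig_coord_act: "eig_coord v (rmat (act_mat A t) *v x) $ j = eigval t j * eig_coord v x $ j"
  by (rule eig_coord_apply[OF inv_V act_mat_eig])

lemma eig_coord_act_int: "eig_coord v (int_vec (act_mat A t *v m)) $ j = eigval t j * eig_coord v (int_vec m) $ j"
  by (simp add: int_vec_mult eig_coord_act)

lemma eigval_add: "eigval (s + t) j = eigval s j * eigval t j"
  by (simp add: eigval_def power_int_add mu_nonzero prod.distrib)

lemma eigval_0: "eigval 0 j = 1"
  by (simp add: eigval_def)

lemma abs_eigval: "\<bar>eigval t j\<bar> = exp (lyap j \<bullet> int_vec t)"
proof -
  have "\<bar>mu i j powi k\<bar> = exp (real_of_int k * ln \<bar>mu i j\<bar>)" for i k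
    using powr_real_of_int'[of "\<bar>mu i j\<bar>" k] mu_nonzero[of i j]
    by (simp add: powr_def power_int_abs)
  then show ?thesis
    by (simp add: eigval_def abs_prod exp_sum[symmetric] lyap_def inner_vec_def mult.commute)
qed

lemma eig_norm_less_iff: "eig_norm v z < r \<longleftrightarrow> (\<forall>j. \<bar>eig_coord v z $ j\<bar> < r)"
  unfolding eig_norm_def by (subst Max_less_iff) auto

lemma eig_norm_nonneg: "0 \<le> eig_norm v z"
  unfolding eig_norm_def by (rule order_trans[OF abs_ge_zero Max_ge]) auto

lemma tor_act_eq: "\<exists>m. tor_act A t x = rmat (act_mat A t) *v x - int_vec m"
  by (rule exI[of _ "\<chi> j. \<lfloor>(rmat (act_mat A t) *v x) $ j\<rfloor>"]) (simp add: tor_act_def vec_eq_iff frac_def)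

lemma tdist_less_iff: "tdist v x y < r \<longleftrightarrow> (\<exists>m. eig_norm v (x - y - int_vec m) < r)"
proof -
  have "bdd_below {eig_norm v (x - y - (\<chi> j. real_of_int (m $ j))) | m. True}"
    by (rule bdd_belowI[of _ 0]) (auto simp: eig_norm_nonneg)
  then show ?thesis unfolding tdist_def int_vec_def by (subst cInf_less_iff) auto
qed

text \<open>The fractional parts and the infimum over integer translates merge into one unknown
  integer vector, so torus distance at time \<open>t\<close> becomes distance to a lattice point in
  eigencoordinates.\<close>

lemma tdist_act_less_iff:
  "tdist v (tor_act A t x) (tor_act A t y) < r \<longleftrightarrow>
    (\<exists>m. \<forall>j. \<bar>eigval t j * eig_coord v (x - y) $ j - eig_coord v (int_vec m) $ j\<bar> < r)"
proof -
  obtain k l where kl: "tor_act A t x = rmat (act_mat A t) *v x - int_vec k"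
    "tor_act A t y = rmat (act_mat A t) *v y - int_vec l" using tor_act_eq by metis
  have eq: "tor_act A t x - tor_act A t y - int_vec m
      = rmat (act_mat A t) *v (x - y) - int_vec (m + k - l)" for m
    by (simp add: kl matrix_vector_mult_diff_distrib int_vec_add int_vec_diff)
  have "tdist v (tor_act A t x) (tor_act A t y) < r \<longleftrightarrow>
      (\<exists>m. eig_norm v (rmat (act_mat A t) *v (x - y) - int_vec (m + k - l)) < r)"
    by (simp add: tdist_less_iff eq)
  also have "\<dots> \<longleftrightarrow> (\<exists>m. eig_norm v (rmat (act_mat A t) *v (x - y) - int_vec m) < r)"
    by (metis add_diff_cancel diff_add_cancel add_diff_eq)
  finally show ?thesis
    by (simp add: eig_norm_less_iff matrix_vector_mult_diff_distrib[of "matrix_inv (eigmat v)" "rmat _ *v _"] eig_coord_act)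
qed

lemma dF_less_iff:
  assumes "finite F" "F \<noteq> {}"
  shows "dF v A F x y < r \<longleftrightarrow>
    (\<forall>t\<in>F. \<exists>m. \<forall>j. \<bar>eigval t j * eig_coord v (x - y) $ j - eig_coord v (int_vec m) $ j\<bar> < r)"
  unfolding dF_def using assms by (subst Max_less_iff) (auto simp: tdist_act_less_iff)

end

section \<open>Integer points of norm balls and rounding\<close>

lemma finite_Fset:
  assumes p: "is_norm p" shows "finite (Fset p s)"
proof -
  obtain k where k: "k > 0" "\<And>x. k * norm x \<le> p x" using is_norm_lower[OF p] by metis
  have "Fset p s \<subseteq> {t. \<forall>j. \<bar>int_vec t $ j\<bar> \<le> s / k}"
  proof clarify
    fix t j assume "t \<in> Fset p s"
    then have "k * norm (int_vec t) \<le> s" using k(2)[of "int_vec t"] by (simp add: Fset_def int_vec_def)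
    then have "norm (int_vec t) \<le> s / k" using k(1) by (simp add: field_simps)
    then show "\<bar>int_vec t $ j\<bar> \<le> s / k" using component_le_norm_cart[of "int_vec t" j] by linarith
  qed
  then show ?thesis using finite_int_vec_bounded finite_subset by blast
qed

lemma mem_Fset_iff: "t \<in> Fset p s \<longleftrightarrow> p (int_vec t) \<le> s"
  by (simp add: Fset_def int_vec_def)

lemma zero_in_Fset: "is_norm p \<Longrightarrow> 0 \<le> s \<Longrightarrow> 0 \<in> Fset p s"
  by (simp add: mem_Fset_iff int_vec_0 is_normD(5))

text \<open>Equally spaced points of the segment from 0 to \<open>t\<close>, rounded down in every
  coordinate. Since norm balls are convex, such a path leaves a ball around 0 containing
  \<open>t\<close> by a bounded amount only.\<close>

lemma integer_path:
  fixes t :: "int^'m::finite"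
  obtains N and \<tau> :: "nat \<Rightarrow> int^'m" where "\<tau> 0 = 0" "\<tau> N = t"
    "\<And>k i. \<bar>(\<tau> (Suc k) - \<tau> k) $ i\<bar> \<le> 1"
    "\<And>k. k \<le> N \<Longrightarrow> \<exists>r. 0 \<le> r \<and> r \<le> 1 \<and> (\<forall>i. 0 \<le> (r *\<^sub>R int_vec t - int_vec (\<tau> k)) $ i \<and> (r *\<^sub>R int_vec t - int_vec (\<tau> k)) $ i \<le> 1)"
proof -
  \<comment> \<open>\<open>N\<close> bounds every \<open>\<bar>t $ i\<bar>\<close>, so no coordinate
    moves by more than 1 in a step; the added 1 keeps \<open>N\<close> positive when
    \<open>t = 0\<close>.\<close>
  define N where "N = nat (\<Sum>i\<in>UNIV. \<bar>t $ i\<bar>) + 1"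
  define \<tau> where "\<tau> k = (\<chi> i. \<lfloor>real k * real_of_int (t $ i) / real N\<rfloor>)" for k
  have tN: "\<bar>real_of_int (t $ i)\<bar> \<le> real N" for i
  proof -
    have "\<bar>t $ i\<bar> \<le> (\<Sum>i\<in>UNIV. \<bar>t $ i\<bar>)" by (rule member_le_sum) auto
    then show ?thesis unfolding N_def by linarith
  qed
  have N0: "real N > 0" unfolding N_def by simp (simp add: add_pos_nonneg sum_nonneg)
  show ?thesis
  proof (rule that[of \<tau> N])
    show "\<tau> 0 = 0" by (simp add: \<tau>_def vec_eq_iff)
    show "\<tau> N = t" using N0 by (simp add: \<tau>_def vec_eq_iff)
    show "\<bar>(\<tau> (Suc k) - \<tau> k) $ i\<bar> \<le> 1" for k i
    proof -
      have "real (Suc k) * real_of_int (t $ i) / real N = real k * real_of_int (t $ i) / real N + real_of_int (t $ i) / real N"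
        by (simp add: add_divide_distrib algebra_simps)
      moreover have "\<bar>real_of_int (t $ i) / real N\<bar> \<le> 1" using tN[of i] N0 by (simp add: field_simps)
      moreover have "\<bar>\<lfloor>x + y\<rfloor> - \<lfloor>x\<rfloor>\<bar> \<le> 1" if "\<bar>y\<bar> \<le> 1" for x y :: real using that by linarith
      ultimately show ?thesis unfolding \<tau>_def by (simp del: of_nat_Suc)
    qed
    show "\<exists>r. 0 \<le> r \<and> r \<le> 1 \<and> (\<forall>i. 0 \<le> (r *\<^sub>R int_vec t - int_vec (\<tau> k)) $ i \<and> (r *\<^sub>R int_vec t - int_vec (\<tau> k)) $ i \<le> 1)"
      if "k \<le> N" for k
    proof (intro exI[of _ "real k / real N"] conjI allI)
      fix i
      have e: "(real k / real N) * real_of_int (t $ i) = real k * real_of_int (t $ i) / real N" by simp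
      show "0 \<le> ((real k / real N) *\<^sub>R int_vec t - int_vec (\<tau> k)) $ i" unfolding \<tau>_def by simp
      show "((real k / real N) *\<^sub>R int_vec t - int_vec (\<tau> k)) $ i \<le> 1" unfolding \<tau>_def by simp linarith
    qed (use that N0 in auto)
  qed
qed

text \<open>Bounds the cost of rounding a vector down, since the error lies in the unit cube;
  \<open>c\<close> later appears as the shift in \<open>s\<close>.\<close>

lemma is_norm_unit_cube_bound:
  fixes p :: "real^'m::finite \<Rightarrow> real"
  assumes p: "is_norm p"
  obtains c where "c > 0" "\<And>u. (\<And>i. 0 \<le> u $ i \<and> u $ i \<le> 1) \<Longrightarrow> p u \<le> c"
proof -
  obtain K where K: "K > 0" "\<And>x. p x \<le> K * norm x" using is_norm_upper[OF p] by metis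
  show ?thesis
  proof (rule that[of "K * real CARD('m)"])
    show "K * real CARD('m) > 0" using K by simp
    fix u :: "real^'m" assume u: "\<And>i. 0 \<le> u $ i \<and> u $ i \<le> 1"
    have "norm u \<le> (\<Sum>i\<in>UNIV. \<bar>u $ i\<bar>)" by (rule norm_le_l1_cart)
    also have "\<dots> \<le> (\<Sum>i\<in>(UNIV::'m set). 1)" using u by (intro sum_mono) simp
    finally have "norm u \<le> real CARD('m)" by simp
    then have "K * norm u \<le> K * real CARD('m)" using K by simp
    then show "p u \<le> K * real CARD('m)" using K(2)[of u] by linarith
  qed
qed

lemma inner_unit_cube_bound:
  fixes a u :: "real^'m::finite"
  assumes "\<And>i. 0 \<le> u $ i \<and> u $ i \<le> 1"
  shows "a \<bullet> u \<le> (\<Sum>i\<in>UNIV. \<bar>a $ i\<bar>)"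
proof -
  have "a $ i * u $ i \<le> \<bar>a $ i\<bar>" for i
  proof -
    have "a $ i * u $ i \<le> \<bar>a $ i\<bar> * u $ i" using assms[of i] by (intro mult_right_mono) auto
    also have "\<dots> \<le> \<bar>a $ i\<bar> * 1" using assms[of i] by (intro mult_left_mono) auto
    finally show ?thesis by simp
  qed
  then show ?thesis unfolding inner_vec_def by (intro sum_mono) simp
qed

lemma sets_tmeas: "E \<in> sets tmeas \<longleftrightarrow> E \<in> sets borel \<and> E \<subseteq> tcube"
  and measure_tmeas: "E \<in> sets tmeas \<Longrightarrow> measure tmeas E = measure lebesgue E"
proof -
  show s: "E \<in> sets tmeas \<longleftrightarrow> E \<in> sets borel \<and> E \<subseteq> tcube"
    unfolding tmeas_def by (subst sets_restrict_space_iff) auto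
  show "measure tmeas E = measure lebesgue E" if "E \<in> sets tmeas"
    using that unfolding s unfolding tmeas_def by (subst measure_restrict_space) auto
qed

section \<open>Upper bound for the covering numbers\<close>

context torus_action
begin

lemma eig_coord_small:
  obtains K where "K > 0" "\<And>z r a. r > 0 \<Longrightarrow> (\<And>j. \<bar>eig_coord v z $ j\<bar> < r) \<Longrightarrow> \<bar>z $ a\<bar> < K * r"
proof -
  \<comment> \<open>The added 1 makes \<open>K\<close> positive and the final inequality
    strict.\<close>
  define K where "K = 1 + (\<Sum>a\<in>UNIV. \<Sum>j\<in>UNIV. \<bar>eigmat v $ a $ j\<bar>)"
  have K1: "K \<ge> 1" unfolding K_def by (simp add: sum_nonneg)
  show ?thesis
  proof (rule that[of K])
    show "K > 0" using K1 by simp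
    fix z r a assume r: "r > 0" and z: "\<And>j. \<bar>eig_coord v z $ j\<bar> < r"
    have "z $ a = (\<Sum>j\<in>UNIV. eigmat v $ a $ j * eig_coord v z $ j)"
      using matrix_inv_mult_vec(1)[OF inv_V, of z]
      unfolding matrix_vector_mult_def[of "eigmat v"] by (metis (no_types, lifting) vec_lambda_beta)
    then have "\<bar>z $ a\<bar> \<le> (\<Sum>j\<in>UNIV. \<bar>eigmat v $ a $ j * eig_coord v z $ j\<bar>)" by (simp add: sum_abs)
    also have "\<dots> \<le> (\<Sum>j\<in>UNIV. \<bar>eigmat v $ a $ j\<bar> * r)"
      using z by (intro sum_mono) (simp add: abs_mult less_imp_le mult_left_mono)
    also have "\<dots> = (\<Sum>j\<in>UNIV. \<bar>eigmat v $ a $ j\<bar>) * r" by (simp add: sum_distrib_right)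
    also have "\<dots> \<le> (K - 1) * r"
    proof (rule mult_right_mono)
      have "(\<Sum>j\<in>UNIV. \<bar>eigmat v $ a $ j\<bar>) \<le> (\<Sum>a\<in>UNIV. \<Sum>j\<in>UNIV. \<bar>eigmat v $ a $ j\<bar>)"
        by (rule member_le_sum[of a UNIV "\<lambda>a. \<Sum>j\<in>UNIV. \<bar>eigmat v $ a $ j\<bar>"]) (auto simp: sum_nonneg)
      then show "(\<Sum>j\<in>UNIV. \<bar>eigmat v $ a $ j\<bar>) \<le> K - 1" by (simp add: K_def)
    qed (use r in simp)
    also have "\<dots> < K * r" using r by (simp add: algebra_simps)
    finally show "\<bar>z $ a\<bar> < K * r" .
  qed
qed

definition entropy_sum :: "(real^'m \<Rightarrow> real) \<Rightarrow> real" where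
  "entropy_sum p = (\<Sum>j\<in>UNIV. dual_norm p (lyap j))"

text \<open>Divide the eigencoordinates of the cube into cells with sides \<open>w j\<close> and
  pick one point in each occupied cell. Every time in \<open>Fset p s\<close> expands the j-th
  coordinate by at most \<open>exp (s * h j)\<close>, so points of one cell stay within
  \<open>eps / 2\<close> of each other, with the integer translate 0 at all times.\<close>

lemma covering_exists:
  assumes p: "is_norm p" and eps: "eps > 0"
  obtains C where "C > 0" "\<And>s. 0 \<le> s \<Longrightarrow> \<exists>X. X \<subseteq> tcube \<and> finite X \<and>
      tcube \<subseteq> (\<Union>x\<in>X. {y \<in> tcube. dF v A (Fset p s) x y < eps}) \<and> real (card X) \<le> C * exp (s * entropy_sum p)"
proof -
  obtain L where L: "L > 0" "\<And>y j. y \<in> tcube \<Longrightarrow> \<bar>eig_coord v y $ j\<bar> \<le> L"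
  proof -
    have "bounded (eig_coord v ` tcube)"
      by (intro bounded_linear_image bounded_tcube matrix_vector_mul_bounded_linear)
    then obtain L where "L > 0" "\<And>x. x \<in> eig_coord v ` tcube \<Longrightarrow> norm x \<le> L" unfolding bounded_pos by blast
    then show ?thesis using component_le_norm_cart order_trans by (intro that[of L]) blast+
  qed
  \<comment> \<open>In each coordinate there are at most \<open>2 * (L / w j) + 3\<close> cells, and
    \<open>L / w j\<close> equals \<open>2 * L / eps * exp (s * h j)\<close>.\<close>
  define C where "C = (4 * L / eps + 3) ^ CARD('n)"
  have C0: "C > 0" unfolding C_def using L eps by (intro zero_less_power add_nonneg_pos) auto
  show ?thesis
  proof (rule that[OF C0])
    fix s :: real assume s: "0 \<le> s"
    define h where "h j = dual_norm p (lyap j)" for j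
    have h0: "h j \<ge> 0" for j unfolding h_def by (rule dual_norm_nonneg[OF p])
    define w where "w j = eps / 2 * exp (- (s * h j))" for j
    have w0: "w j > 0" for j using eps by (simp add: w_def)
    define cell where "cell y = (\<lambda>j. \<lfloor>eig_coord v y $ j / w j\<rfloor>)" for y
    define Nb where "Nb j = \<lceil>L / w j\<rceil>" for j
    have cellsub: "cell ` tcube \<subseteq> PiE UNIV (\<lambda>j. {- Nb j .. Nb j})"
    proof (rule image_subsetI, rule PiE_I)
      fix y :: "real^'n" and j assume "y \<in> tcube"
      then have "\<bar>eig_coord v y $ j\<bar> \<le> L" by (rule L)
      then have "\<bar>eig_coord v y $ j / w j\<bar> \<le> L / w j" using w0[of j] by (simp add: abs_divide divide_right_mono)
      then have "- Nb j \<le> \<lfloor>eig_coord v y $ j / w j\<rfloor> \<and> \<lfloor>eig_coord v y $ j / w j\<rfloor> \<le> Nb j"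
        unfolding Nb_def by linarith
      then show "cell y j \<in> {- Nb j .. Nb j}" by (simp add: cell_def)
    qed simp
    have finP: "finite (PiE (UNIV :: 'n set) (\<lambda>j. {- Nb j .. Nb j}))" by (intro finite_PiE) auto
    have fin: "finite (cell ` tcube)" by (rule finite_subset[OF cellsub finP])
    have cardj: "real (card {- Nb j .. Nb j}) \<le> (4 * L / eps + 3) * exp (s * h j)" for j
    proof -
      have Nb0: "Nb j \<ge> 0" unfolding Nb_def using L w0[of j] by simp (smt (verit) divide_nonneg_pos)
      have "real (card {- Nb j .. Nb j}) = 2 * real_of_int (Nb j) + 1" using Nb0 by simp
      also have "\<dots> \<le> 2 * (L / w j) + 3" unfolding Nb_def by linarith
      also have "L / w j = 2 * L / eps * exp (s * h j)" unfolding w_def by (simp add: exp_minus field_simps)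
      also have "2 * (2 * L / eps * exp (s * h j)) + 3 \<le> (4 * L / eps + 3) * exp (s * h j)"
        using h0[of j] s by (simp add: algebra_simps)
      finally show ?thesis .
    qed
    define rep where "rep k = (SOME y. y \<in> tcube \<and> cell y = k)" for k
    have rep: "rep k \<in> tcube \<and> cell (rep k) = k" if "k \<in> cell ` tcube" for k
      unfolding rep_def by (rule someI_ex) (use that in auto)
    define X where "X = rep ` cell ` tcube"
    have "card X \<le> card (cell ` tcube)" unfolding X_def by (rule card_image_le[OF fin])
    also have "\<dots> \<le> card (PiE (UNIV :: 'n set) (\<lambda>j. {- Nb j .. Nb j}))" by (rule card_mono[OF finP cellsub])
    also have "\<dots> = (\<Prod>j\<in>UNIV. card {- Nb j .. Nb j})" by (simp add: card_PiE)
    finally have "real (card X) \<le> (\<Prod>j\<in>UNIV. real (card {- Nb j .. Nb j}))" by (simp flip: of_nat_prod)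
    also have "\<dots> \<le> (\<Prod>j\<in>UNIV. (4 * L / eps + 3) * exp (s * h j))" by (intro prod_mono conjI cardj) simp
    also have "\<dots> = C * exp (s * entropy_sum p)"
      by (simp add: prod.distrib C_def entropy_sum_def h_def exp_sum sum_distrib_left)
    finally have card: "real (card X) \<le> C * exp (s * entropy_sum p)" .
    have "tcube \<subseteq> (\<Union>x\<in>X. {y \<in> tcube. dF v A (Fset p s) x y < eps})"
    proof
      fix y :: "real^'n" assume y: "y \<in> tcube"
      define x where "x = rep (cell y)"
      have xX: "x \<in> X" and cx: "cell x = cell y" using rep[of "cell y"] y by (auto simp: X_def x_def)
      have near: "\<bar>eig_coord v (x - y) $ j\<bar> < w j" for j
      proof -
        have "\<lfloor>eig_coord v x $ j / w j\<rfloor> = \<lfloor>eig_coord v y $ j / w j\<rfloor>" using fun_cong[OF cx, of j] by (simp add: cell_def)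
        then have "\<bar>eig_coord v x $ j / w j - eig_coord v y $ j / w j\<bar> < 1" by linarith
        then have "\<bar>eig_coord v x $ j - eig_coord v y $ j\<bar> / w j < 1" using w0[of j]
          by (simp add: diff_divide_distrib[symmetric] abs_divide)
        then show ?thesis using w0[of j] by (simp add: matrix_vector_mult_diff_distrib field_simps)
      qed
      have "dF v A (Fset p s) x y < eps"
      proof (subst dF_less_iff[OF finite_Fset[OF p]])
        show "Fset p s \<noteq> {}" using zero_in_Fset[OF p s] by auto
        show "\<forall>t\<in>Fset p s. \<exists>m. \<forall>j. \<bar>eigval t j * eig_coord v (x - y) $ j - eig_coord v (int_vec m) $ j\<bar> < eps"
        proof (intro ballI exI[of _ 0] allI)
          fix t j assume t: "t \<in> Fset p s"
          have "lyap j \<bullet> int_vec t \<le> s * h j"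
            unfolding h_def using t by (intro inner_le_dual_norm_ball[OF p]) (simp add: mem_Fset_iff)
          then have "\<bar>eigval t j\<bar> \<le> exp (s * h j)" by (simp add: abs_eigval)
          then have "\<bar>eigval t j * eig_coord v (x - y) $ j\<bar> \<le> exp (s * h j) * w j"
            unfolding abs_mult using near[of j] by (intro mult_mono) auto
          also have "\<dots> = eps / 2" by (simp add: w_def exp_minus)
          also have "\<dots> < eps" using eps by simp
          finally show "\<bar>eigval t j * eig_coord v (x - y) $ j - eig_coord v (int_vec 0) $ j\<bar> < eps" by (simp add: int_vec_0)
        qed
      qed
      then show "y \<in> (\<Union>x\<in>X. {y \<in> tcube. dF v A (Fset p s) x y < eps})" using xX y by blast
    qed
    then show "\<exists>X. X \<subseteq> tcube \<and> finite X \<and>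
      tcube \<subseteq> (\<Union>x\<in>X. {y \<in> tcube. dF v A (Fset p s) x y < eps}) \<and> real (card X) \<le> C * exp (s * entropy_sum p)"
      using rep fin card by (intro exI[of _ X]) (auto simp: X_def)
  qed
qed

end

section \<open>Lower bound for the covering numbers, and the slow entropy of a norm\<close>

context torus_action
begin

text \<open>Consecutive points of a path in \<^term>\<open>F\<close> differ by a bounded step, so if \<^term>\<open>r\<close> is small the nearest
  lattice points are carried into each other by the action and the \<^const>\<open>dF\<close>-ball is locally a box.\<close>

lemma dF_ball_local:
  assumes p: "is_norm p"
  obtains r0 c where "r0 > 0" "c > 0"
    "\<And>r s x y. 0 < r \<Longrightarrow> r < r0 \<Longrightarrow> c \<le> s \<Longrightarrow> x \<in> tcube \<Longrightarrow> y \<in> tcube \<Longrightarrow> dF v A (Fset p s) x y < r \<Longrightarrow>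
      \<exists>m. (\<forall>a. \<bar>int_vec m $ a\<bar> \<le> 2) \<and>
        (\<forall>t\<in>Fset p (s - c). \<forall>j. \<bar>eigval t j * eig_coord v (x - y - int_vec m) $ j\<bar> < r)"
proof -
  obtain K where K: "K > 0" "\<And>z r a. r > 0 \<Longrightarrow> (\<And>j. \<bar>eig_coord v z $ j\<bar> < r) \<Longrightarrow> \<bar>z $ a\<bar> < K * r"
    using eig_coord_small by metis
  obtain c where c: "c > 0" "\<And>u. (\<And>i. 0 \<le> u $ i \<and> u $ i \<le> 1) \<Longrightarrow> p u \<le> c"
    using is_norm_unit_cube_bound[OF p] by metis
  define \<Lambda> where "\<Lambda> = exp (\<Sum>j\<in>UNIV. \<Sum>i\<in>UNIV. \<bar>lyap j $ i\<bar>)"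
  have \<Lambda>1: "\<Lambda> \<ge> 1" unfolding \<Lambda>_def by (simp add: sum_nonneg)
  have step: "\<bar>eigval d j\<bar> \<le> \<Lambda>" if "\<And>i. \<bar>d $ i\<bar> \<le> 1" for d j
  proof -
    have "lyap j \<bullet> int_vec d \<le> (\<Sum>i\<in>UNIV. \<bar>lyap j $ i\<bar>)"
      unfolding inner_vec_def
    proof (rule sum_mono)
      fix i
      have "lyap j $ i \<bullet> int_vec d $ i \<le> \<bar>lyap j $ i\<bar> * \<bar>real_of_int (d $ i)\<bar>" by (simp flip: abs_mult)
      also have "\<bar>real_of_int (d $ i)\<bar> \<le> 1" using that[of i] by linarith
      finally show "lyap j $ i \<bullet> int_vec d $ i \<le> \<bar>lyap j $ i\<bar>" by (simp add: mult_left_mono)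
    qed
    also have "\<dots> \<le> (\<Sum>j\<in>UNIV. \<Sum>i\<in>UNIV. \<bar>lyap j $ i\<bar>)"
      by (rule member_le_sum[of j UNIV "\<lambda>j. \<Sum>i\<in>UNIV. \<bar>lyap j $ i\<bar>"]) (auto simp: sum_nonneg)
    finally show ?thesis by (simp add: abs_eigval \<Lambda>_def)
  qed
  \<comment> \<open>Chosen so that integer vectors whose eigencoordinates differ by less than
    \<open>(\<Lambda> + 1) * r0\<close> have entries differing by less than 1, hence coincide. Here
    \<open>\<Lambda>\<close> bounds the expansion in one step.\<close>
  define r0 where "r0 = 1 / (K * (\<Lambda> + 1))"
  have r00: "r0 > 0" using K \<Lambda>1 by (simp add: r0_def)
  have sys: "m = m'" if "\<And>j. \<bar>eig_coord v (int_vec m) $ j - eig_coord v (int_vec m') $ j\<bar> < (\<Lambda> + 1) * r0" for m m'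
  proof -
    have "\<bar>int_vec (m - m') $ a\<bar> < K * ((\<Lambda> + 1) * r0)" for a
      by (rule K(2)) (use that r00 \<Lambda>1 in \<open>auto simp: int_vec_diff matrix_vector_mult_diff_distrib\<close>)
    moreover have "K * ((\<Lambda> + 1) * r0) = 1" using K \<Lambda>1 by (simp add: r0_def)
    ultimately have "\<bar>real_of_int ((m - m') $ a)\<bar> < 1" for a by (metis int_vec_nth)
    then have "(m - m') $ a = 0" for a
    proof -
      have "k = 0" if "\<bar>real_of_int k\<bar> < 1" for k using that by linarith
      then show ?thesis using \<open>\<And>a. \<bar>real_of_int ((m - m') $ a)\<bar> < 1\<close> by blast
    qed
    then show ?thesis by (simp add: vec_eq_iff)
  qed
  show ?thesis
  proof (rule that[OF r00 c(1)])
    fix r s x y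
    assume r: "0 < r" "r < r0" and s: "c \<le> s" and xy: "x \<in> tcube" "y \<in> tcube"
      and ball: "dF v A (Fset p s) x y < r"
    define z where "z = eig_coord v (x - y)"
    have 0: "0 \<in> Fset p s" using s c by (intro zero_in_Fset[OF p]) simp
    have near: "\<exists>m. \<forall>j. \<bar>eigval t j * z $ j - eig_coord v (int_vec m) $ j\<bar> < r" if "t \<in> Fset p s" for t
      using ball that 0 unfolding z_def by (subst (asm) dF_less_iff[OF finite_Fset[OF p]]) auto
    obtain m0 where m0: "\<And>j. \<bar>z $ j - eig_coord v (int_vec m0) $ j\<bar> < r"
      using near[OF 0] by (auto simp: eigval_0)
    \<comment> \<open>\<open>G t\<close>: at time \<open>t\<close> the image of the initial lattice
      point \<open>m0\<close> is still a witness of nearness.\<close>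
    define G where "G t \<longleftrightarrow> (\<forall>j. \<bar>eigval t j * z $ j - eigval t j * eig_coord v (int_vec m0) $ j\<bar> < r)" for t
    have G0: "G 0" using m0 by (simp add: G_def eigval_0)
    have Gstep: "G (t + d)" if t: "G t" "t + d \<in> Fset p s" and d: "\<And>i. \<bar>d $ i\<bar> \<le> 1" for t d
    proof -
      obtain m' where m': "\<And>j. \<bar>eigval (t + d) j * z $ j - eig_coord v (int_vec m') $ j\<bar> < r"
        using near[OF t(2)] by blast
      \<comment> \<open>The image of \<open>m0\<close> is within \<open>\<Lambda> * r\<close> of the
        moved point and \<open>m'\<close> within \<open>r\<close>; two integer vectors that close
        are equal.\<close>
      have m'_eq: "m' = act_mat A (t + d) *v m0"
      proof (rule sys)
        fix j
        define e where "e = eigval t j * z $ j - eigval t j * eig_coord v (int_vec m0) $ j"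
        have "\<bar>e\<bar> < r" using t(1) by (simp add: G_def e_def)
        then have "\<bar>eigval d j * e\<bar> \<le> \<Lambda> * r" unfolding abs_mult using step[OF d, of j] \<Lambda>1 by (intro mult_mono) auto
        moreover have "eig_coord v (int_vec m') $ j - eig_coord v (int_vec (act_mat A (t + d) *v m0)) $ j
            = eigval d j * e - (eigval (t + d) j * z $ j - eig_coord v (int_vec m') $ j)"
          by (simp add: e_def eig_coord_act_int eigval_add algebra_simps)
        ultimately have "\<bar>eig_coord v (int_vec m') $ j - eig_coord v (int_vec (act_mat A (t + d) *v m0)) $ j\<bar> < \<Lambda> * r + r"
          using m'[of j] by linarith
        also have "\<dots> \<le> (\<Lambda> + 1) * r0" using r \<Lambda>1 by (simp add: algebra_simps mult_left_mono add_mono)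
        finally show "\<bar>eig_coord v (int_vec m') $ j - eig_coord v (int_vec (act_mat A (t + d) *v m0)) $ j\<bar> < (\<Lambda> + 1) * r0" .
      qed
      show ?thesis using m' unfolding G_def m'_eq by (simp add: eig_coord_act_int)
    qed
    \<comment> \<open>The path to \<open>t\<close> may leave the ball of radius \<open>s - c\<close>
      by at most \<open>c\<close>, so it stays in \<open>Fset p s\<close>, where nearness is known.
      This is why the conclusion is restricted to \<open>Fset p (s - c)\<close>.\<close>
    have Gall: "G t" if t: "t \<in> Fset p (s - c)" for t
    proof -
      obtain N \<tau> where \<tau>: "\<tau> 0 = 0" "\<tau> N = t" "\<And>k i. \<bar>(\<tau> (Suc k) - \<tau> k) $ i\<bar> \<le> 1"
        and fr: "\<And>k. k \<le> N \<Longrightarrow> \<exists>\<rho>. 0 \<le> \<rho> \<and> \<rho> \<le> 1 \<and> (\<forall>i. 0 \<le> (\<rho> *\<^sub>R int_vec t - int_vec (\<tau> k)) $ i \<and> (\<rho> *\<^sub>R int_vec t - int_vec (\<tau> k)) $ i \<le> 1)"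
        using integer_path[of t] by metis
      have F: "\<tau> k \<in> Fset p s" if kN: "k \<le> N" for k
      proof -
        obtain \<rho> where \<rho>: "0 \<le> \<rho>" "\<rho> \<le> 1"
          and u: "\<And>i. 0 \<le> (\<rho> *\<^sub>R int_vec t - int_vec (\<tau> k)) $ i \<and> (\<rho> *\<^sub>R int_vec t - int_vec (\<tau> k)) $ i \<le> 1"
          using fr[OF kN] by blast
        have "p (int_vec (\<tau> k)) = p (\<rho> *\<^sub>R int_vec t - (\<rho> *\<^sub>R int_vec t - int_vec (\<tau> k)))" by simp
        also have "\<dots> \<le> p (\<rho> *\<^sub>R int_vec t) + p (\<rho> *\<^sub>R int_vec t - int_vec (\<tau> k))" by (rule is_normD(7)[OF p])
        also have "p (\<rho> *\<^sub>R int_vec t) \<le> p (int_vec t)"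
          using \<rho> is_normD(1)[OF p, of "int_vec t"] by (simp add: is_normD(3)[OF p] mult_left_le_one_le)
        also have "p (int_vec t) \<le> s - c" using t by (simp add: mem_Fset_iff)
        also have "p (\<rho> *\<^sub>R int_vec t - int_vec (\<tau> k)) \<le> c" by (rule c(2)[OF u])
        finally show ?thesis by (simp add: mem_Fset_iff)
      qed
      have "G (\<tau> k)" if "k \<le> N" for k
        using that
      proof (induction k)
        case (Suc k)
        have "G (\<tau> k + (\<tau> (Suc k) - \<tau> k))"
          by (rule Gstep) (use Suc F[of "Suc k"] \<tau>(3)[of k] in auto)
        then show ?case by simp
      qed (use \<tau> G0 in simp)
      from this[of N] show ?thesis by (simp add: \<tau>)
    qed
    \<comment> \<open>The translate ranges over a finite set independent of \<open>s\<close>, so a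
      ball consists of boundedly many pieces.\<close>
    have bound: "\<bar>int_vec m0 $ a\<bar> \<le> 2" for a
    proof -
      have "\<bar>(x - y - int_vec m0) $ a\<bar> < K * r"
        by (rule K(2)) (use r m0 in \<open>auto simp: z_def matrix_vector_mult_diff_distrib\<close>)
      also have "K * r \<le> K * r0" using r K by simp
      also have "K * r0 \<le> 1" using K \<Lambda>1 by (simp add: r0_def)
      finally have "\<bar>x $ a - y $ a - int_vec m0 $ a\<bar> < 1" by simp
      moreover have "0 \<le> x $ a" "x $ a < 1" "0 \<le> y $ a" "y $ a < 1" using xy by (auto simp: tcube_def)
      ultimately show ?thesis by linarith
    qed
    show "\<exists>m. (\<forall>a. \<bar>int_vec m $ a\<bar> \<le> 2) \<and>
        (\<forall>t\<in>Fset p (s - c). \<forall>j. \<bar>eigval t j * eig_coord v (x - y - int_vec m) $ j\<bar> < r)"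
    proof (intro exI[of _ m0] conjI allI ballI bound)
      fix t j assume "t \<in> Fset p (s - c)"
      then show "\<bar>eigval t j * eig_coord v (x - y - int_vec m0) $ j\<bar> < r"
        using Gall[of t] by (simp add: G_def z_def matrix_vector_mult_diff_distrib[of _ "x - y"] right_diff_distrib)
    qed
  qed
qed

text \<open>Scale a vector attaining the dual norm by \<open>s - c\<close> and round it down: the
  result stays in \<open>Fset p s\<close> and loses a bounded amount under \<open>a\<close>.\<close>

lemma large_exponent:
  assumes p: "is_norm p"
  obtains c where "c > 0" "\<And>s. c \<le> s \<Longrightarrow> \<exists>t\<in>Fset p s. s * dual_norm p a - c \<le> a \<bullet> int_vec t"
proof -
  obtain c where c: "c > 0" "\<And>u. (\<And>i. 0 \<le> u $ i \<and> u $ i \<le> 1) \<Longrightarrow> p u \<le> c"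
    using is_norm_unit_cube_bound[OF p] by metis
  obtain x where x: "p x \<le> 1" "a \<bullet> x = dual_norm p a" using dual_norm_attained[OF p] by metis
  define B where "B = (\<Sum>i\<in>UNIV. \<bar>a $ i\<bar>)"
  have B0: "B \<ge> 0" unfolding B_def by (simp add: sum_nonneg)
  have D0: "dual_norm p a \<ge> 0" by (rule dual_norm_nonneg[OF p])
  show ?thesis
  \<comment> \<open>\<open>c * dual_norm p a\<close> is lost by shrinking \<open>s\<close> to
    \<open>s - c\<close>, and \<open>B\<close> by rounding under \<open>a\<close>; the first
    \<open>c\<close> gives positivity and \<open>c \<le> s\<close>.\<close>
  proof (rule that[of "c + c * dual_norm p a + B"])
    show "c + c * dual_norm p a + B > 0" using c(1) B0 D0 by (simp add: add_pos_nonneg)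
    fix s assume s: "c + c * dual_norm p a + B \<le> s"
    have sc: "s - c \<ge> 0" using s B0 D0 c(1) by (smt (verit) mult_nonneg_nonneg)
    define t where "t = (\<chi> i. \<lfloor>(s - c) * x $ i\<rfloor>)"
    define u where "u = (s - c) *\<^sub>R x - int_vec t"
    have u: "0 \<le> u $ i \<and> u $ i \<le> 1" for i unfolding u_def t_def by simp linarith
    have it: "int_vec t = (s - c) *\<^sub>R x - u" by (simp add: u_def)
    have "p (int_vec t) \<le> p ((s - c) *\<^sub>R x) + p u" unfolding it by (rule is_normD(7)[OF p])
    also have "p ((s - c) *\<^sub>R x) \<le> s - c" using x(1) sc by (simp add: is_normD(3)[OF p] mult_left_le)
    also have "p u \<le> c" by (rule c(2)[OF u])
    finally have "t \<in> Fset p s" by (simp add: mem_Fset_iff)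
    moreover have "a \<bullet> int_vec t = (s - c) * dual_norm p a - a \<bullet> u" by (simp add: it inner_diff_right x(2))
    then have "s * dual_norm p a - (c + c * dual_norm p a + B) \<le> a \<bullet> int_vec t"
      using inner_unit_cube_bound[of u a, OF u] c(1) unfolding B_def by (simp add: algebra_simps)
    ultimately show "\<exists>t\<in>Fset p s. s * dual_norm p a - (c + c * dual_norm p a + B) \<le> a \<bullet> int_vec t" by blast
  qed
qed

lemma measure_eig_box:
  "(*v) (eigmat v) ` cbox (- R) R \<in> lmeasurable"
  "(\<And>j. 0 \<le> R $ j) \<Longrightarrow> measure lebesgue ((*v) (eigmat v) ` cbox (- R) R) = \<bar>det (eigmat v)\<bar> * (\<Prod>j\<in>UNIV. 2 * R $ j)"
proof -
  show "(*v) (eigmat v) ` cbox (- R) R \<in> lmeasurable" by (intro lmeasurable_matrix_image lmeasurable_cbox)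
  assume R: "\<And>j. 0 \<le> R $ j"
  have ne: "cbox (- R) R \<noteq> {}" using R by (auto simp: interval_ne_empty_cart intro: order_trans[of _ 0])
  show "measure lebesgue ((*v) (eigmat v) ` cbox (- R) R) = \<bar>det (eigmat v)\<bar> * (\<Prod>j\<in>UNIV. 2 * R $ j)"
    using content_cbox_cart[OF ne] by (simp add: measure_matrix_image)
qed

text \<open>Every ball lies in \<open>card M\<close> translates of one box, whose volume is a
  constant times \<open>exp (- (s * entropy_sum p))\<close>. The constant depends on
  \<open>r\<close> but not on \<open>s\<close>.\<close>

lemma covered_measure_le:
  assumes p: "is_norm p"
  obtains r0 where "r0 > 0" "\<And>r. 0 < r \<Longrightarrow> r < r0 \<Longrightarrow>
    \<exists>\<kappa>>0. \<exists>s0. \<forall>s\<ge>s0. \<forall>X E. X \<subseteq> tcube \<and> finite X \<and> E \<in> sets tmeas \<and>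
      E \<subseteq> (\<Union>x\<in>X. {y \<in> tcube. dF v A (Fset p s) x y < r}) \<longrightarrow>
      measure tmeas E \<le> real (card X) * \<kappa> * exp (- (s * entropy_sum p))"
proof -
  obtain r0 c where r0: "r0 > 0" and c: "c > 0" and local:
    "\<And>r s x y. 0 < r \<Longrightarrow> r < r0 \<Longrightarrow> c \<le> s \<Longrightarrow> x \<in> tcube \<Longrightarrow> y \<in> tcube \<Longrightarrow> dF v A (Fset p s) x y < r \<Longrightarrow>
      \<exists>m. (\<forall>a. \<bar>int_vec m $ a\<bar> \<le> 2) \<and>
        (\<forall>t\<in>Fset p (s - c). \<forall>j. \<bar>eigval t j * eig_coord v (x - y - int_vec m) $ j\<bar> < r)"
    using dF_ball_local[OF p] by metis
  have "\<exists>c'>0. \<forall>s\<ge>c'. \<exists>t\<in>Fset p s. s * dual_norm p (lyap j) - c' \<le> lyap j \<bullet> int_vec t" for j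
    using large_exponent[OF p, of "lyap j"] by metis
  then obtain c' where c': "\<And>j. c' j > 0"
    "\<And>j s. c' j \<le> s \<Longrightarrow> \<exists>t\<in>Fset p s. s * dual_norm p (lyap j) - c' j \<le> lyap j \<bullet> int_vec t" by metis
  define M where "M = {m :: int^'n. \<forall>a. \<bar>int_vec m $ a\<bar> \<le> 2}"
  have finM: "finite M" unfolding M_def by (rule finite_int_vec_bounded)
  have "0 \<in> M" by (simp add: M_def)
  then have cardM: "card M > 0" using finM by (auto simp: card_gt_0_iff)
  show ?thesis
  proof (rule that[OF r0])
    fix r assume r: "0 < r" "r < r0"
    define h where "h j = dual_norm p (lyap j)" for j
    define \<gamma> where "\<gamma> j = 2 * r * exp (c * h j + c' j)" for j
    define \<kappa> where "\<kappa> = real (card M) * (\<bar>det (eigmat v)\<bar> * (\<Prod>j\<in>UNIV. \<gamma> j))"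
    have detV: "\<bar>det (eigmat v)\<bar> > 0" using inv_V invertible_det_nz by auto
    have \<kappa>0: "\<kappa> > 0" unfolding \<kappa>_def \<gamma>_def using cardM detV r by (intro mult_pos_pos prod_pos) auto
    define s0 where "s0 = c + (\<Sum>j\<in>UNIV. c' j)"
    have "measure tmeas E \<le> real (card X) * \<kappa> * exp (- (s * entropy_sum p))"
      if s: "s \<ge> s0" and X: "X \<subseteq> tcube" "finite X" and E: "E \<in> sets tmeas"
        and cov: "E \<subseteq> (\<Union>x\<in>X. {y \<in> tcube. dF v A (Fset p s) x y < r})" for s X E
    proof -
      have scj: "c' j \<le> s - c" for j
      proof -
        have "c' j \<le> (\<Sum>j\<in>UNIV. c' j)" by (rule member_le_sum) (auto simp: c' less_imp_le)
        then show ?thesis using s by (simp add: s0_def)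
      qed
      have cs: "c \<le> s" using scj[of undefined] c'(1)[of undefined] by linarith
      \<comment> \<open>There is a time in \<open>Fset p (s - c)\<close> whose j-th exponent is at
        least \<open>(s - c) * h j - c' j\<close>; even that expansion keeps the coordinate below
        \<open>r\<close>, which bounds it by \<open>R $ j\<close>.\<close>
      define R where "R = (\<chi> j. r * exp (- (s * h j) + (c * h j + c' j)))"
      have R0: "0 \<le> R $ j" for j using r by (simp add: R_def)
      define Bx where "Bx = (*v) (eigmat v) ` cbox (- R) R"
      have Bm: "Bx \<in> lmeasurable" unfolding Bx_def by (rule measure_eig_box)
      have tr: "(+) w ` Bx \<in> lmeasurable" for w by (rule measurable_translation[OF Bm])
      have "E \<subseteq> (\<Union>(x, m)\<in>X \<times> M. (+) (x - int_vec m) ` Bx)"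
      proof
        fix y assume "y \<in> E"
        then obtain x where x: "x \<in> X" "y \<in> tcube" "dF v A (Fset p s) x y < r" using cov by blast
        then obtain m where m: "m \<in> M"
          and sm: "\<And>t j. t \<in> Fset p (s - c) \<Longrightarrow> \<bar>eigval t j * eig_coord v (x - y - int_vec m) $ j\<bar> < r"
          using local[OF r cs _ _ x(3)] X(1) unfolding M_def by blast
        define z where "z = eig_coord v (x - y - int_vec m)"
        have zR: "\<bar>z $ j\<bar> \<le> R $ j" for j
        proof -
          obtain t where t: "t \<in> Fset p (s - c)" "(s - c) * h j - c' j \<le> lyap j \<bullet> int_vec t"
            using c'(2)[OF scj[of j]] unfolding h_def by blast
          have "exp ((s - c) * h j - c' j) * \<bar>z $ j\<bar> \<le> \<bar>eigval t j\<bar> * \<bar>z $ j\<bar>"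
            using t(2) by (intro mult_right_mono) (auto simp: abs_eigval)
          also have "\<dots> < r" using sm[OF t(1), of j] by (simp add: z_def abs_mult)
          finally have "\<bar>z $ j\<bar> < r / exp ((s - c) * h j - c' j)" by (simp add: field_simps)
          also have "\<dots> = r * exp (- ((s - c) * h j - c' j))" unfolding exp_minus by (simp add: divide_inverse)
          also have "- ((s - c) * h j - c' j) = - (s * h j) + (c * h j + c' j)" by (simp add: algebra_simps)
          finally show ?thesis by (simp add: R_def)
        qed
        have "(- R) $ j \<le> (- z) $ j \<and> (- z) $ j \<le> R $ j" for j using zR[of j] by (simp add: abs_le_iff)
        then have "- z \<in> cbox (- R) R" unfolding mem_box_cart by blast
        then have "eigmat v *v (- z) \<in> Bx" unfolding Bx_def by blast
        moreover have "eigmat v *v (- z) = y - (x - int_vec m)"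
          using matrix_inv_mult_vec(1)[OF inv_V, of "x - y - int_vec m"]
            matrix_vector_mult_diff_distrib[of "eigmat v" 0 z]
          by (simp add: z_def)
        ultimately have "y \<in> (+) (x - int_vec m) ` Bx" by (intro image_eqI[of _ _ "eigmat v *v (- z)"]) simp_all
        then show "y \<in> (\<Union>(x, m)\<in>X \<times> M. (+) (x - int_vec m) ` Bx)" using x(1) m by blast
      qed
      then have "measure lebesgue E \<le> measure lebesgue (\<Union>(x, m)\<in>X \<times> M. (+) (x - int_vec m) ` Bx)"
        using E X(2) finM tr unfolding sets_tmeas
        by (intro measure_mono_fmeasurable fmeasurable.finite_UN) auto
      also have "\<dots> \<le> (\<Sum>(x, m)\<in>X \<times> M. measure lebesgue ((+) (x - int_vec m) ` Bx))"
        using measure_UNION_le[of "X \<times> M" "\<lambda>(x, m). (+) (x - int_vec m) ` Bx" lebesgue] X(2) finM fmeasurableD[OF tr]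
        by (auto simp: case_prod_unfold)
      also have "\<dots> = real (card X) * real (card M) * measure lebesgue Bx"
        by (simp add: measure_translation case_prod_unfold card_cartesian_product)
      also have "measure lebesgue Bx = \<bar>det (eigmat v)\<bar> * (\<Prod>j\<in>UNIV. 2 * R $ j)"
        unfolding Bx_def by (rule measure_eig_box(2)[OF R0])
      also have "(\<Prod>j\<in>UNIV. 2 * R $ j) = (\<Prod>j\<in>UNIV. \<gamma> j * exp (- (s * h j)))"
        unfolding R_def \<gamma>_def vec_lambda_beta exp_add by (simp only: mult_ac)
      also have "\<dots> = (\<Prod>j\<in>UNIV. \<gamma> j) * exp (- (s * entropy_sum p))"
        unfolding prod.distrib entropy_sum_def h_def[symmetric] sum_distrib_left sum_negf[symmetric]
        by (simp only: exp_sum[OF finite])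
      finally show ?thesis using measure_tmeas[OF E] by (simp add: \<kappa>_def mult_ac)
    qed
    then show "\<exists>\<kappa>>0. \<exists>s0. \<forall>s\<ge>s0. \<forall>X E. X \<subseteq> tcube \<and> finite X \<and> E \<in> sets tmeas \<and>
      E \<subseteq> (\<Union>x\<in>X. {y \<in> tcube. dF v A (Fset p s) x y < r}) \<longrightarrow>
      measure tmeas E \<le> real (card X) * \<kappa> * exp (- (s * entropy_sum p))" using \<kappa>0 by blast
  qed
qed

text \<open>For fixed small \<open>eps\<close> and \<open>delta\<close> below 1 the covering number
  lies between two constant multiples of \<open>exp (s * entropy_sum p)\<close>. The iterated limit
  is therefore that of an eventually constant function on the product filter.\<close>

theorem sh_norm_eq:
  assumes p: "is_norm p"
  shows "sh_norm v A p = ereal (entropy_sum p)"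
proof -
  let ?H = "entropy_sum p"
  define f where "f eps delta = Limsup at_top (\<lambda>s::real. ereal (ln (real (covnum v A (Fset p s) eps delta)) / s))" for eps delta :: real
  obtain r0 where r0: "r0 > 0" and lower: "\<And>r. 0 < r \<Longrightarrow> r < r0 \<Longrightarrow>
    \<exists>\<kappa>>0. \<exists>s0. \<forall>s\<ge>s0. \<forall>X E. X \<subseteq> tcube \<and> finite X \<and> E \<in> sets tmeas \<and>
      E \<subseteq> (\<Union>x\<in>X. {y \<in> tcube. dF v A (Fset p s) x y < r}) \<longrightarrow>
      measure tmeas E \<le> real (card X) * \<kappa> * exp (- (s * ?H))"
    by (rule covered_measure_le[OF p]) (rule that)
  have f: "f eps delta = ereal ?H" if e: "0 < eps" "eps < r0" and d: "0 < delta" "delta < 1" for eps delta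
  proof -
    obtain C where C: "C > 0" and cov: "\<And>s. 0 \<le> s \<Longrightarrow> \<exists>X. X \<subseteq> tcube \<and> finite X \<and>
      tcube \<subseteq> (\<Union>x\<in>X. {y \<in> tcube. dF v A (Fset p s) x y < eps}) \<and> real (card X) \<le> C * exp (s * ?H)"
      by (rule covering_exists[OF p e(1)]) (rule that)
    obtain \<kappa> s0 where \<kappa>: "\<kappa> > 0" and low: "\<And>s X E. s \<ge> s0 \<Longrightarrow> X \<subseteq> tcube \<Longrightarrow> finite X \<Longrightarrow> E \<in> sets tmeas \<Longrightarrow>
      E \<subseteq> (\<Union>x\<in>X. {y \<in> tcube. dF v A (Fset p s) x y < eps}) \<Longrightarrow>
      measure tmeas E \<le> real (card X) * \<kappa> * exp (- (s * ?H))"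
      using lower[OF e] by (elim exE conjE) (rule that, assumption, blast)
    have bounds: "(1 - delta) / \<kappa> * exp (s * ?H) \<le> real (covnum v A (Fset p s) eps delta)"
      "real (covnum v A (Fset p s) eps delta) \<le> C * exp (s * ?H)" if s: "s \<ge> max 0 s0" for s
    proof -
      \<comment> \<open>The full cover of the cube shows that the set behind \<open>LEAST\<close> is
        nonempty, so the least value is itself realised by a cover, to which the lower bound
        applies.\<close>
      define P where "P N \<longleftrightarrow> (\<exists>X. X \<subseteq> tcube \<and> finite X \<and> card X = N \<and>
        (\<exists>E \<in> sets tmeas. measure tmeas E \<ge> 1 - delta \<and>
          E \<subseteq> (\<Union>x\<in>X. {y \<in> tcube. dF v A (Fset p s) x y < eps})))" for N
      have c: "covnum v A (Fset p s) eps delta = (LEAST N. P N)" unfolding covnum_def P_def ..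
      have s': "0 \<le> s" using s by simp
      obtain X where X: "X \<subseteq> tcube" "finite X" "tcube \<subseteq> (\<Union>x\<in>X. {y \<in> tcube. dF v A (Fset p s) x y < eps})"
        "real (card X) \<le> C * exp (s * ?H)" using cov[OF s'] by blast
      have tc: "(tcube :: (real^'n) set) \<in> sets tmeas" by (simp add: sets_tmeas tcube_borel)
      have "P (card X)" unfolding P_def
        using X tc measure_tmeas[OF tc] measure_tcube[where 'n='n] d by (intro exI[of _ X] conjI bexI[of _ tcube]) auto
      then have "(LEAST N. P N) \<le> card X" and PL: "P (LEAST N. P N)" by (auto intro: Least_le LeastI)
      then show "real (covnum v A (Fset p s) eps delta) \<le> C * exp (s * ?H)" using X(4) unfolding c by linarith
      from PL obtain Y E where Y: "Y \<subseteq> tcube" "finite Y" "card Y = (LEAST N. P N)" and E: "E \<in> sets tmeas"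
        "measure tmeas E \<ge> 1 - delta" "E \<subseteq> (\<Union>x\<in>Y. {y \<in> tcube. dF v A (Fset p s) x y < eps})"
        unfolding P_def by blast
      have "1 - delta \<le> real (card Y) * \<kappa> * exp (- (s * ?H))"
        using low[of s Y E] s Y E by auto
      then have "(1 - delta) * exp (s * ?H) \<le> real (card Y) * \<kappa> * exp (- (s * ?H)) * exp (s * ?H)"
        by (rule mult_right_mono) simp
      also have "\<dots> = real (card Y) * \<kappa>" unfolding mult.assoc exp_add[symmetric] by simp
      finally have "(1 - delta) * exp (s * ?H) / \<kappa> \<le> real (card Y)" by (simp only: pos_divide_le_eq[OF \<kappa>])
      then show "(1 - delta) / \<kappa> * exp (s * ?H) \<le> real (covnum v A (Fset p s) eps delta)"
        unfolding c Y(3)[symmetric] by simp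
    qed
    have LHS: "a / s + ?H \<le> b / s" if "a + s * ?H \<le> b" "s > 0" for a b s
      using divide_right_mono[OF that(1), of s] that(2) by (simp add: add_divide_distrib)
    have RHS: "b / s \<le> a / s + ?H" if "b \<le> a + s * ?H" "s > 0" for a b s
      using divide_right_mono[OF that(1), of s] that(2) by (simp add: add_divide_distrib)
    have "((\<lambda>s. ln (real (covnum v A (Fset p s) eps delta)) / s) \<longlongrightarrow> ?H) at_top"
    proof (rule tendsto_sandwich)
      show "\<forall>\<^sub>F s in at_top. ln ((1 - delta) / \<kappa>) / s + ?H \<le> ln (real (covnum v A (Fset p s) eps delta)) / s"
        using eventually_ge_at_top[of "max 1 s0"]
      proof eventually_elim
        case (elim s)
        have a: "(1 - delta) / \<kappa> > 0" using d \<kappa> by simp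
        have "ln ((1 - delta) / \<kappa>) + s * ?H = ln ((1 - delta) / \<kappa> * exp (s * ?H))" using a by (subst ln_mult) auto
        also have "\<dots> \<le> ln (real (covnum v A (Fset p s) eps delta))"
          using bounds(1)[of s] d \<kappa> elim by (intro ln_mono) auto
        finally show ?case using elim by (intro LHS) auto
      qed
      show "\<forall>\<^sub>F s in at_top. ln (real (covnum v A (Fset p s) eps delta)) / s \<le> ln C / s + ?H"
        using eventually_ge_at_top[of "max 1 s0"]
      proof eventually_elim
        case (elim s)
        have "0 < (1 - delta) / \<kappa> * exp (s * ?H)" using d \<kappa> by simp
        also have "\<dots> \<le> real (covnum v A (Fset p s) eps delta)" using bounds(1)[of s] elim by simp
        finally have "ln (real (covnum v A (Fset p s) eps delta)) \<le> ln (C * exp (s * ?H))"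
          using bounds(2)[of s] elim by (intro ln_mono) auto
        also have "\<dots> = ln C + s * ?H" using C by (subst ln_mult) auto
        finally show ?case using elim by (intro RHS) auto
      qed
      have "((\<lambda>s. a / s + ?H) \<longlongrightarrow> 0 + ?H) at_top" for a :: real
        by (intro tendsto_intros tendsto_divide_0[OF tendsto_const] filterlim_at_top_imp_at_infinity filterlim_ident)
      then show "((\<lambda>s. ln ((1 - delta) / \<kappa>) / s + ?H) \<longlongrightarrow> ?H) at_top" "((\<lambda>s. ln C / s + ?H) \<longlongrightarrow> ?H) at_top" by simp_all
    qed
    then have "((\<lambda>s. ereal (ln (real (covnum v A (Fset p s) eps delta)) / s)) \<longlongrightarrow> ereal ?H) at_top" by simp
    then show ?thesis unfolding f_def by (intro lim_imp_Limsup) auto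
  qed
  have ev: "\<forall>\<^sub>F x in at_right 0 \<times>\<^sub>F at_right 0. (\<lambda>(eps, delta). f eps delta) x = ereal ?H"
  proof -
    have "\<forall>\<^sub>F e in at_right (0::real). 0 < e \<and> e < r0" "\<forall>\<^sub>F d in at_right (0::real). 0 < d \<and> d < 1"
      using r0 by (auto simp: eventually_at_right_field intro: exI[of _ r0] exI[of _ 1])
    from eventually_prodI[OF this] show ?thesis by eventually_elim (auto simp: f)
  qed
  have "((\<lambda>(eps, delta). f eps delta) \<longlongrightarrow> ereal ?H) (at_right 0 \<times>\<^sub>F at_right 0)"
    by (rule tendsto_eventually[OF ev])
  moreover have "at_right (0::real) \<times>\<^sub>F at_right (0::real) \<noteq> bot" by (simp add: prod_filter_eq_bot)
  ultimately show ?thesis unfolding sh_norm_def f_def by (intro tendsto_Lim) auto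
qed

end

section \<open>The extremal problem for norms\<close>

definition unit_volume_norms :: "(real^'m::finite \<Rightarrow> real) set" where
  "unit_volume_norms = {p. is_norm p \<and> emeasure lborel {x. p x \<le> 1} = 1}"

text \<open>The value of \<open>entropy_sum\<close> when the Lyapunov functionals are the coordinate functionals and minus their sum.\<close>

definition simplex_cost :: "(real^'m::finite \<Rightarrow> real) \<Rightarrow> real" where
  "simplex_cost p = (\<Sum>k\<in>UNIV. dual_norm p (axis k 1)) + dual_norm p (vec 1)"

lemma emeasure_eq_1_iff:
  fixes K :: "'a::euclidean_space set"
  assumes "compact K" shows "emeasure lborel K = 1 \<longleftrightarrow> measure lebesgue K = 1"
proof -
  have K: "K \<in> sets borel" using assms by (simp add: compact_imp_closed borel_closed)
  have "emeasure lborel K < \<infinity>" using emeasure_compact_finite[OF assms] by simp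
  then have "emeasure lborel K = ennreal (measure lborel K)" by (intro emeasure_eq_ennreal_measure) auto
  then show ?thesis using K by simp
qed

text \<open>The unit ball lies in the box with half-sides \<open>a $ k\<close>, so
  \<open>2 ^ CARD('m)\<close> times their product is at least 1; the mean inequality bounds their
  sum, and the remaining term is nonnegative.\<close>

lemma simplex_cost_ge:
  fixes p :: "real^'m::finite \<Rightarrow> real"
  assumes "p \<in> unit_volume_norms"
  shows "real CARD('m) / 2 \<le> simplex_cost p"
proof -
  have p: "is_norm p" and vol: "emeasure lborel {x. p x \<le> 1} = 1" using assms by (auto simp: unit_volume_norms_def)
  define a where "a = (\<chi> k. dual_norm p (axis k 1))"
  have a0: "0 \<le> a $ k" for k using dual_norm_nonneg[OF p] by (simp add: a_def)
  have sub: "{x. p x \<le> 1} \<subseteq> cbox (- a) a"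
  proof (clarsimp simp: mem_box_cart)
    fix x k assume x: "p x \<le> 1"
    show "- a $ k \<le> x $ k \<and> x $ k \<le> a $ k"
      using inner_le_dual_norm_ball[OF p x, of "axis k 1"] inner_le_dual_norm_ball[OF p, of "- x" 1 "axis k 1"] x
      by (simp add: a_def inner_axis' is_normD(6)[OF p])
  qed
  have c: "compact {x. p x \<le> 1}" by (rule compact_norm_ball[OF p])
  have ne: "cbox (- a) a \<noteq> {}" using subsetD[OF sub, of 0] is_normD(5)[OF p] by auto
  have "1 = measure lebesgue {x. p x \<le> 1}" using vol emeasure_eq_1_iff[OF c] by simp
  also have "\<dots> \<le> measure lebesgue (cbox (- a) a)"
    using sub c by (intro measure_mono_fmeasurable) (auto simp: lmeasurable_compact fmeasurableD)
  also have "\<dots> = (\<Prod>k\<in>UNIV. 2 * a $ k)" using content_cbox_cart[OF ne] by simp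
  also have "\<dots> = 2 ^ CARD('m) * (\<Prod>k\<in>UNIV. a $ k)" by (simp add: prod.distrib)
  finally have 1: "1 \<le> 2 ^ CARD('m) * (\<Prod>k\<in>UNIV. a $ k)" .
  let ?m = "real CARD('m)"
  have "(1 / 2 :: real) = ((1 / 2) powr ?m) powr (1 / ?m)" by (simp add: powr_powr)
  also have "(1 / 2 :: real) powr ?m = 1 / 2 ^ CARD('m)" by (simp add: powr_realpow power_divide)
  also have "\<dots> powr (1 / ?m) \<le> (\<Prod>k\<in>UNIV. a $ k) powr (1 / ?m)"
    using 1 by (intro powr_mono2) (simp_all add: field_simps)
  also have "\<dots> \<le> (\<Sum>k\<in>UNIV. a $ k / ?m)" using arith_geom_mean[of UNIV "\<lambda>k. a $ k"] a0 by simp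
  also have "\<dots> = (\<Sum>k\<in>UNIV. a $ k) / ?m" by (simp add: sum_divide_distrib)
  finally have "?m / 2 \<le> (\<Sum>k\<in>UNIV. a $ k)" by (simp add: field_simps)
  then show ?thesis using dual_norm_nonneg[OF p, of "vec 1"] by (simp add: simplex_cost_def a_def)
qed

text \<open>The factor 2 makes the unit ball a cube of side 1. On it each coordinate is at most 1/2
  and the sum of coordinates at most \<open>CARD('m) / 2\<close>.\<close>

lemma cube_norm:
  defines "p \<equiv> \<lambda>x::real^'m::finite. 2 * infnorm x"
  shows "p \<in> unit_volume_norms" "simplex_cost p \<le> real CARD('m)"
proof -
  have p: "is_norm p"
    unfolding is_norm_def p_def
    by (auto simp: infnorm_pos_le infnorm_eq_0 infnorm_mul) (metis distrib_left infnorm_triangle mult_2 add_mono)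
  have comp: "\<bar>x $ k\<bar> \<le> infnorm x" for x :: "real^'m" and k by (rule component_le_infnorm_cart)
  have ball: "{x. p x \<le> 1} = cbox (- (\<chi> i. 1/2)) (\<chi> i. 1/2)"
  proof (intro set_eqI iffI)
    fix x assume "x \<in> {x. p x \<le> 1}"
    then have "\<bar>x $ k\<bar> \<le> 1/2" for k using comp[of x k] by (simp add: p_def)
    then have "- (1/2) \<le> x $ k \<and> x $ k \<le> 1/2" for k by (smt (verit))
    then show "x \<in> cbox (- (\<chi> i. 1/2)) (\<chi> i. 1/2)" unfolding mem_box_cart by simp
  next
    fix x :: "real^'m" assume "x \<in> cbox (- (\<chi> i. 1/2)) (\<chi> i. 1/2)"
    then have "- (1/2) \<le> x $ k \<and> x $ k \<le> 1/2" for k unfolding mem_box_cart by simp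
    then have "\<bar>x $ k\<bar> \<le> 1/2" for k by (smt (verit))
    then have "infnorm x \<le> 1/2" unfolding infnorm_cart by (intro cSup_least) auto
    then show "x \<in> {x. p x \<le> 1}" by (simp add: p_def)
  qed
  have ne: "cbox (- (\<chi> i. 1/2)) (\<chi> i. 1/2) \<noteq> ({} :: (real^'m) set)" by (simp add: interval_ne_empty_cart)
  have "measure lebesgue {x. p x \<le> 1} = 1"
    unfolding ball using content_cbox_cart[OF ne] by simp
  then show "p \<in> unit_volume_norms"
    using p emeasure_eq_1_iff[OF compact_norm_ball[OF p]] by (simp add: unit_volume_norms_def)
  have d: "dual_norm p a \<le> c" if "\<And>x. p x \<le> 1 \<Longrightarrow> a \<bullet> x \<le> c" for a c
    using dual_norm_attained[OF p, of a] that by metis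
  have half: "x $ k \<le> 1/2" if "p x \<le> 1" for x k using comp[of x k] that by (simp add: p_def abs_le_iff)
  have "dual_norm p (axis k 1) \<le> 1/2" for k by (rule d) (use half in \<open>force simp: inner_axis'\<close>)
  then have "(\<Sum>k\<in>UNIV. dual_norm p (axis k 1)) \<le> (\<Sum>k\<in>(UNIV :: 'm set). 1/2)" by (intro sum_mono)
  moreover have "dual_norm p (vec 1) \<le> (\<Sum>k\<in>(UNIV :: 'm set). 1/2)"
  proof (rule d)
    fix x assume "p x \<le> 1"
    then show "vec 1 \<bullet> x \<le> (\<Sum>k\<in>(UNIV :: 'm set). 1/2)"
      unfolding inner_vec_def by (intro sum_mono) (use half in force)
  qed
  ultimately show "simplex_cost p \<le> real CARD('m)" by (simp add: simplex_cost_def)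
qed

text \<open>Unimodular substitutions act on the admissible norms, and on functionals through the
  transpose.\<close>

lemma unit_volume_norm_compose:
  fixes S :: "real^'m::finite^'m"
  assumes p: "p \<in> unit_volume_norms" and S: "\<bar>det S\<bar> = 1"
  shows "(\<lambda>x. p (S *v x)) \<in> unit_volume_norms"
    and "dual_norm p w = dual_norm (\<lambda>x. p (S *v x)) (transpose S *v w)"
proof -
  have pn: "is_norm p" and vol: "emeasure lborel {x. p x \<le> 1} = 1" using p by (auto simp: unit_volume_norms_def)
  have inv: "invertible S" using S invertible_det_nz by force
  let ?q = "\<lambda>x. p (S *v x)"
  have inj0: "x = 0" if "S *v x = 0" for x using matrix_inv_mult_vec(2)[OF inv, of x] that by simp
  have q: "is_norm ?q"
    unfolding is_norm_def
    using is_normD[OF pn] inj0 by (auto simp: matrix_vector_mult_scaleR matrix_vector_right_distrib)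
  have im: "{x. p x \<le> 1} = (*v) S ` {x. ?q x \<le> 1}"
  proof (intro equalityI subsetI)
    fix x assume "x \<in> {x. p x \<le> 1}"
    then show "x \<in> (*v) S ` {x. ?q x \<le> 1}"
      by (intro image_eqI[of _ _ "matrix_inv S *v x"]) (simp_all add: matrix_inv_mult_vec[OF inv])
  qed auto
  have "measure lebesgue {x. p x \<le> 1} = measure lebesgue {x. ?q x \<le> 1}"
    unfolding im using S by (subst measure_matrix_image) (auto simp: lmeasurable_compact compact_norm_ball[OF q])
  then show "?q \<in> unit_volume_norms"
    using vol q emeasure_eq_1_iff[OF compact_norm_ball[OF pn]] emeasure_eq_1_iff[OF compact_norm_ball[OF q]]
    by (simp add: unit_volume_norms_def)
  show "dual_norm p w = dual_norm ?q (transpose S *v w)"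
    unfolding dual_norm_def im image_image by (simp add: dot_lmul_matrix[symmetric] flip: matrix_vector_mul(1))
qed

lemma dual_norm_scaleR:
  assumes p: "is_norm p" and c: "c \<ge> 0" shows "dual_norm p (c *\<^sub>R a) = c * dual_norm p a"
proof -
  obtain x where x: "p x \<le> 1" "a \<bullet> x = dual_norm p a" "\<And>y. p y \<le> 1 \<Longrightarrow> a \<bullet> y \<le> dual_norm p a"
    using dual_norm_attained[OF p] by metis
  show ?thesis by (rule dual_norm_eqI[OF p _ x(1)]) (use x c in \<open>auto intro: mult_left_mono\<close>)
qed

text \<open>The constant of the final theorem; the type argument only carries the dimension.\<close>

definition simplex_const :: "'m::finite itself \<Rightarrow> real" where
  "simplex_const _ = Inf (simplex_cost ` (unit_volume_norms :: (real^'m \<Rightarrow> real) set))"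

lemma simplex_const_le:
  fixes p :: "real^'m::finite \<Rightarrow> real"
  assumes "p \<in> unit_volume_norms" shows "simplex_const TYPE('m) \<le> simplex_cost p"
  unfolding simplex_const_def
  by (rule cInf_lower[OF imageI[OF assms] bdd_belowI2[OF simplex_cost_ge]])

lemma simplex_const_bounds:
  "real CARD('m) / 2 \<le> simplex_const TYPE('m::finite)" "simplex_const TYPE('m) \<le> real CARD('m)"
proof -
  show "real CARD('m) / 2 \<le> simplex_const TYPE('m::finite)"
    unfolding simplex_const_def by (rule cInf_greatest) (use cube_norm(1) simplex_cost_ge in auto)
  show "simplex_const TYPE('m) \<le> real CARD('m)"
    using simplex_const_le[OF cube_norm(1)] cube_norm(2) by (rule order_trans)
qed

text \<open>With \<open>c ^ CARD('m) = \<bar>det T\<bar>\<close> the matrix \<open>T\<close> divided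
  by \<open>c\<close> has determinant 1 or -1. Substituting it or its inverse preserves unit volume
  and turns \<open>H\<close> into \<open>c\<close> times \<open>simplex_cost\<close>, in both
  directions, so the infimum scales by \<open>c\<close>.\<close>

lemma INF_simplex_exponents:
  fixes T :: "real^'m::finite^'m" and H :: "(real^'m \<Rightarrow> real) \<Rightarrow> real"
  assumes T: "det T \<noteq> 0"
    and H: "\<And>p. p \<in> unit_volume_norms \<Longrightarrow>
      H p = (\<Sum>k\<in>UNIV. dual_norm p (transpose T *v axis k 1)) + dual_norm p (transpose T *v vec 1)"
  shows "(INF p\<in>unit_volume_norms. ereal (H p)) = ereal (simplex_const TYPE('m) * \<bar>det T\<bar> powr (1 / real CARD('m)))"
proof -
  let ?m = "real CARD('m)"
  define c where "c = \<bar>det T\<bar> powr (1 / ?m)"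
  have c0: "c > 0" using T by (simp add: c_def)
  have cm: "c ^ CARD('m) = \<bar>det T\<bar>" using T by (simp add: c_def powr_realpow[symmetric] powr_powr)
  have inv: "invertible T" using T invertible_det_nz by blast
  have det_sc: "det (a *\<^sub>R M) = a ^ CARD('m) * det M" for a and M :: "real^'m^'m"
  proof -
    have "a *\<^sub>R M = (\<chi> i. a *s M $ i)" by (simp add: vec_eq_iff)
    then show ?thesis using det_rows_mul[of "\<lambda>_. a" "\<lambda>i. M $ i"] by simp
  qed
  have norm: "is_norm p" if "p \<in> unit_volume_norms" for p :: "real^'m \<Rightarrow> real" using that by (simp add: unit_volume_norms_def)
  have key: "H p = c * simplex_cost q"
    if p: "p \<in> unit_volume_norms" and q: "q \<in> unit_volume_norms"
      and e: "\<And>w. dual_norm p (transpose T *v w) = c * dual_norm q w" for p q :: "real^'m \<Rightarrow> real"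
    unfolding H[OF p] simplex_cost_def e by (simp add: sum_distrib_left distrib_left)
  have down: "\<exists>q\<in>(unit_volume_norms :: (real^'m \<Rightarrow> real) set). H p = c * simplex_cost q" if p: "p \<in> unit_volume_norms" for p
  proof -
    define S where "S = c *\<^sub>R matrix_inv T"
    have "det (T ** matrix_inv T) = 1" by (simp add: matrix_inv_right[OF inv])
    then have dd: "det T * det (matrix_inv T) = 1" by (simp add: det_mul)
    have S1: "\<bar>det S\<bar> = 1"
    proof -
      have "\<bar>det S\<bar> = \<bar>det T\<bar> * \<bar>det (matrix_inv T)\<bar>" using c0 by (simp add: S_def det_sc abs_mult cm)
      also have "\<dots> = \<bar>det T * det (matrix_inv T)\<bar>" by (simp add: abs_mult)
      finally show ?thesis using dd by simp
    qed
    let ?q = "\<lambda>x. p (S *v x)"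
    have q: "?q \<in> unit_volume_norms" by (rule unit_volume_norm_compose(1)[OF p S1])
    have TS: "T ** S = c *\<^sub>R mat 1"
    proof -
      have "T ** (c *\<^sub>R matrix_inv T) = c *\<^sub>R (T ** matrix_inv T)"
        by (simp add: vec_eq_iff matrix_matrix_mult_def sum_distrib_left mult_ac)
      then show ?thesis by (simp add: S_def matrix_inv_right[OF inv])
    qed
    have "dual_norm p (transpose T *v w) = c * dual_norm ?q w" for w
    proof -
      have "transpose S *v (transpose T *v w) = transpose (T ** S) *v w"
        by (simp only: matrix_vector_mul_assoc matrix_transpose_mul)
      also have "\<dots> = c *\<^sub>R w"
      proof -
        have "transpose (c *\<^sub>R mat 1) = c *\<^sub>R (mat 1 :: real^'m^'m)" by (simp add: transpose_def mat_def vec_eq_iff)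
        then show ?thesis unfolding TS by (simp add: scaleR_matrix_vector_assoc[symmetric])
      qed
      finally show ?thesis
        using unit_volume_norm_compose(2)[OF p S1, of "transpose T *v w"] dual_norm_scaleR[OF norm[OF q], of c w] c0
        by simp
    qed
    then have "H p = c * simplex_cost ?q" by (rule key[OF p q])
    then show ?thesis by (rule bexI[OF _ q])
  qed
  have up: "\<exists>p\<in>unit_volume_norms. H p = c * simplex_cost q" if q: "q \<in> unit_volume_norms" for q :: "real^'m \<Rightarrow> real"
  proof -
    define S where "S = (1 / c) *\<^sub>R T"
    have S1: "\<bar>det S\<bar> = 1" using c0 T by (simp add: S_def det_sc abs_mult power_one_over cm)
    let ?p = "\<lambda>x. q (S *v x)"
    have p: "?p \<in> unit_volume_norms" by (rule unit_volume_norm_compose(1)[OF q S1])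
    have "dual_norm ?p (transpose T *v w) = c * dual_norm q w" for w
    proof -
      have "transpose T *v w = c *\<^sub>R (transpose S *v w)"
        using c0 by (simp add: S_def transpose_def matrix_vector_mult_def vec_eq_iff sum_distrib_left)
      then show ?thesis
        using unit_volume_norm_compose(2)[OF q S1, of w] dual_norm_scaleR[OF norm[OF p], of c "transpose S *v w"] c0
        by simp
    qed
    then have "H ?p = c * simplex_cost q" by (rule key[OF p q])
    then show ?thesis by (rule bexI[OF _ p])
  qed
  show ?thesis
    unfolding c_def[symmetric]
  proof (rule INF_eqI)
    fix p :: "real^'m \<Rightarrow> real" assume "p \<in> unit_volume_norms"
    then obtain q :: "real^'m \<Rightarrow> real" where q: "q \<in> unit_volume_norms" "H p = c * simplex_cost q"
      by (rule bexE[OF down]) (rule that)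
    have "c * simplex_const TYPE('m) \<le> c * simplex_cost q"
      using simplex_const_le[OF q(1)] c0 by (intro mult_left_mono) auto
    then show "ereal (simplex_const TYPE('m) * c) \<le> ereal (H p)" unfolding q(2) by (simp add: mult.commute)
  next
    fix y assume y: "\<And>p. p \<in> (unit_volume_norms :: (real^'m \<Rightarrow> real) set) \<Longrightarrow> y \<le> ereal (H p)"
    have yq: "y \<le> ereal (c * simplex_cost q)" if "q \<in> unit_volume_norms" for q :: "real^'m \<Rightarrow> real"
    proof -
      obtain p where "p \<in> unit_volume_norms" "H p = c * simplex_cost q" using up[OF \<open>q \<in> unit_volume_norms\<close>] by (elim bexE)
      then show ?thesis using y[of p] by simp
    qed
    show "y \<le> ereal (simplex_const TYPE('m) * c)"
    proof (cases y)
      case (real r)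
      have "r / c \<le> simplex_const TYPE('m)"
        unfolding simplex_const_def
      proof (rule cInf_greatest)
        show "simplex_cost ` (unit_volume_norms :: (real^'m \<Rightarrow> real) set) \<noteq> {}" unfolding image_is_empty using cube_norm(1) by (metis empty_iff)
        fix x assume "x \<in> simplex_cost ` (unit_volume_norms :: (real^'m \<Rightarrow> real) set)"
        then obtain q :: "real^'m \<Rightarrow> real" where q: "q \<in> unit_volume_norms" "x = simplex_cost q" by (elim imageE)
        then show "r / c \<le> x" using yq[OF q(1)] real c0 by (simp add: field_simps)
      qed
      then show ?thesis using real c0 by (simp add: field_simps)
    next
      case PInf
      then show ?thesis using yq[OF cube_norm(1)] by simp
    qed simp
  qed
qed

section \<open>Integral operators on the eigenbasis\<close>

definition hom_eval :: "('a::comm_ring_1 \<Rightarrow> real) \<Rightarrow> 'a poly \<Rightarrow> real \<Rightarrow> real" where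
  "hom_eval h p x = poly (map_poly h p) x"

lemma hom_eval_0: "hom_eval h 0 x = 0"
  by (simp add: hom_eval_def)

lemma hom_eval_pCons: "h 0 = 0 \<Longrightarrow> hom_eval h (pCons a p) x = h a + x * hom_eval h p x"
  by (simp add: hom_eval_def map_poly_pCons)

text \<open>Treats the evaluation of integer and of rational polynomials at real points at
  once.\<close>

locale real_hom =
  fixes h :: "'a::comm_ring_1 \<Rightarrow> real"
  assumes h0: "h 0 = 0" and h1: "h 1 = 1"
    and hadd: "h (a + b) = h a + h b" and hmult: "h (a * b) = h a * h b"
begin

lemma eval_add: "hom_eval h (p + q) x = hom_eval h p x + hom_eval h q x"
  by (induction p q rule: poly_induct2) (simp_all add: hom_eval_0 hom_eval_pCons h0 hadd algebra_simps)

lemma eval_smult: "hom_eval h (smult a p) x = h a * hom_eval h p x"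
  by (induction p) (simp_all add: hom_eval_0 hom_eval_pCons h0 hmult algebra_simps)

lemma eval_mult: "hom_eval h (p * q) x = hom_eval h p x * hom_eval h q x"
  by (induction p) (simp_all add: hom_eval_0 hom_eval_pCons h0 eval_add eval_smult algebra_simps)

lemma eval_1: "hom_eval h 1 x = 1"
  by (simp add: one_pCons hom_eval_pCons hom_eval_0 h0 h1)

lemma eval_pcompose: "hom_eval h (pcompose p q) x = hom_eval h p (hom_eval h q x)"
  by (induction p) (simp_all add: hom_eval_0 hom_eval_pCons h0 eval_add eval_mult pcompose_pCons)

lemma eval_power: "hom_eval h (p ^ k) x = hom_eval h p x ^ k"
  by (induction k) (simp_all add: eval_1 eval_mult)

lemma eval_sum: "hom_eval h (sum f S) x = (\<Sum>i\<in>S. hom_eval h (f i) x)"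
  by (induction S rule: infinite_finite_induct) (simp_all add: hom_eval_0 eval_add)

lemma eval_monom: "hom_eval h (monom a k) x = h a * x ^ k"
  by (induction k) (simp_all add: monom_0 monom_Suc hom_eval_pCons hom_eval_0 h0)

end

interpretation int_hom: real_hom real_of_int by unfold_locales auto
interpretation rat_hom: real_hom "of_rat :: rat \<Rightarrow> real"
  by unfold_locales (auto simp: of_rat_add of_rat_mult)

abbreviation ipoly :: "int poly \<Rightarrow> real \<Rightarrow> real" where "ipoly \<equiv> hom_eval real_of_int"
abbreviation qpoly :: "rat poly \<Rightarrow> real \<Rightarrow> real" where "qpoly \<equiv> hom_eval of_rat"

lemma qpoly_of_int: "qpoly (map_poly rat_of_int p) x = ipoly p x"
  by (induction p) (simp_all add: map_poly_pCons hom_eval_0 hom_eval_pCons)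

lemma algebraic_int_iff_ipoly: "algebraic_int x \<longleftrightarrow> (\<exists>f. ipoly f x = 0 \<and> lead_coeff f = 1)"
  by (auto simp: algebraic_int_altdef_ipoly hom_eval_def)

lemma matrix_times_eigmat:
  assumes "\<And>j. M *v v j = c j *\<^sub>R v j"
  shows "M ** eigmat v = eigmat v ** (\<chi> a b. if a = b then c a else 0)"
  by (simp add: eigmat_mult assms)
     (simp add: vec_eq_iff eigmat_def matrix_matrix_mult_def if_distrib mult.commute cong: if_cong)

lemma det_eig:
  assumes inv: "invertible (eigmat v)" and "\<And>j. M *v v j = c j *\<^sub>R v j"
  shows "det M = (\<Prod>j\<in>UNIV. c j)"
proof -
  have "det M * det (eigmat v) = det (eigmat v) * det (\<chi> a b. if a = b then c a else 0)"
    using arg_cong[OF matrix_times_eigmat[of M v c, OF assms(2)], of det] by (simp add: det_mul)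
  also have "det (\<chi> a b. if a = b then c a else 0) = (\<Prod>j\<in>UNIV. c j)" by (subst det_diagonal) auto
  finally show ?thesis using inv by (simp add: invertible_det_nz)
qed

lemma ipoly_charpoly: "ipoly (charpoly M) x = det (x *\<^sub>R mat 1 - rmat M)"
proof -
  have "ipoly (charpoly M) x = det (\<chi> a b. ipoly ((if a = b then [:0, 1:] else 0) - [:M $ a $ b:]) x)"
    unfolding charpoly_def by (subst det_hom[of "\<lambda>p. ipoly p x"]) (simp_all add: int_hom.eval_add int_hom.eval_mult int_hom.eval_1)
  also have "(\<chi> a b. ipoly ((if a = b then [:0, 1:] else 0) - [:M $ a $ b:]) x) = x *\<^sub>R mat 1 - rmat M"
    by (simp add: vec_eq_iff mat_def rmat_def hom_eval_pCons hom_eval_0)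
  finally show ?thesis .
qed

text \<open>Both sides agree at every real point, the left one being a determinant computed in the
  eigenbasis; real polynomials with equal values coincide.\<close>

lemma charpoly_eig:
  assumes inv: "invertible (eigmat v)" and M: "\<And>j. rmat M *v v j = c j *\<^sub>R v j"
  shows "map_poly real_of_int (charpoly M) = (\<Prod>j\<in>UNIV. [:- c j, 1:])"
proof -
  have "poly (map_poly real_of_int (charpoly M)) x = poly (\<Prod>j\<in>UNIV. [:- c j, 1:]) x" for x
  proof -
    have "poly (map_poly real_of_int (charpoly M)) x = det (x *\<^sub>R mat 1 - rmat M)"
      using ipoly_charpoly[of M x] by (simp add: hom_eval_def)
    also have "\<dots> = (\<Prod>j\<in>UNIV. x - c j)"
    proof (rule det_eig[OF inv])
      fix j
      have "(x *\<^sub>R mat 1 - rmat M) *v v j = x *\<^sub>R v j - rmat M *v v j"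
        by (simp add: matrix_vector_mult_diff_rdistrib scaleR_matrix_vector_assoc[symmetric])
      then show "(x *\<^sub>R mat 1 - rmat M) *v v j = (x - c j) *\<^sub>R v j" by (simp add: M scaleR_left_diff_distrib)
    qed
    finally show ?thesis by (simp add: poly_prod)
  qed
  then show ?thesis by (simp add: poly_eq_poly_eq_iff[symmetric] fun_eq_iff)
qed

lemma degree_prod_linear: "degree (\<Prod>j\<in>S. [:- c j, 1:] :: real poly) = card S"
  by (subst degree_prod_eq_sum_degree) auto

lemma charpoly_monic:
  fixes M :: "int^'n::finite^'n"
  assumes "invertible (eigmat v)" and "\<And>j. rmat M *v v j = c j *\<^sub>R v j"
  shows "degree (charpoly M) = CARD('n)" "lead_coeff (charpoly M) = 1" "ipoly (charpoly M) (c j) = 0"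
proof -
  let ?P = "map_poly real_of_int (charpoly M)"
  have P: "?P = (\<Prod>j\<in>UNIV. [:- c j, 1:])" by (rule charpoly_eig[OF assms])
  have d: "degree ?P = degree (charpoly M)" by (rule degree_map_poly) simp
  show dn: "degree (charpoly M) = CARD('n)" using d by (simp add: P degree_prod_linear)
  have "lead_coeff ?P = 1" unfolding P by (subst lead_coeff_prod) simp
  then have "real_of_int (lead_coeff (charpoly M)) = 1" using d by (simp add: coeff_map_poly)
  then show "lead_coeff (charpoly M) = 1" by simp
  show "ipoly (charpoly M) (c j) = 0" unfolding hom_eval_def P by (auto simp: poly_prod intro!: prod_zero)
qed

text \<open>\<^term>\<open>c\<close> lists the eigenvalues of an operator that is diagonal in the basis \<^term>\<open>v\<close>. For
  the conjugates of an element of the number field, \<open>integral_over\<close> turns out to be equivalent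
  to being algebraic integers, but unlike the latter it is visibly closed under products.\<close>

definition lattice_mult :: "('n::finite \<Rightarrow> real^'n) \<Rightarrow> ('n \<Rightarrow> real) \<Rightarrow> bool" where
  "lattice_mult v c \<longleftrightarrow> (\<exists>Y :: int^'n^'n. \<forall>j. rmat Y *v v j = c j *\<^sub>R v j)"

definition integral_over :: "('n::finite \<Rightarrow> real^'n) \<Rightarrow> ('n \<Rightarrow> real) \<Rightarrow> bool" where
  "integral_over v c \<longleftrightarrow> (\<exists>D::nat. D > 0 \<and> (\<forall>k. lattice_mult v (\<lambda>j. real D * c j ^ k)))"

lemma lattice_mult_diff: "lattice_mult v c \<Longrightarrow> lattice_mult v d \<Longrightarrow> lattice_mult v (\<lambda>j. c j - d j)"
proof (unfold lattice_mult_def, elim exE)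
  fix Y Z assume "\<forall>j. rmat Y *v v j = c j *\<^sub>R v j" "\<forall>j. rmat Z *v v j = d j *\<^sub>R v j"
  moreover have "rmat (Y - Z) = rmat Y - rmat Z" by (simp add: rmat_def vec_eq_iff)
  ultimately show "\<exists>Y. \<forall>j. rmat Y *v v j = (c j - d j) *\<^sub>R v j"
    by (intro exI[of _ "Y - Z"]) (simp add: matrix_vector_mult_diff_rdistrib scaleR_left_diff_distrib)
qed

lemma lattice_mult_mult: "lattice_mult v c \<Longrightarrow> lattice_mult v d \<Longrightarrow> lattice_mult v (\<lambda>j. c j * d j)"
proof (unfold lattice_mult_def, elim exE)
  fix Y Z assume "\<forall>j. rmat Y *v v j = c j *\<^sub>R v j" "\<forall>j. rmat Z *v v j = d j *\<^sub>R v j"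
  then show "\<exists>Y. \<forall>j. rmat Y *v v j = (c j * d j) *\<^sub>R v j"
    by (intro exI[of _ "Y ** Z"]) (simp add: rmat_mult matrix_vector_mul_assoc[symmetric] matrix_vector_mult_scaleR mult.commute)
qed

lemma lattice_mult_of_int: "lattice_mult v (\<lambda>j. real_of_int k)" for v :: "'n::finite \<Rightarrow> real^'n"
proof -
  have "rmat (\<chi> a b. if a = b then k else 0) = real_of_int k *\<^sub>R (mat 1 :: real^'n^'n)" by (simp add: rmat_def mat_def vec_eq_iff)
  then show ?thesis unfolding lattice_mult_def
    by (intro exI[of _ "\<chi> a b. if a = b then k else 0"]) (simp add: scaleR_matrix_vector_assoc[symmetric])
qed

lemma lattice_mult_add: "lattice_mult v c \<Longrightarrow> lattice_mult v d \<Longrightarrow> lattice_mult v (\<lambda>j. c j + d j)"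
  using lattice_mult_diff[OF _ lattice_mult_diff[OF lattice_mult_of_int[of v 0]], of c d] by simp

lemma lattice_mult_sum: "(\<And>i. i \<in> S \<Longrightarrow> lattice_mult v (f i)) \<Longrightarrow> lattice_mult v (\<lambda>j. \<Sum>i\<in>S. f i j)"
proof (induction S rule: infinite_finite_induct)
  case (insert i S)
  then have "lattice_mult v (\<lambda>j. f i j + (\<Sum>i\<in>S. f i j))" by (intro lattice_mult_add) auto
  with insert show ?case by simp
qed (use lattice_mult_of_int[of v 0] in simp_all)

lemma lattice_mult_of_int_mult: "lattice_mult v c \<Longrightarrow> lattice_mult v (\<lambda>j. real_of_int k * c j)"
  by (rule lattice_mult_mult[OF lattice_mult_of_int])

text \<open>Bounded denominators of all powers characterise integrality here, and the bounds of two
  factors simply multiply.\<close>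

lemma integral_over_mult:
  assumes "integral_over v c" "integral_over v d" shows "integral_over v (\<lambda>j. c j * d j)"
proof -
  obtain D E where D: "D > 0" "\<And>k. lattice_mult v (\<lambda>j. real D * c j ^ k)"
    and E: "E > 0" "\<And>k. lattice_mult v (\<lambda>j. real E * d j ^ k)"
    using assms unfolding integral_over_def by blast
  have "lattice_mult v (\<lambda>j. real (D * E) * (c j * d j) ^ k)" for k
    using lattice_mult_mult[OF D(2)[of k] E(2)[of k]] by (simp add: power_mult_distrib mult_ac)
  then show ?thesis unfolding integral_over_def using D(1) E(1) by (intro exI[of _ "D * E"]) auto
qed

text \<open>The vectors mapped into the integer lattice by all \<^term>\<open>D\<close>-fold powers of the operator form
  a lattice that the operator preserves; in a basis of it the operator is an integer matrix.\<close>

lemma integral_over_int_matrix: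
  assumes inv: "invertible (eigmat v)" and int: "integral_over v c"
  obtains N :: "int^'n::finite^'n" and w where "invertible (eigmat w)" "\<And>j. rmat N *v w j = c j *\<^sub>R w j"
proof -
  obtain D where D0: "D > 0" and D: "\<And>k. lattice_mult v (\<lambda>j. real D * c j ^ k)"
    using int unfolding integral_over_def by blast
  from D have "\<exists>Y :: int^'n^'n. \<forall>j. rmat Y *v v j = (real D * c j ^ k) *\<^sub>R v j" for k
    by (auto simp: lattice_mult_def)
  then obtain Y :: "nat \<Rightarrow> int^'n^'n" where Y: "\<And>k j. rmat (Y k) *v v j = (real D * c j ^ k) *\<^sub>R v j" by metis
  define X where "X = (1 / real D) *\<^sub>R rmat (Y 1)"
  have X: "X *v v j = c j *\<^sub>R v j" for j using D0 by (simp add: X_def scaleR_matrix_vector_assoc[symmetric] Y)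
  have YX: "rmat (Y k) ** X = rmat (Y (Suc k))" for k
    by (rule matrix_eq_on_eigenbasis[OF inv])
       (simp add: matrix_vector_mul_assoc[symmetric] X Y matrix_vector_mult_scaleR mult_ac)
  have Y0: "rmat (Y 0) = real D *\<^sub>R mat 1"
    by (rule matrix_eq_on_eigenbasis[OF inv]) (simp add: Y scaleR_matrix_vector_assoc[symmetric])
  define L where "L = {u :: real^'n. \<forall>k. \<exists>m. rmat (Y k) *v u = int_vec m}"
  have L0: "0 \<in> L" unfolding L_def by (auto intro!: exI[of _ 0] simp: int_vec_0)
  have Ld: "x - y \<in> L" if xy: "x \<in> L" "y \<in> L" for x y
    unfolding L_def
  proof (clarify)
    fix k
    obtain m m' where "rmat (Y k) *v x = int_vec m" "rmat (Y k) *v y = int_vec m'"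
      using xy unfolding L_def by blast
    then show "\<exists>m. rmat (Y k) *v (x - y) = int_vec m"
      by (intro exI[of _ "m - m'"]) (simp add: matrix_vector_mult_diff_distrib int_vec_diff)
  qed
  have ax: "axis i 1 \<in> L" for i
    unfolding L_def
  proof clarify
    fix k show "\<exists>m. rmat (Y k) *v axis i 1 = int_vec m"
      by (rule exI[of _ "Y k *v axis i 1"]) (simp add: int_vec_mult int_vec_axis)
  qed
  \<comment> \<open>The condition for \<open>k = 0\<close> says that \<open>D\<close> times the
    vector is integral, so \<open>L\<close> is discrete.\<close>
  have fin: "finite {x \<in> L. norm x \<le> C}" for C
  proof (rule finite_subset)
    show "{x \<in> L. norm x \<le> C} \<subseteq> (\<lambda>m. (1 / real D) *\<^sub>R int_vec m) ` {m. \<forall>j. \<bar>int_vec m $ j\<bar> \<le> real D * C}"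
    proof
      fix x assume x: "x \<in> {x \<in> L. norm x \<le> C}"
      then obtain m where m: "rmat (Y 0) *v x = int_vec m" unfolding L_def by blast
      then have Dx: "real D *\<^sub>R x = int_vec m" by (simp add: Y0 scaleR_matrix_vector_assoc[symmetric])
      have "\<bar>int_vec m $ j\<bar> \<le> real D * C" for j
      proof -
        have "\<bar>int_vec m $ j\<bar> = real D * \<bar>x $ j\<bar>" unfolding Dx[symmetric] by (simp add: abs_mult)
        also have "\<dots> \<le> real D * C" using component_le_norm_cart[of x j] x by (intro mult_left_mono) auto
        finally show ?thesis .
      qed
      moreover have "x = (1 / real D) *\<^sub>R int_vec m" using D0 by (simp flip: Dx)
      ultimately show "x \<in> (\<lambda>m. (1 / real D) *\<^sub>R int_vec m) ` {m. \<forall>j. \<bar>int_vec m $ j\<bar> \<le> real D * C}" by blast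
    qed
  qed (intro finite_imageI finite_int_vec_bounded)
  have "eigmat (\<lambda>i. axis i 1) = (mat 1 :: real^'n^'n)" by (simp add: eigmat_def mat_def axis_def vec_eq_iff)
  then have "invertible (eigmat (\<lambda>i. axis i 1 :: real^'n))" by (simp add: invertible_def exI[of _ "mat 1"])
  then have "\<exists>b. (\<forall>i. b i \<in> L) \<and> invertible (eigmat b) \<and> L = zspan b"
    using L0 Ld fin ax by (intro discrete_subgroup_basis[of L "\<lambda>i. axis i 1"])
  then obtain b where b: "\<And>i. b i \<in> L" "invertible (eigmat b)" "L = zspan b" by blast
  \<comment> \<open>\<open>X\<close> shifts the conditions by one, because \<open>Y k\<close> times
    \<open>X\<close> is \<open>Y (Suc k)\<close>.\<close>
  have XL: "X *v u \<in> L" if "u \<in> L" for u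
    unfolding L_def
  proof clarify
    fix k
    have "rmat (Y k) *v (X *v u) = rmat (Y (Suc k)) *v u" by (simp only: matrix_vector_mul_assoc YX)
    then show "\<exists>m. rmat (Y k) *v (X *v u) = int_vec m" using that unfolding L_def by auto
  qed
  have "\<exists>m. X *v b i = eigmat b *v int_vec m" for i using XL[OF b(1)[of i]] unfolding b(3) zspan_def by blast
  then obtain n where n: "\<And>i. X *v b i = eigmat b *v int_vec (n i)" by metis
  define N where "N = (\<chi> a i. n i $ a)"
  have "eigmat (\<lambda>i. int_vec (n i)) = rmat N" by (simp add: eigmat_def N_def rmat_def vec_eq_iff)
  then have XB: "X ** eigmat b = eigmat b ** rmat N" by (metis (no_types, lifting) eigmat_mult n ext)
  let ?Bi = "matrix_inv (eigmat b)"
  define w where "w j = ?Bi *v v j" for j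
  have iBi: "invertible ?Bi" using matrix_inv_left[OF b(2)] matrix_inv_right[OF b(2)] unfolding invertible_def by blast
  have "eigmat w = ?Bi ** eigmat v" by (simp add: eigmat_mult w_def[abs_def])
  then have iw: "invertible (eigmat w)" using invertible_mult[OF iBi inv] by simp
  have "rmat N *v w j = c j *\<^sub>R w j" for j
  proof -
    have "rmat N = ?Bi ** (eigmat b ** rmat N)" by (simp add: matrix_mul_assoc matrix_inv_left[OF b(2)])
    then have "rmat N *v w j = (?Bi ** (X ** eigmat b)) *v w j" by (simp add: XB)
    also have "\<dots> = ?Bi *v (X *v (eigmat b *v w j))" by (simp only: matrix_vector_mul_assoc matrix_mul_assoc)
    also have "eigmat b *v w j = v j" by (simp only: w_def matrix_inv_mult_vec[OF b(2)])
    finally show ?thesis by (simp add: X matrix_vector_mult_scaleR w_def)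
  qed
  then show ?thesis using that iw by blast
qed

section \<open>The number field\<close>

text \<open>Each linear factor multiplies the bound on the coefficients by at most
  \<open>1 + B\<close>. Bounded conjugates thus leave finitely many integer polynomials.\<close>

lemma coeff_prod_linear_bound:
  fixes c :: "'a \<Rightarrow> real"
  assumes "finite S" "\<And>j. j \<in> S \<Longrightarrow> \<bar>c j\<bar> \<le> B" "B \<ge> 0"
  shows "\<bar>coeff (\<Prod>j\<in>S. [:- c j, 1:]) i\<bar> \<le> (1 + B) ^ card S"
  using assms
proof (induction S arbitrary: i)
  case (insert j S)
  let ?P = "\<Prod>j\<in>S. [:- c j, 1:]"
  have IH: "\<bar>coeff ?P i\<bar> \<le> (1 + B) ^ card S" for i using insert by auto
  have "coeff (\<Prod>j\<in>insert j S. [:- c j, 1:]) i = - (c j * coeff ?P i) + coeff (pCons 0 ?P) i"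
    using insert by simp
  also have "\<bar>\<dots>\<bar> \<le> \<bar>c j\<bar> * \<bar>coeff ?P i\<bar> + \<bar>coeff (pCons 0 ?P) i\<bar>" by (simp add: abs_mult[symmetric])
  also have "\<dots> \<le> B * (1 + B) ^ card S + (1 + B) ^ card S"
  proof (rule add_mono)
    show "\<bar>c j\<bar> * \<bar>coeff ?P i\<bar> \<le> B * (1 + B) ^ card S" using insert IH by (intro mult_mono) auto
    show "\<bar>coeff (pCons 0 ?P) i\<bar> \<le> (1 + B) ^ card S"
      using IH insert.prems(2) by (cases i) (auto simp: coeff_pCons)
  qed
  also have "\<dots> = (1 + B) ^ card (insert j S)" using insert by (simp add: algebra_simps)
  finally show ?case .
qed simp

lemma finite_int_polys_bounded: "finite {f :: int poly. degree f \<le> n \<and> (\<forall>i. \<bar>real_of_int (coeff f i)\<bar> \<le> C)}"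
proof -
  let ?S = "{f :: int poly. degree f \<le> n \<and> (\<forall>i. \<bar>real_of_int (coeff f i)\<bar> \<le> C)}"
  have "coeffs ` ?S \<subseteq> {xs. set xs \<subseteq> {- \<lfloor>C\<rfloor> .. \<lfloor>C\<rfloor>} \<and> length xs \<le> Suc n}"
  proof clarsimp
    fix f :: "int poly" assume f: "degree f \<le> n" "\<forall>i. \<bar>real_of_int (coeff f i)\<bar> \<le> C"
    have "coeff f i \<in> {- \<lfloor>C\<rfloor> .. \<lfloor>C\<rfloor>}" for i
    proof -
      have "\<bar>real_of_int (coeff f i)\<bar> \<le> C" using f by blast
      then have "coeff f i \<le> \<lfloor>C\<rfloor>" "- (coeff f i) \<le> \<lfloor>C\<rfloor>" by linarith+
      then show ?thesis by simp
    qed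
    then have "set (coeffs f) \<subseteq> {- \<lfloor>C\<rfloor> .. \<lfloor>C\<rfloor>}" by (auto simp: coeffs_def split: if_splits)
    moreover have "length (coeffs f) \<le> Suc n" using f by (cases "f = 0") (simp_all add: length_coeffs_degree)
    ultimately show "set (coeffs f) \<subseteq> {- \<lfloor>C\<rfloor> .. \<lfloor>C\<rfloor>} \<and> length (coeffs f) \<le> Suc n" by blast
  qed
  then have "finite (coeffs ` ?S)" by (rule finite_subset) (rule finite_lists_length_le, simp)
  then show ?thesis by (rule finite_imageD) (auto simp: inj_on_def coeffs_eq_iff)
qed

lemma integral_over_poly:
  assumes "invertible (eigmat v)" "integral_over v c"
  obtains f :: "int poly" where "map_poly real_of_int f = (\<Prod>j\<in>UNIV. [:- c j, 1:])" "lead_coeff f = 1"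
proof -
  obtain N w where N: "invertible (eigmat w)" "\<And>j. rmat N *v w j = c j *\<^sub>R w j"
    using integral_over_int_matrix[OF assms] by metis
  from charpoly_eig[OF N] charpoly_monic(2)[OF N] show ?thesis using that by blast
qed

lemma integral_over_algebraic_int:
  assumes "invertible (eigmat v)" "integral_over v c" shows "algebraic_int (c j)"
proof -
  obtain f where "map_poly real_of_int f = (\<Prod>j\<in>UNIV. [:- c j, 1:])" "lead_coeff f = 1"
    using integral_over_poly[OF assms] by metis
  then show ?thesis unfolding algebraic_int_iff_ipoly
    by (intro exI[of _ f]) (auto simp: hom_eval_def poly_prod intro!: prod_zero)
qed

text \<open>The product is the determinant of an integer matrix with these eigenvalues.\<close>

lemma integral_over_prod_Ints:
  fixes c :: "'n::finite \<Rightarrow> real"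
  assumes "invertible (eigmat v)" "integral_over v c" shows "(\<Prod>j\<in>UNIV. c j) \<in> \<int>"
proof -
  obtain N w where N: "invertible (eigmat w)" "\<And>j. rmat N *v w j = c j *\<^sub>R w j"
    using integral_over_int_matrix[OF assms] by metis
  show ?thesis using det_eig[OF N] det_rmat[of N] by (metis Ints_of_int)
qed

lemma rat_of_int_div_nat: "\<exists>k (d::nat). d > 0 \<and> real d * of_rat a = real_of_int k" for a :: rat
proof -
  obtain k d where a: "quotient_of a = (k, d)" by (cases "quotient_of a")
  then have d: "d > 0" "a = rat_of_int k / rat_of_int d"
    using quotient_of_denom_pos quotient_of_div by auto
  then have "real (nat d) * of_rat a = real_of_int k" by (simp add: of_rat_divide)
  then show ?thesis using d(1) by (intro exI[of _ k] exI[of _ "nat d"]) simp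
qed

section \<open>Conjugates and integrality\<close>

locale cartan = torus_action A v mu
  for A :: "'m::finite \<Rightarrow> int^'n::finite^'n" and v :: "'n \<Rightarrow> real^'n" and mu :: "'m \<Rightarrow> 'n \<Rightarrow> real" +
  fixes i0 :: 'm and j1 :: 'n
  assumes irr: "irreducible (map_poly rat_of_int (charpoly (A i0)))"
    and inj_act: "inj (act_mat A)"
begin

abbreviation "lam \<equiv> mu i0"
abbreviation "P0 \<equiv> map_poly rat_of_int (charpoly (A i0))"

lemma P0_root: "qpoly P0 (lam j) = 0"
  using charpoly_monic(3)[OF inv_V A_eig] by (simp add: qpoly_of_int)

lemma degree_P0: "degree P0 = CARD('n)"
  using charpoly_monic(1)[OF inv_V A_eig[of i0]] by (subst degree_map_poly) auto

lemma bezout_P0: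
  assumes "\<not> P0 dvd q" obtains s t where "s * P0 + t * q = 1"
proof -
  have "prime_elem P0" using irr by (rule field_poly_irreducible_imp_prime)
  then have "coprime P0 q" using assms by (rule prime_elem_imp_coprime)
  then have "fst (bezout_coefficients P0 q) * P0 + snd (bezout_coefficients P0 q) * q = 1"
    by (simp add: bezout_coefficients_fst_snd)
  then show ?thesis using that by blast
qed

lemma P0_dvd: assumes "qpoly q (lam j) = 0" shows "P0 dvd q"
proof (rule ccontr)
  assume "\<not> P0 dvd q"
  then obtain s t where "s * P0 + t * q = 1" using bezout_P0 by blast
  then have "qpoly (s * P0 + t * q) (lam j) = 1" by (simp add: rat_hom.eval_1)
  then show False by (simp add: rat_hom.eval_add rat_hom.eval_mult P0_root assms)
qed

text \<open>Underlies the embeddings: \<open>P0\<close> is irreducible and vanishes at every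
  eigenvalue, so a rational relation of one eigenvalue holds for all.\<close>

lemma conjugate_root: assumes "qpoly q (lam j) = 0" shows "qpoly q (lam j') = 0"
  using P0_dvd[OF assms] by (auto simp: dvd_def rat_hom.eval_mult P0_root)

lemma conjugate_eq:
  assumes "qpoly p (lam j) = qpoly q (lam j)" shows "qpoly p (lam j') = qpoly q (lam j')"
proof -
  have diff: "qpoly (p - q) x = qpoly p x - qpoly q x" for x
    using rat_hom.eval_add[of "p - q" q x] by simp
  show ?thesis using conjugate_root[of "p - q" j j'] assms by (simp add: diff)
qed

lemma nf_field_iff: "x \<in> nf_field (lam j1) \<longleftrightarrow> (\<exists>q. x = qpoly q (lam j1))"
  by (simp add: nf_field_def hom_eval_def)

text \<open>\<open>nf_emb\<close> chooses some polynomial representing the element; two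
  representatives agree at one eigenvalue, hence at all.\<close>

lemma nf_emb_qpoly: "nf_emb (lam j1) (lam j) (qpoly q (lam j1)) = qpoly q (lam j)"
proof -
  define p where "p = (SOME p. qpoly q (lam j1) = qpoly p (lam j1))"
  have "qpoly q (lam j1) = qpoly p (lam j1)" unfolding p_def by (rule someI[of _ q]) simp
  then have "qpoly p (lam j) = qpoly q (lam j)" using conjugate_eq[of q j1 p j] by simp
  then show ?thesis unfolding nf_emb_def p_def hom_eval_def .
qed

text \<open>Clearing the denominators of \<open>q\<close> makes it an integer polynomial in the
  integer matrix \<open>A i0\<close>.\<close>

lemma lattice_mult_qpoly: "\<exists>D::nat. D > 0 \<and> lattice_mult v (\<lambda>j. real D * qpoly q (lam j))"
proof (induction q)
  case 0
  show ?case using lattice_mult_of_int[of v 0] by (intro exI[of _ 1]) (simp add: hom_eval_0)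
next
  case (pCons a q)
  then obtain D :: nat where D: "D > 0" "lattice_mult v (\<lambda>j. real D * qpoly q (lam j))" by blast
  obtain k and d :: nat where d: "d > 0" "real d * of_rat a = real_of_int k" using rat_of_int_div_nat by blast
  have "lattice_mult v lam" unfolding lattice_mult_def using A_eig by blast
  then have "lattice_mult v (\<lambda>j. real_of_int (int D * k) + lam j * (real_of_int (int d) * (real D * qpoly q (lam j))))"
    by (intro lattice_mult_add lattice_mult_of_int lattice_mult_mult lattice_mult_of_int_mult D)
  also have "(\<lambda>j. real_of_int (int D * k) + lam j * (real_of_int (int d) * (real D * qpoly q (lam j))))
      = (\<lambda>j. real (d * D) * qpoly (pCons a q) (lam j))"
    using d(2)[symmetric] by (auto simp: hom_eval_pCons algebra_simps)
  finally show ?case using D(1) d(1) by (intro exI[of _ "d * D"]) simp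
qed

text \<open>A monic integer equation of degree \<open>d\<close> passes to all conjugates through the
  composition of \<open>f\<close> with \<open>q\<close>. It expresses each higher power by integer
  combinations of lower ones, so the product of the denominators of the first \<open>d\<close>
  powers serves for all.\<close>

lemma algebraic_int_integral:
  assumes "algebraic_int (qpoly q (lam j1))"
  shows "integral_over v (\<lambda>j. qpoly q (lam j))"
proof -
  obtain f where f: "ipoly f (qpoly q (lam j1)) = 0" "lead_coeff f = 1"
    using assms algebraic_int_iff_ipoly by blast
  let ?c = "\<lambda>j. qpoly q (lam j)"
  define d where "d = degree f"
  have root: "ipoly f (?c j) = 0" for j
  proof -
    have e: "qpoly (pcompose (map_poly rat_of_int f) q) (lam j) = ipoly f (?c j)" for j
      by (simp add: rat_hom.eval_pcompose qpoly_of_int)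
    show ?thesis using conjugate_root[of "pcompose (map_poly rat_of_int f) q" j1 j] f(1) by (simp add: e)
  qed
  have pow: "?c j ^ d = - (\<Sum>i<d. real_of_int (coeff f i) * ?c j ^ i)" for j
  proof -
    have "0 = (\<Sum>i\<le>d. real_of_int (coeff f i) * ?c j ^ i)"
      using root[of j] unfolding hom_eval_def d_def poly_altdef
      by (simp add: coeff_map_poly degree_map_poly)
    also have "\<dots> = (\<Sum>i<d. real_of_int (coeff f i) * ?c j ^ i) + ?c j ^ d"
      using f(2) by (simp add: lessThan_Suc_atMost[symmetric] d_def)
    finally show ?thesis by simp
  qed
  have "\<exists>D::nat. D > 0 \<and> lattice_mult v (\<lambda>j. real D * ?c j ^ i)" for i
    using lattice_mult_qpoly[of "q ^ i"] by (simp add: rat_hom.eval_power)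
  then obtain D :: "nat \<Rightarrow> nat" where D: "\<And>i. D i > 0" "\<And>i. lattice_mult v (\<lambda>j. real (D i) * ?c j ^ i)" by metis
  define E where "E = (\<Prod>i<d. D i)"
  have "lattice_mult v (\<lambda>j. real E * ?c j ^ k)" for k
  proof (induction k rule: less_induct)
    case (less k)
    show ?case
    proof (cases "k < d")
      case True
      have "E = D k * (\<Prod>i\<in>{..<d} - {k}. D i)" unfolding E_def using True by (simp add: prod.remove)
      then have "(\<lambda>j. real E * ?c j ^ k) = (\<lambda>j. real_of_int (int (\<Prod>i\<in>{..<d} - {k}. D i)) * (real (D k) * ?c j ^ k))"
        by (simp add: mult_ac)
      then show ?thesis using lattice_mult_of_int_mult[OF D(2)[of k]] by metis
    next
      case False
      have "real E * ?c j ^ k = 0 - (\<Sum>i<d. real_of_int (coeff f i) * (real E * ?c j ^ (k - d + i)))" for j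
      proof -
        have "?c j ^ k = ?c j ^ (k - d) * ?c j ^ d" using False by (simp flip: power_add)
        also have "\<dots> = - (\<Sum>i<d. real_of_int (coeff f i) * ?c j ^ (k - d + i))"
          by (simp add: pow sum_distrib_left power_add mult_ac)
        finally show ?thesis by (simp add: sum_distrib_left mult_ac)
      qed
      moreover have "lattice_mult v (\<lambda>j. real_of_int 0 - (\<Sum>i<d. real_of_int (coeff f i) * (real E * ?c j ^ (k - d + i))))"
        by (intro lattice_mult_diff lattice_mult_of_int lattice_mult_sum lattice_mult_of_int_mult less.IH) (use False in auto)
      ultimately show ?thesis by simp
    qed
  qed
  then show ?thesis unfolding integral_over_def using D(1) by (intro exI[of _ E]) (simp add: E_def)
qed

text \<open>Trades \<open>algebraic_int\<close> for \<open>integral_over\<close>, which is stable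
  under products. The polynomial \<open>t\<close>, from a Bezout relation with \<open>P0\<close>,
  represents the inverse at all conjugates simultaneously.\<close>

lemma nf_unit_iff:
  "x \<in> nf_units (lam j1) \<longleftrightarrow> (\<exists>q t. x = qpoly q (lam j1) \<and> (\<forall>j. qpoly q (lam j) * qpoly t (lam j) = 1) \<and>
     integral_over v (\<lambda>j. qpoly q (lam j)) \<and> integral_over v (\<lambda>j. qpoly t (lam j)))"
proof
  assume "x \<in> nf_units (lam j1)"
  then obtain q where q: "x = qpoly q (lam j1)" and x: "x \<noteq> 0" "algebraic_int x" "algebraic_int (inverse x)"
    unfolding nf_units_def using nf_field_iff by blast
  have "\<not> P0 dvd q" using x(1) q by (auto simp: dvd_def rat_hom.eval_mult P0_root)
  then obtain s t where st: "s * P0 + t * q = 1" using bezout_P0 by blast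
  have 1: "qpoly q (lam j) * qpoly t (lam j) = 1" for j
  proof -
    have "qpoly (s * P0 + t * q) (lam j) = 1" by (simp add: st rat_hom.eval_1)
    then show ?thesis by (simp add: rat_hom.eval_add rat_hom.eval_mult P0_root mult.commute)
  qed
  then have "inverse x = qpoly t (lam j1)" using q by (metis inverse_unique)
  then show "\<exists>q t. x = qpoly q (lam j1) \<and> (\<forall>j. qpoly q (lam j) * qpoly t (lam j) = 1) \<and>
     integral_over v (\<lambda>j. qpoly q (lam j)) \<and> integral_over v (\<lambda>j. qpoly t (lam j))"
    using q 1 x algebraic_int_integral[of q] algebraic_int_integral[of t] by auto
next
  assume "\<exists>q t. x = qpoly q (lam j1) \<and> (\<forall>j. qpoly q (lam j) * qpoly t (lam j) = 1) \<and>
     integral_over v (\<lambda>j. qpoly q (lam j)) \<and> integral_over v (\<lambda>j. qpoly t (lam j))"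
  then obtain q t where q: "x = qpoly q (lam j1)" "\<And>j. qpoly q (lam j) * qpoly t (lam j) = 1"
    "integral_over v (\<lambda>j. qpoly q (lam j))" "integral_over v (\<lambda>j. qpoly t (lam j))" by blast
  have "inverse x = qpoly t (lam j1)" using q by (metis inverse_unique)
  moreover have "x \<noteq> 0" using q(1) q(2)[of j1] by auto
  ultimately show "x \<in> nf_units (lam j1)" unfolding nf_units_def
    using q nf_field_iff integral_over_algebraic_int[OF inv_V q(3), of j1] integral_over_algebraic_int[OF inv_V q(4), of j1]
    by auto
qed

end

section \<open>Generators as field elements, and the units\<close>

context cartan
begin

text \<open>The Krylov vectors of an integer vector under \<^term>\<open>A i0\<close> are linearly independent over the rationals, by
  irreducibility, so every integer matrix commuting with \<^term>\<open>A i0\<close> is a rational polynomial in it.\<close>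

lemma mu_qpoly: "\<exists>q. \<forall>j. mu i j = qpoly q (lam j)"
proof -
  define w :: "int^'n" where "w = axis j1 1"
  define z where "z = eig_coord v (int_vec w)"
  have "int_vec w \<noteq> 0" by (simp add: w_def int_vec_axis axis_eq_0_iff)
  have zV: "eigmat v *v z = int_vec w" unfolding z_def by (rule matrix_inv_mult_vec[OF inv_V])
  have "z \<noteq> 0" using zV \<open>int_vec w \<noteq> 0\<close> by auto
  then obtain jz where jz: "z $ jz \<noteq> 0" by (auto simp: vec_eq_iff)
  obtain \<kappa> :: "'n \<Rightarrow> nat" where \<kappa>: "bij_betw \<kappa> UNIV {..<CARD('n)}"
    using ex_bij_betw_finite_nat[of "UNIV :: 'n set"] by (auto simp: atLeast0LessThan)
  have \<kappa>n: "\<kappa> b < CARD('n)" for b using \<kappa> by (auto simp: bij_betw_def)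
  define u where "u k = ((\<lambda>x. A i0 *v x) ^^ k) w" for k
  have cu: "eig_coord v (int_vec (u k)) $ j = lam j ^ k * z $ j" for k j
    by (induction k) (simp_all add: u_def z_def int_vec_mult eig_coord_apply[OF inv_V A_eig])
  \<comment> \<open>The columns are the Krylov vectors, numbered through \<open>\<kappa>\<close>,
    and \<open>Q y\<close> has \<open>y\<close> as coefficient vector, so \<open>U *v y\<close> is
    \<open>Q y\<close> of the operator applied to \<open>w\<close>.\<close>
  define U :: "rat^'n^'n" where "U = (\<chi> a b. rat_of_int (u (\<kappa> b) $ a))"
  define Q where "Q y = (\<Sum>b\<in>UNIV. monom (y $ b) (\<kappa> b))" for y :: "rat^'n"
  have Qeval: "qpoly (Q y) x = (\<Sum>b\<in>UNIV. of_rat (y $ b) * x ^ \<kappa> b)" for y x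
    by (simp add: Q_def rat_hom.eval_sum rat_hom.eval_monom)
  have Qdeg: "degree (Q y) < CARD('n)" for y
  proof -
    have "degree (Q y) \<le> CARD('n) - 1" unfolding Q_def
      by (intro degree_sum_le order_trans[OF degree_monom_le]) (use \<kappa>n in \<open>auto simp: less_eq_Suc_le le_diff_conv2\<close>)
    then show ?thesis using zero_less_card_finite[where 'a='n] by linarith
  qed
  have key: "eig_coord v (\<chi> a. of_rat ((U *v y) $ a)) $ j = qpoly (Q y) (lam j) * z $ j" for y j
  proof -
    have "(\<chi> a. of_rat ((U *v y) $ a)) = (\<Sum>b\<in>UNIV. of_rat (y $ b) *\<^sub>R int_vec (u (\<kappa> b)))"
      by (simp add: vec_eq_iff U_def matrix_vector_mult_def of_rat_sum of_rat_mult mult.commute)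
    then have "eig_coord v (\<chi> a. of_rat ((U *v y) $ a)) $ j = (\<Sum>b\<in>UNIV. of_rat (y $ b) * (lam j ^ \<kappa> b * z $ j))"
      by (simp add: linear_sum[OF matrix_vector_mul_linear] matrix_vector_mult_scaleR cu)
    then show ?thesis by (simp add: Qeval sum_distrib_left mult_ac)
  qed
  \<comment> \<open>A relation makes \<open>Q y\<close> vanish at an eigenvalue with
    \<open>z $ jz \<noteq> 0\<close>, and a multiple of \<open>P0\<close> of smaller degree is
    0.\<close>
  have ker: "y = 0" if "U *v y = 0" for y
  proof -
    have "(\<chi> a. of_rat ((U *v y) $ a)) = (0 :: real^'n)" by (simp add: that vec_eq_iff)
    then have "qpoly (Q y) (lam jz) * z $ jz = 0" using key[of y jz] by simp
    then have "P0 dvd Q y" using jz by (intro P0_dvd[of _ jz]) simp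
    then have "Q y = 0" using Qdeg[of y] degree_P0 dvd_imp_degree_le[of P0 "Q y"] by linarith
    have "y $ b = coeff (Q y) (\<kappa> b)" for b
    proof -
      have "coeff (Q y) (\<kappa> b) = (\<Sum>b'\<in>UNIV. if b' = b then y $ b' else 0)"
        unfolding Q_def coeff_sum
        using \<kappa> by (intro sum.cong) (auto simp: bij_betw_def inj_on_eq_iff)
      then show ?thesis by simp
    qed
    then show ?thesis using \<open>Q y = 0\<close> by (simp add: vec_eq_iff)
  qed
  then have "\<exists>B. B ** U = mat 1" unfolding matrix_left_invertible_ker by blast
  then obtain B where "B ** U = mat 1" by blast
  then have UB: "U ** B = mat 1" by (rule matrix_left_right_inverse[THEN iffD1])
  have sol: "\<exists>y. U *v y = r" for r :: "rat^'n"
    by (rule exI[of _ "B *v r"]) (simp add: matrix_vector_mul_assoc UB)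
  \<comment> \<open>Every integer vector is some \<open>U *v y\<close>, with j-th eigencoordinate a
    multiple of \<open>z $ j\<close>. Were \<open>z $ j\<close> zero, this coordinate would vanish
    on the standard basis, hence on \<open>v j\<close>.\<close>
  have znz: "z $ j \<noteq> 0" for j
  proof
    assume zj: "z $ j = 0"
    have "eig_coord v (int_vec m) $ j = 0" for m
    proof -
      obtain y where y: "U *v y = (\<chi> a. rat_of_int (m $ a))" using sol by blast
      have "int_vec m = (\<chi> a. of_rat ((U *v y) $ a))" by (simp add: y vec_eq_iff)
      then show ?thesis using key[of y j] zj by simp
    qed
    then have "eig_coord v (axis a 1) $ j = 0" for a using int_vec_axis[of a] by metis
    then have "matrix_inv (eigmat v) $ j $ a = 0" for a
      by (simp add: matrix_vector_mult_basis column_def)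
    then have "eig_coord v (v j) $ j = 0" by (simp add: matrix_vector_mult_def)
    moreover have "eig_coord v (v j) = axis j 1" using matrix_inv_mult_vec(2)[OF inv_V, of "axis j 1"] by (simp add: eigmat_axis)
    ultimately show False by simp
  qed
  obtain y where y: "U *v y = (\<chi> a. rat_of_int ((A i *v w) $ a))" using sol by blast
  have "int_vec (A i *v w) = (\<chi> a. of_rat ((U *v y) $ a))" by (simp add: y vec_eq_iff)
  then have "mu i j * z $ j = qpoly (Q y) (lam j) * z $ j" for j
    using key[of y j] eig_coord_apply[OF inv_V, of "rmat (A i)" "mu i", OF A_eig, of "int_vec w" j]
    by (auto simp: int_vec_mult z_def)
  then show ?thesis using znz by (intro exI[of _ "Q y"]) simp
qed

definition conjugate :: "real \<Rightarrow> 'n \<Rightarrow> real" where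
  "conjugate x j = nf_emb (lam j1) (lam j) x"

lemma conj_qpoly: "conjugate (qpoly q (lam j1)) j = qpoly q (lam j)"
  by (simp add: conjugate_def nf_emb_qpoly)

abbreviation "units \<equiv> nf_units (lam j1)"

lemma unitE:
  assumes "x \<in> units"
  obtains q t where "x = qpoly q (lam j1)" "inverse x = qpoly t (lam j1)"
    "\<And>j. qpoly q (lam j) * qpoly t (lam j) = 1"
    "integral_over v (\<lambda>j. qpoly q (lam j))" "integral_over v (\<lambda>j. qpoly t (lam j))"
  using assms unfolding nf_unit_iff by (metis inverse_unique)

lemma unit_conj:
  assumes "x \<in> units"
  shows "conjugate x j \<noteq> 0" "conjugate x j1 = x" "integral_over v (conjugate x)" "integral_over v (\<lambda>j. inverse (conjugate x j))"
    "conjugate (inverse x) j = inverse (conjugate x j)" "inverse x \<in> units"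
proof -
  obtain q t where q: "x = qpoly q (lam j1)" "inverse x = qpoly t (lam j1)"
    "\<And>j. qpoly q (lam j) * qpoly t (lam j) = 1"
    "integral_over v (\<lambda>j. qpoly q (lam j))" "integral_over v (\<lambda>j. qpoly t (lam j))"
    using unitE[OF assms] by metis
  have c: "conjugate x j = qpoly q (lam j)" "conjugate (inverse x) j = qpoly t (lam j)" for j
    by (simp_all only: q(1) q(2) conj_qpoly) (simp_all only: q(1)[symmetric] q(2) conj_qpoly)
  have i: "inverse (qpoly q (lam j)) = qpoly t (lam j)" for j using q(3) by (metis inverse_unique)
  show "conjugate x j \<noteq> 0" using q(3)[of j] by (auto simp: c)
  show "conjugate x j1 = x" using c(1)[of j1] q(1) by simp
  show "integral_over v (conjugate x)" using q(4) by (simp add: c[abs_def] fun_eq_iff[symmetric])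
  show "integral_over v (\<lambda>j. inverse (conjugate x j))" using q(5) by (simp add: c i)
  show "conjugate (inverse x) j = inverse (conjugate x j)" by (simp only: c i)
  show "inverse x \<in> units" unfolding nf_unit_iff using q by (metis mult.commute)
qed

lemma unit_mult:
  assumes "x \<in> units" "y \<in> units"
  shows "x * y \<in> units" "conjugate (x * y) j = conjugate x j * conjugate y j"
proof -
  obtain q t where q: "x = qpoly q (lam j1)" "\<And>j. qpoly q (lam j) * qpoly t (lam j) = 1"
    "integral_over v (\<lambda>j. qpoly q (lam j))" "integral_over v (\<lambda>j. qpoly t (lam j))"
    using assms(1) unfolding nf_unit_iff by blast
  obtain r u where r: "y = qpoly r (lam j1)" "\<And>j. qpoly r (lam j) * qpoly u (lam j) = 1"
    "integral_over v (\<lambda>j. qpoly r (lam j))" "integral_over v (\<lambda>j. qpoly u (lam j))"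
    using assms(2) unfolding nf_unit_iff by blast
  have xy: "x * y = qpoly (q * r) (lam j1)" by (simp add: q r rat_hom.eval_mult)
  show "x * y \<in> units"
    unfolding nf_unit_iff
  proof (rule exI[of _ "q * r"], rule exI[of _ "t * u"], intro conjI allI)
    show "qpoly (q * r) (lam j) * qpoly (t * u) (lam j) = 1" for j
      using q(2)[of j] r(2)[of j] by (simp add: rat_hom.eval_mult) (metis mult.assoc mult.left_commute mult_1)
  qed (simp_all add: xy rat_hom.eval_mult integral_over_mult q r)
  have "conjugate (x * y) j = qpoly (q * r) (lam j)" unfolding xy by (rule conj_qpoly)
  then show "conjugate (x * y) j = conjugate x j * conjugate y j" by (simp add: q(1) r(1) conj_qpoly rat_hom.eval_mult)
qed

lemma pm1_unit: "s \<in> {1, -1} \<Longrightarrow> s \<in> units" "s \<in> {1, -1} \<Longrightarrow> conjugate s j = s"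
proof -
  assume s: "s \<in> {1, -1 :: real}"
  then obtain r :: rat where r: "s = of_rat r" "r * r = 1" by (auto intro: that[of 1] that[of "-1"])
  have e: "qpoly [:r:] x = s" for x by (simp add: hom_eval_pCons hom_eval_0 r)
  have ss: "s * s = 1" using s by auto
  have "lattice_mult v (\<lambda>j. s ^ k)" for k
  proof -
    have "s ^ k = real_of_int ((if s = 1 then 1 else -1) ^ k)" using s by auto
    then show ?thesis using lattice_mult_of_int by metis
  qed
  then have i: "integral_over v (\<lambda>j. s)" unfolding integral_over_def by (intro exI[of _ 1]) simp
  show "s \<in> units" unfolding nf_unit_iff
    by (intro exI[of _ "[:r:]"]) (simp add: e ss i)
  show "conjugate s j = s" using conj_qpoly[of "[:r:]" j] by (simp add: e)
qed

text \<open>Integrality comes from the characteristic polynomials of \<open>A i\<close> and its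
  inverse, membership in the field from \<open>mu_qpoly\<close>.\<close>

lemma generator_unit: "mu i j1 \<in> units" and conj_generator: "conjugate (mu i j1) j = mu i j"
proof -
  obtain q where q: "\<And>j. mu i j = qpoly q (lam j)" using mu_qpoly by blast
  show "conjugate (mu i j1) j = mu i j" unfolding q by (rule conj_qpoly)
  have "algebraic_int (mu i j1)"
    using charpoly_monic[OF inv_V A_eig[of i]] algebraic_int_iff_ipoly by blast
  moreover have "algebraic_int (inverse (mu i j1))"
    using charpoly_monic[OF inv_V inverse_eig[of i]] algebraic_int_iff_ipoly by blast
  ultimately show "mu i j1 \<in> units" unfolding nf_units_def using q nf_field_iff mu_nonzero[of i j1] by blast
qed

text \<open>The norm of the unit and the norm of its inverse are integers with product 1.\<close>

lemma unit_norm: assumes x: "x \<in> units" shows "\<bar>\<Prod>j\<in>UNIV. conjugate x j\<bar> = 1"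
proof -
  have "(\<Prod>j\<in>UNIV. conjugate x j) \<in> \<int>" "(\<Prod>j\<in>UNIV. inverse (conjugate x j)) \<in> \<int>"
    using integral_over_prod_Ints[OF inv_V] unit_conj(3,4)[OF x] by blast+
  then obtain a b where ab: "(\<Prod>j\<in>UNIV. conjugate x j) = real_of_int a" "(\<Prod>j\<in>UNIV. inverse (conjugate x j)) = real_of_int b"
    by (auto elim!: Ints_cases)
  have "(\<Prod>j\<in>UNIV. conjugate x j) * (\<Prod>j\<in>UNIV. inverse (conjugate x j)) = 1"
    using unit_conj(1)[OF x] by (simp add: prod.distrib[symmetric])
  then have "a * b = 1" unfolding ab by (metis of_int_eq_1_iff of_int_mult)
  then have "\<bar>a\<bar> = 1" using zmult_eq_1_iff[of a b] by auto
  then show ?thesis unfolding ab by (metis of_int_1 of_int_abs)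
qed

text \<open>Such a unit is a root of the monic integer polynomial of its conjugates, whose
  coefficients are bounded: finitely many polynomials with finitely many roots each.\<close>

lemma finite_units_bounded: "finite {x \<in> units. \<forall>j. \<bar>conjugate x j\<bar> \<le> B}"
proof (cases "B \<ge> 0")
  case True
  define F where "F = {f :: int poly. degree f \<le> CARD('n) \<and> (\<forall>i. \<bar>real_of_int (coeff f i)\<bar> \<le> (1 + B) ^ CARD('n))}"
  have "{x \<in> units. \<forall>j. \<bar>conjugate x j\<bar> \<le> B} \<subseteq> (\<Union>f\<in>F - {0}. {x. poly (map_poly real_of_int f) x = 0})"
  proof
    fix x assume x: "x \<in> {x \<in> units. \<forall>j. \<bar>conjugate x j\<bar> \<le> B}"
    then have xu: "x \<in> units" and xB: "\<And>j. \<bar>conjugate x j\<bar> \<le> B" by auto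
    obtain f where f: "map_poly real_of_int f = (\<Prod>j\<in>UNIV. [:- conjugate x j, 1:])" "lead_coeff f = 1"
      using integral_over_poly[OF inv_V unit_conj(3)[OF xu]] by metis
    have "degree f = degree (map_poly real_of_int f)" by (subst degree_map_poly) auto
    then have "degree f = CARD('n)" by (simp add: f degree_prod_linear)
    moreover have "\<bar>real_of_int (coeff f i)\<bar> \<le> (1 + B) ^ CARD('n)" for i
      using coeff_prod_linear_bound[of UNIV "conjugate x" B i] xB True by (simp add: f(1)[symmetric] coeff_map_poly)
    ultimately have "f \<in> F" by (simp add: F_def)
    moreover have "f \<noteq> 0" using f(2) by auto
    moreover have "poly (map_poly real_of_int f) x = 0"
      unfolding f poly_prod using unit_conj(2)[OF xu] by (intro prod_zero bexI[of _ j1]) simp_all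
    ultimately show "x \<in> (\<Union>f\<in>F - {0}. {x. poly (map_poly real_of_int f) x = 0})" by blast
  qed
  moreover have "finite (\<Union>f\<in>F - {0}. {x. poly (map_poly real_of_int f) x = 0})"
  proof (intro finite_UN_I)
    show "finite (F - {0})" unfolding F_def by (intro finite_Diff finite_int_polys_bounded)
    fix f assume "f \<in> F - {0}"
    then have "map_poly real_of_int f \<noteq> 0" by (simp add: map_poly_eq_0_iff)
    then show "finite {x. poly (map_poly real_of_int f) x = 0}" by (rule poly_roots_finite)
  qed
  ultimately show ?thesis by (rule finite_subset)
next
  case False
  then have "{x \<in> units. \<forall>j. \<bar>conjugate x j\<bar> \<le> B} = {}" by (auto simp: not_le)
  then show ?thesis by (simp only: finite.emptyI)
qed

end

section \<open>The logarithmic lattice\<close>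

context cartan
begin

text \<open>The change of basis is fixed, so bounded eigenvalues bound the integer entries. That
  leaves finitely many matrices, and injectivity of the action finitely many times.\<close>

lemma finite_act_bounded: "finite {t. \<forall>j. \<bar>eigval t j\<bar> \<le> B}"
proof -
  define C where "C = (\<Sum>a\<in>UNIV. \<Sum>b\<in>UNIV. \<Sum>j\<in>UNIV. \<bar>eigmat v $ a $ j\<bar> * (B * \<bar>eig_coord v (axis b 1) $ j\<bar>))"
  let ?R = "{r :: int^'n. \<forall>b. \<bar>int_vec r $ b\<bar> \<le> C}"
  have "act_mat A ` {t. \<forall>j. \<bar>eigval t j\<bar> \<le> B} \<subseteq> vec_lambda ` (UNIV \<rightarrow> ?R)"
  proof clarify
    fix t assume t: "\<forall>j. \<bar>eigval t j\<bar> \<le> B"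
    have B0: "B \<ge> 0" using t by (meson abs_ge_zero order_trans)
    let ?M = "act_mat A t"
    have "\<bar>int_vec (?M $ a) $ b\<bar> \<le> C" for a b
    proof -
      have "rmat ?M *v axis b 1 = eigmat v *v (eig_coord v (rmat ?M *v axis b 1))"
        by (simp only: matrix_inv_mult_vec[OF inv_V])
      then have "(rmat ?M *v axis b 1) $ a = (\<Sum>j\<in>UNIV. eigmat v $ a $ j * (eigval t j * eig_coord v (axis b 1) $ j))"
        unfolding matrix_vector_mult_def[of "eigmat v"] by (simp add: eig_coord_act)
      moreover have "(rmat ?M *v axis b 1) $ a = int_vec (?M $ a) $ b"
        by (simp add: matrix_vector_mult_basis column_def rmat_def)
      ultimately have "\<bar>int_vec (?M $ a) $ b\<bar> \<le> (\<Sum>j\<in>UNIV. \<bar>eigmat v $ a $ j * (eigval t j * eig_coord v (axis b 1) $ j)\<bar>)"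
        by (metis sum_abs)
      also have "\<dots> \<le> (\<Sum>j\<in>UNIV. \<bar>eigmat v $ a $ j\<bar> * (B * \<bar>eig_coord v (axis b 1) $ j\<bar>))"
        unfolding abs_mult using t by (intro sum_mono mult_left_mono mult_right_mono) auto
      also have "\<dots> \<le> (\<Sum>b\<in>UNIV. \<Sum>j\<in>UNIV. \<bar>eigmat v $ a $ j\<bar> * (B * \<bar>eig_coord v (axis b 1) $ j\<bar>))"
        by (rule member_le_sum[of b UNIV "\<lambda>b. \<Sum>j\<in>UNIV. \<bar>eigmat v $ a $ j\<bar> * (B * \<bar>eig_coord v (axis b 1) $ j\<bar>)"])
           (use B0 in \<open>auto intro!: sum_nonneg mult_nonneg_nonneg\<close>)
      also have "\<dots> \<le> C" unfolding C_def
        by (rule member_le_sum[of a UNIV "\<lambda>a. \<Sum>b\<in>UNIV. \<Sum>j\<in>UNIV. \<bar>eigmat v $ a $ j\<bar> * (B * \<bar>eig_coord v (axis b 1) $ j\<bar>)"])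
           (use B0 in \<open>auto intro!: sum_nonneg mult_nonneg_nonneg\<close>)
      finally show ?thesis .
    qed
    then have "?M $ a \<in> ?R" for a by (intro CollectI allI)
    then have "vec_nth ?M \<in> UNIV \<rightarrow> ?R" by (rule Pi_I)
    then show "?M \<in> vec_lambda ` (UNIV \<rightarrow> ?R)"
      by (rule image_eqI[of ?M vec_lambda "vec_nth ?M", OF vec_nth_inverse[symmetric]])
  qed
  moreover have "finite (UNIV \<rightarrow> ?R :: ('n \<Rightarrow> int^'n) set)"
    using finite_PiE[of "UNIV :: 'n set" "\<lambda>_. ?R", OF finite finite_int_vec_bounded]
    by (simp only: PiE_UNIV_domain)
  ultimately have "finite (act_mat A ` {t. \<forall>j. \<bar>eigval t j\<bar> \<le> B})" by (meson finite_imageI finite_subset)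
  then show ?thesis by (rule finite_imageD) (rule inj_on_subset[OF inj_act], simp)
qed

text \<open>Rounding the multiples of a vector on which all exponents vanish would give infinitely many
  group elements with bounded eigenvalues.\<close>

lemma lyap_injective:
  assumes w: "\<And>j. lyap j \<bullet> w = 0" shows "w = 0"
proof (rule ccontr)
  assume "w \<noteq> 0"
  then obtain i where i: "w $ i \<noteq> 0" by (auto simp: vec_eq_iff)
  define t where "t N = (\<chi> i. \<lfloor>real N * w $ i\<rfloor>)" for N :: nat
  define B where "B = exp (\<Sum>j\<in>UNIV. \<Sum>i\<in>UNIV. \<bar>lyap j $ i\<bar>)"
  have "\<bar>eigval (t N) j\<bar> \<le> B" for N j
  proof -
    define u where "u = real N *\<^sub>R w - int_vec (t N)"
    have u: "0 \<le> u $ i \<and> u $ i \<le> 1" for i unfolding u_def t_def by simp linarith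
    have "lyap j \<bullet> int_vec (t N) = (- lyap j) \<bullet> u" by (simp add: u_def inner_diff_right w)
    also have "\<dots> \<le> (\<Sum>i\<in>UNIV. \<bar>(- lyap j) $ i\<bar>)" by (rule inner_unit_cube_bound[OF u])
    also have "\<dots> = (\<Sum>i\<in>UNIV. \<bar>lyap j $ i\<bar>)" by simp
    also have "\<dots> \<le> (\<Sum>j\<in>UNIV. \<Sum>i\<in>UNIV. \<bar>lyap j $ i\<bar>)"
      by (rule member_le_sum[of j UNIV "\<lambda>j. \<Sum>i\<in>UNIV. \<bar>lyap j $ i\<bar>"]) (auto simp: sum_nonneg)
    finally show ?thesis by (simp add: abs_eigval B_def)
  qed
  then have "range t \<subseteq> {t. \<forall>j. \<bar>eigval t j\<bar> \<le> B}" by blast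
  then have "finite (range t)" by (rule finite_subset[OF _ finite_act_bounded])
  then have "finite ((\<lambda>s. \<bar>s $ i\<bar>) ` range t)" by (rule finite_imageI)
  then obtain M where M: "\<And>N. \<bar>t N $ i\<bar> \<le> M" unfolding finite_int_iff_bounded_le by fastforce
  obtain N :: nat where N: "(real_of_int M + 1) / \<bar>w $ i\<bar> < real N" using reals_Archimedean2 by blast
  then have "real_of_int M + 1 < \<bar>real N * w $ i\<bar>" using i by (simp add: field_simps abs_mult)
  moreover have "\<bar>real N * w $ i - real_of_int (t N $ i)\<bar> \<le> 1" unfolding t_def by simp linarith
  moreover have "\<bar>real_of_int (t N $ i)\<bar> \<le> real_of_int M" using M[of N] by linarith
  ultimately show False by linarith
qed

lemma unit_sum_ln: assumes x: "x \<in> units" shows "(\<Sum>j\<in>UNIV. ln \<bar>conjugate x j\<bar>) = 0"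
proof -
  have "(\<Sum>j\<in>UNIV. ln \<bar>conjugate x j\<bar>) = ln (\<Prod>j\<in>UNIV. \<bar>conjugate x j\<bar>)"
    using unit_conj(1)[OF x] by (simp add: ln_prod)
  also have "(\<Prod>j\<in>UNIV. \<bar>conjugate x j\<bar>) = 1" using unit_norm[OF x] by (simp add: abs_prod)
  finally show ?thesis by simp
qed

lemma sum_lyap: "(\<Sum>j\<in>UNIV. lyap j) = 0"
  using unit_sum_ln[OF generator_unit] by (simp add: vec_eq_iff lyap_def conj_generator)

end

section \<open>Omitting one embedding\<close>

locale cartan_log = cartan A v mu i0 j1
  for A :: "'m::finite \<Rightarrow> int^'n::finite^'n" and v mu i0 j1 +
  fixes e :: "'m \<Rightarrow> 'n"
  assumes inj_e: "inj e" and card_mn: "CARD('m) = CARD('n) - 1" and card_n: "CARD('n) \<ge> 3"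
begin

text \<open>By cardinality \<open>e\<close> misses exactly one index, which is
  \<open>j0\<close>.\<close>

lemma sum_split: "\<exists>j0. \<forall>f :: 'n \<Rightarrow> 'b::comm_monoid_add. sum f UNIV = f j0 + (\<Sum>k\<in>UNIV. f (e k))"
proof -
  have "card (range e) = CARD('n) - 1" using card_image[OF inj_e] card_mn by simp
  then have "card (UNIV - range e) = 1" using card_n by (subst card_Diff_subset) auto
  then obtain j0 where j0: "UNIV - range e = {j0}" by (auto simp: card_1_singleton_iff)
  have "sum f UNIV = f j0 + (\<Sum>k\<in>UNIV. f (e k))" for f :: "'n \<Rightarrow> 'b"
  proof -
    have "UNIV = insert j0 (range e)" using j0 by blast
    then have "sum f UNIV = sum f (insert j0 (range e))" by simp
    also have "\<dots> = f j0 + sum f (range e)" using j0 by (intro sum.insert) auto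
    finally show ?thesis by (simp add: sum.reindex[OF inj_e])
  qed
  then show ?thesis by blast
qed

lemma all_if_e_and_sum:
  fixes f :: "'n \<Rightarrow> real"
  assumes "\<And>k. f (e k) = 0" "sum f UNIV = 0" shows "f j = 0"
proof -
  obtain j0 where j0: "\<And>g :: 'n \<Rightarrow> real. sum g UNIV = g j0 + (\<Sum>k\<in>UNIV. g (e k))" using sum_split by blast
  have "f j0 = 0" using j0[of f] assms by simp
  moreover have "j = j0 \<or> j \<in> range e"
  proof (rule ccontr)
    assume "\<not> (j = j0 \<or> j \<in> range e)"
    \<comment> \<open>The splitting is tested on the indicator function of \<open>j\<close>: an
      index missed by both parts would give 1 = 0.\<close>
    then have "(\<Sum>k\<in>UNIV. (if e k = j then 1 else 0 :: real)) = 0" by (intro sum.neutral) auto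
    then show False using j0[of "\<lambda>i. if i = j then 1 else 0"] \<open>\<not> (j = j0 \<or> j \<in> range e)\<close> by auto
  qed
  ultimately show ?thesis using assms(1) by auto
qed

definition logmat :: "real^'m^'m" where
  "logmat = (\<chi> i k. ln \<bar>mu i (e k)\<bar>)"

lemma logmat_axis: "logmat *v axis k 1 = lyap (e k)"
  by (simp add: logmat_def matrix_vector_mult_basis column_def lyap_def)

text \<open>A vector orthogonal to the functionals picked by \<open>e\<close> is orthogonal to the
  omitted one too, as all add up to zero; \<open>lyap_injective\<close> then applies.\<close>

lemma det_logmat: "det logmat \<noteq> 0"
proof -
  have "w = 0" if "transpose logmat *v w = 0" for w
  proof (rule lyap_injective)
    fix j
    show "lyap j \<bullet> w = 0"
    proof (rule all_if_e_and_sum[of "\<lambda>j. lyap j \<bullet> w"])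
      fix k
      have "(transpose logmat *v w) $ k = lyap (e k) \<bullet> w"
        by (simp add: matrix_vector_mult_def transpose_def logmat_def lyap_def inner_vec_def)
      then show "lyap (e k) \<bullet> w = 0" using that by simp
    next
      show "(\<Sum>j\<in>UNIV. lyap j \<bullet> w) = 0" using sum_lyap by (simp add: inner_sum_left[symmetric])
    qed
  qed
  then have "\<exists>B. B ** transpose logmat = mat 1" unfolding matrix_left_invertible_ker by blast
  then have "invertible (transpose logmat)" using invertible_left_inverse by blast
  then show ?thesis by (simp add: invertible_det_nz)
qed

text \<open>The omitted functional is minus the sum of the others, and a dual norm is even.\<close>

lemma entropy_sum_simplex:
  assumes p: "is_norm p"
  shows "entropy_sum p = (\<Sum>k\<in>UNIV. dual_norm p (logmat *v axis k 1)) + dual_norm p (logmat *v vec 1)"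
proof -
  obtain j0 where s: "\<And>g :: 'n \<Rightarrow> real. sum g UNIV = g j0 + (\<Sum>k\<in>UNIV. g (e k))" using sum_split by blast
  have "lyap j0 = - (logmat *v vec 1)"
  proof -
    have "lyap j0 $ i = - (logmat *v vec 1) $ i" for i
    proof -
      have "(\<Sum>j\<in>UNIV. lyap j $ i) = 0" using sum_lyap by (metis sum_component zero_index)
      then have "lyap j0 $ i + (\<Sum>k\<in>UNIV. lyap (e k) $ i) = 0" using s[of "\<lambda>j. lyap j $ i"] by simp
      then show ?thesis by (simp add: matrix_vector_mult_def logmat_def lyap_def)
    qed
    then show ?thesis by (simp add: vec_eq_iff)
  qed
  then have "dual_norm p (lyap j0) = dual_norm p (logmat *v vec 1)" by (simp add: dual_norm_minus[OF p])
  then show ?thesis unfolding entropy_sum_def s by (simp add: logmat_axis)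
qed

lemma sh_alpha_eq: "sh_alpha v A = ereal (simplex_const TYPE('m) * \<bar>det logmat\<bar> powr (1 / real CARD('m)))"
proof -
  have "sh_alpha v A = (INF p\<in>unit_volume_norms. ereal (entropy_sum p))"
    unfolding sh_alpha_def unit_volume_norms_def by (rule INF_cong) (auto simp: sh_norm_eq)
  also have "\<dots> = ereal (simplex_const TYPE('m) * \<bar>det (transpose logmat)\<bar> powr (1 / real CARD('m)))"
    by (rule INF_simplex_exponents) (use det_logmat entropy_sum_simplex in \<open>auto simp: unit_volume_norms_def transpose_transpose\<close>)
  finally show ?thesis by (simp add: det_transpose)
qed

section \<open>Logarithms of units, index and regulator\<close>

definition ulog :: "real \<Rightarrow> real^'m" where
  "ulog x = (\<chi> k. ln \<bar>conjugate x (e k)\<bar>)"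

lemma ulog_mult: "x \<in> units \<Longrightarrow> y \<in> units \<Longrightarrow> ulog (x * y) = ulog x + ulog y"
  by (simp add: ulog_def vec_eq_iff unit_mult(2) unit_conj(1) abs_mult ln_mult)

lemma ulog_inverse: "x \<in> units \<Longrightarrow> ulog (inverse x) = - ulog x"
  by (simp add: ulog_def vec_eq_iff unit_conj(1,5) ln_inverse)

lemma ulog_pm1: "s \<in> {1, -1} \<Longrightarrow> ulog s = 0"
  using pm1_unit(2) by (auto simp: ulog_def vec_eq_iff)

lemma unit_power: "x \<in> units \<Longrightarrow> x ^ n \<in> units \<and> ulog (x ^ n) = real n *\<^sub>R ulog x"
  by (induction n) (auto simp: pm1_unit(1) ulog_pm1 unit_mult(1) ulog_mult algebra_simps)

lemma unit_powi: "x \<in> units \<Longrightarrow> x powi k \<in> units \<and> ulog (x powi k) = real_of_int k *\<^sub>R ulog x"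
  using unit_power[of x "nat k"] unit_power[of "inverse x" "nat (- k)"] unit_conj(6)[of x] ulog_inverse[of x]
  by (auto simp: power_int_def power_inverse)

lemma unit_prod_powi:
  fixes u :: "'m \<Rightarrow> real"
  assumes "\<forall>i. u i \<in> units"
  shows "(\<Prod>i\<in>S. u i powi m i) \<in> units \<and> ulog (\<Prod>i\<in>S. u i powi m i) = (\<Sum>i\<in>S. real_of_int (m i) *\<^sub>R ulog (u i))"
  using unit_powi[OF assms[rule_format]]
  by (induction S rule: infinite_finite_induct) (auto simp: pm1_unit(1) ulog_pm1 unit_mult(1) ulog_mult)

text \<open>The vanishing sum recovers the omitted logarithm, so all conjugates have absolute value
  1. Since the conjugate at \<open>j1\<close> is the real number \<open>x\<close> itself, only two
  values remain.\<close>

lemma ulog_kernel: assumes x: "x \<in> units" and "ulog x = 0" shows "x \<in> {1, -1}"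
proof -
  have "ln \<bar>conjugate x j1\<bar> = 0"
  proof (rule all_if_e_and_sum[of "\<lambda>j. ln \<bar>conjugate x j\<bar>"])
    show "ln \<bar>conjugate x (e k)\<bar> = 0" for k using assms(2) by (simp add: ulog_def vec_eq_iff)
  qed (rule unit_sum_ln[OF x])
  then have "\<bar>x\<bar> = 1" using unit_conj(1,2)[OF x] by (metis abs_zero ln_eq_zero_iff zero_less_abs_iff)
  then show ?thesis by auto
qed

lemma ulog_eq_imp: assumes "x \<in> units" "y \<in> units" "ulog x = ulog y" obtains s where "s \<in> {1, -1}" "x = s * y"
proof -
  have "x * inverse y \<in> units" "ulog (x * inverse y) = 0"
    using assms unit_conj(6) by (simp_all add: unit_mult(1) ulog_mult ulog_inverse)
  then have "x * inverse y \<in> {1, -1}" by (rule ulog_kernel)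
  moreover have "y \<noteq> 0" using unit_conj(1,2)[OF assms(2)] by metis
  then have "x = (x * inverse y) * y" by simp
  ultimately show ?thesis using that by blast
qed

lemma finite_ulog_bounded: "finite {l \<in> ulog ` units. norm l \<le> C}"
proof -
  obtain j0 where s: "\<And>g :: 'n \<Rightarrow> real. sum g UNIV = g j0 + (\<Sum>k\<in>UNIV. g (e k))" using sum_split by blast
  \<comment> \<open>The omitted logarithm is minus the sum of the others, hence at most
    \<open>CARD('m) * C\<close>, and the others are at most \<open>C\<close>; adding both bounds
    covers all indices.\<close>
  define B where "B = exp (real CARD('m) * C + C)"
  have "{l \<in> ulog ` units. norm l \<le> C} \<subseteq> ulog ` {x \<in> units. \<forall>j. \<bar>conjugate x j\<bar> \<le> B}"
  proof clarify
    fix x assume x: "x \<in> units" "norm (ulog x) \<le> C"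
    have C0: "C \<ge> 0" using x(2) norm_ge_zero order_trans by blast
    have ek: "\<bar>ln \<bar>conjugate x (e k)\<bar>\<bar> \<le> C" for k
      using component_le_norm_cart[of "ulog x" k] x(2) by (simp add: ulog_def)
    have "ln \<bar>conjugate x j0\<bar> = - (\<Sum>k\<in>UNIV. ln \<bar>conjugate x (e k)\<bar>)" using unit_sum_ln[OF x(1)] s[of "\<lambda>j. ln \<bar>conjugate x j\<bar>"] by simp
    also have "\<dots> \<le> (\<Sum>k\<in>(UNIV :: 'm set). C)" unfolding sum_negf[symmetric] by (intro sum_mono) (use ek abs_le_iff in blast)
    finally have "ln \<bar>conjugate x j0\<bar> \<le> real CARD('m) * C" by simp
    moreover have "j = j0 \<or> j \<in> range e" for j
    proof (rule ccontr)
      assume n: "\<not> (j = j0 \<or> j \<in> range e)"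
      then have "(\<Sum>k\<in>UNIV. (if e k = j then 1 else 0 :: real)) = 0" by (intro sum.neutral) auto
      then show False using s[of "\<lambda>i. if i = j then 1 else 0"] n by auto
    qed
    moreover have "ln \<bar>conjugate x (e k)\<bar> \<le> C" for k using ek[of k] by linarith
    moreover have "0 \<le> real CARD('m) * C" using C0 by simp
    ultimately have "ln \<bar>conjugate x j\<bar> \<le> real CARD('m) * C + C" for j
      using C0 by (metis (no_types, lifting) add_increasing add_increasing2 imageE)
    then have "\<bar>conjugate x j\<bar> \<le> B" for j
      unfolding B_def using unit_conj(1)[OF x(1), of j] by (metis exp_le_cancel_iff exp_ln zero_less_abs_iff)
    then show "ulog x \<in> ulog ` {x \<in> units. \<forall>j. \<bar>conjugate x j\<bar> \<le> B}" using x(1) by blast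
  qed
  then show ?thesis by (rule finite_subset) (intro finite_imageI finite_units_bounded)
qed

abbreviation "log_lattice \<equiv> ulog ` units"

lemma log_lattice_0: "0 \<in> log_lattice"
  using pm1_unit(1)[of 1] ulog_pm1[of 1] by (metis image_eqI insertI1)

lemma log_lattice_diff: "a \<in> log_lattice \<Longrightarrow> b \<in> log_lattice \<Longrightarrow> a - b \<in> log_lattice"
proof clarify
  fix x y assume "x \<in> units" "y \<in> units"
  then have "ulog x - ulog y = ulog (x * inverse y)" "x * inverse y \<in> units"
    using unit_conj(6)[of y] by (simp_all add: ulog_mult ulog_inverse unit_mult(1))
  then show "ulog x - ulog y \<in> log_lattice" by blast
qed

definition genlog :: "'m \<Rightarrow> real^'m" where
  "genlog i = ulog (mu i j1)"

lemma genlog_in: "genlog i \<in> log_lattice"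
  unfolding genlog_def using generator_unit by blast

lemma eigmat_genlog: "eigmat genlog = transpose logmat"
  by (simp add: eigmat_def genlog_def ulog_def conj_generator logmat_def transpose_def vec_eq_iff)

lemma inv_genlog: "invertible (eigmat genlog)"
  using det_logmat by (simp add: invertible_det_nz eigmat_genlog)

lemma zspan_ulog: "(\<forall>i. u i \<in> units) \<Longrightarrow> zspan (\<lambda>i. ulog (u i)) = range (\<lambda>m. ulog (\<Prod>i\<in>UNIV. u i powi m i))"
proof -
  assume u: "\<forall>i. u i \<in> units"
  have e: "eigmat (\<lambda>i. ulog (u i)) *v int_vec m = ulog (\<Prod>i\<in>UNIV. u i powi (m $ i))" for m
    using unit_prod_powi[OF u, of "\<lambda>i. m $ i" UNIV] by (simp add: eigmat_mult_vec)
  show ?thesis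
    unfolding zspan_def e
  proof (intro equalityI subsetI)
    fix l assume "l \<in> range (\<lambda>m. ulog (\<Prod>i\<in>UNIV. u i powi m i))"
    then obtain m where "l = ulog (\<Prod>i\<in>UNIV. u i powi m i)" by (rule rangeE)
    then show "l \<in> range (\<lambda>m. ulog (\<Prod>i\<in>UNIV. u i powi (m $ i)))" by (intro range_eqI[of _ _ "\<chi> i. m i"]) simp
  next
    fix l assume "l \<in> range (\<lambda>m. ulog (\<Prod>i\<in>UNIV. u i powi (m $ i)))"
    then obtain m where "l = ulog (\<Prod>i\<in>UNIV. u i powi (m $ i))" by (rule rangeE)
    then show "l \<in> range (\<lambda>m. ulog (\<Prod>i\<in>UNIV. u i powi m i))" by (rule range_eqI[of _ _ "\<lambda>i. m $ i"])
  qed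
qed

text \<open>Signs are exactly the kernel of \<open>ulog\<close>, so generation up to sign becomes
  generation of the logarithmic lattice.\<close>

lemma fund_system_iff:
  "fund_system (lam j1) u \<longleftrightarrow> (\<forall>i. u i \<in> units) \<and> zspan (\<lambda>i. ulog (u i)) = log_lattice"
proof safe
  assume f: "fund_system (lam j1) u"
  then show u: "u i \<in> units" for i by (simp add: fund_system_def)
  have z: "zspan (\<lambda>i. ulog (u i)) = range (\<lambda>m. ulog (\<Prod>i\<in>UNIV. u i powi m i))" using u by (intro zspan_ulog) simp
  show "l \<in> log_lattice" if "l \<in> zspan (\<lambda>i. ulog (u i))" for l
    using that unit_prod_powi[of u] u unfolding z by blast
  show "ulog x \<in> zspan (\<lambda>i. ulog (u i))" if x: "x \<in> units" for x
  proof -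
    obtain s m where s: "s \<in> {1, -1}" "x = s * (\<Prod>i\<in>UNIV. u i powi m i)"
      using f x unfolding fund_system_def by blast
    then have "ulog x = ulog (\<Prod>i\<in>UNIV. u i powi m i)"
      using ulog_mult[OF pm1_unit(1)[OF s(1)]] unit_prod_powi[of u m UNIV] u ulog_pm1[OF s(1)] by (simp add: s(2))
    then show ?thesis unfolding z by blast
  qed
next
  assume u: "\<forall>i. u i \<in> units" and z: "zspan (\<lambda>i. ulog (u i)) = log_lattice"
  show "fund_system (lam j1) u"
    unfolding fund_system_def
  proof (intro conjI ballI)
    fix x assume x: "x \<in> units"
    then have "ulog x \<in> range (\<lambda>m. ulog (\<Prod>i\<in>UNIV. u i powi m i))" using z zspan_ulog[OF u] by blast
    then obtain m where "ulog x = ulog (\<Prod>i\<in>UNIV. u i powi m i)" by blast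
    then obtain s where "s \<in> {1, -1}" "x = s * (\<Prod>i\<in>UNIV. u i powi m i)"
      using ulog_eq_imp[OF x] unit_prod_powi[OF u] by metis
    then show "\<exists>s\<in>{1, -1}. \<exists>m. x = s * (\<Prod>i\<in>UNIV. u i powi m i)" by blast
  qed (use u in simp)
qed

text \<open>Dirichlet's unit theorem for this field: discreteness comes from
  \<open>finite_ulog_bounded\<close>, and the full rank from the generators of the action.\<close>

lemma fund_system_exists: "\<exists>u :: 'm \<Rightarrow> real. fund_system (lam j1) u"
proof -
  have "\<exists>b. (\<forall>i. b i \<in> log_lattice) \<and> invertible (eigmat b) \<and> log_lattice = zspan b"
    by (rule discrete_subgroup_basis[of log_lattice genlog])
       (use log_lattice_0 log_lattice_diff finite_ulog_bounded genlog_in inv_genlog in auto)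
  then obtain b where b: "\<And>i. b i \<in> log_lattice" "log_lattice = zspan b" by blast
  then have "\<exists>x. x \<in> units \<and> b i = ulog x" for i by blast
  then obtain u where u: "\<And>i. u i \<in> units" "\<And>i. b i = ulog (u i)" by metis
  have "b = (\<lambda>i. ulog (u i))" using u(2) by blast
  then show ?thesis using u(1) b(2) unfolding fund_system_iff by blast
qed

text \<open>The subgroup \<open>H\<close> contains the kernel of \<open>ulog\<close>, so it is the
  full preimage of \<open>zspan genlog\<close>, and its cosets correspond to cosets in the
  logarithmic lattice.\<close>

lemma unit_index_eq: "unit_index (lam j1) (\<lambda>i. mu i j1) = card (log_lattice \<inter> fund_box genlog)"
proof -
  define H where "H = {s * (\<Prod>i\<in>UNIV. mu i j1 powi m i) | s m. s \<in> {1, -1::real}}"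
  have z: "zspan genlog = range (\<lambda>m. ulog (\<Prod>i\<in>UNIV. mu i j1 powi m i))"
    unfolding genlog_def by (rule zspan_ulog) (simp add: generator_unit)
  have H: "h \<in> H \<longleftrightarrow> h \<in> units \<and> ulog h \<in> zspan genlog" for h
  proof
    assume "h \<in> H"
    then obtain s m where h: "s \<in> {1, -1}" "h = s * (\<Prod>i\<in>UNIV. mu i j1 powi m i)" unfolding H_def by blast
    let ?P = "\<Prod>i\<in>UNIV. mu i j1 powi m i"
    have P: "?P \<in> units" using unit_prod_powi[of "\<lambda>i. mu i j1"] generator_unit by blast
    have "h \<in> units" "ulog h = ulog ?P"
      using h unit_mult(1)[OF pm1_unit(1)[OF h(1)] P] ulog_mult[OF pm1_unit(1)[OF h(1)] P] ulog_pm1[OF h(1)] by auto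
    then show "h \<in> units \<and> ulog h \<in> zspan genlog" unfolding z by blast
  next
    assume h: "h \<in> units \<and> ulog h \<in> zspan genlog"
    then obtain m where "ulog h = ulog (\<Prod>i\<in>UNIV. mu i j1 powi m i)" unfolding z by blast
    then obtain s where "s \<in> {1, -1}" "h = s * (\<Prod>i\<in>UNIV. mu i j1 powi m i)"
      using ulog_eq_imp[of h] h unit_prod_powi[of "\<lambda>i. mu i j1"] generator_unit by metis
    then show "h \<in> H" unfolding H_def by blast
  qed
  \<comment> \<open>Preimages under \<open>ulog\<close> within the units; on subsets of the lattice,
    taking the image recovers the set, whence injectivity.\<close>
  define \<Phi> where "\<Phi> S = {y \<in> units. ulog y \<in> S}" for S
  define coset where "coset l = {y. y - l \<in> zspan genlog}" for l
  have sub: "zspan genlog \<subseteq> log_lattice"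
    by (rule zspan_subset[OF log_lattice_0 log_lattice_diff genlog_in])
  have xH: "(\<lambda>y. x * y) ` H = \<Phi> (coset (ulog x))" if x: "x \<in> units" for x
  proof (intro equalityI subsetI)
    fix y assume "y \<in> (\<lambda>y. x * y) ` H"
    then show "y \<in> \<Phi> (coset (ulog x))" using x by (auto simp: H \<Phi>_def coset_def unit_mult(1) ulog_mult)
  next
    fix y assume "y \<in> \<Phi> (coset (ulog x))"
    then have y: "y \<in> units" "ulog y - ulog x \<in> zspan genlog" by (auto simp: \<Phi>_def coset_def)
    have "x \<noteq> 0" using unit_conj(1,2)[OF x] by metis
    then have "y = x * (y * inverse x)" by simp
    moreover have "y * inverse x \<in> H"
      using x y unit_conj(6)[OF x] by (simp add: H unit_mult(1) ulog_mult ulog_inverse)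
    ultimately show "y \<in> (\<lambda>y. x * y) ` H" by blast
  qed
  have "(\<lambda>x. (\<lambda>y. x * y) ` H) ` units = \<Phi> ` coset ` log_lattice"
    by (simp add: image_image xH cong: image_cong_simp)
  moreover have "inj_on \<Phi> (coset ` log_lattice)"
  proof (rule inj_on_inverseI[of _ "\<lambda>T. ulog ` T"])
    fix S assume "S \<in> coset ` log_lattice"
    then obtain l where l: "l \<in> log_lattice" "S = coset l" by blast
    have "S \<subseteq> log_lattice"
    proof
      fix y assume "y \<in> S"
      then have "y - l \<in> log_lattice" using sub l by (auto simp: coset_def)
      then have "(y - l) - (0 - l) \<in> log_lattice" using l log_lattice_0 log_lattice_diff by blast
      then show "y \<in> log_lattice" by simp
    qed
    then show "ulog ` \<Phi> S = S" unfolding \<Phi>_def by blast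
  qed
  ultimately have "card ((\<lambda>x. (\<lambda>y. x * y) ` H) ` units) = card (coset ` log_lattice)" by (simp add: card_image)
  also have "\<dots> = card (log_lattice \<inter> fund_box genlog)"
    using bij_betw_same_card[OF fund_box_coset_reps[of log_lattice genlog]] log_lattice_diff genlog_in log_lattice_0 inv_genlog
    unfolding coset_def[abs_def] by metis
  finally show ?thesis unfolding unit_index_def H_def by simp
qed

text \<open>\<open>regulator\<close> takes the determinant of a chosen system. As a fundamental
  system exists, its logarithms span the whole lattice, and comparing its covolume with that of the
  generators gives the index.\<close>

lemma index_regulator:
  "\<bar>det logmat\<bar> = real (unit_index (lam j1) (\<lambda>i. mu i j1)) * regulator (lam j1) (\<lambda>k. lam (e k))"
proof -
  define u where "u = (SOME u :: 'm \<Rightarrow> real. fund_system (lam j1) u)"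
  have u: "fund_system (lam j1) u" unfolding u_def by (rule someI_ex[OF fund_system_exists])
  define b where "b = (\<lambda>i. ulog (u i))"
  have zb: "zspan b = log_lattice" using u unfolding fund_system_iff b_def by blast
  have reg: "regulator (lam j1) (\<lambda>k. lam (e k)) = \<bar>det (eigmat b)\<bar>"
  proof -
    have "(\<chi> i k. ln \<bar>nf_emb (lam j1) (lam (e k)) (u i)\<bar>) = transpose (eigmat b)"
      by (simp add: vec_eq_iff transpose_def eigmat_def b_def ulog_def conjugate_def)
    then show ?thesis unfolding regulator_def Let_def u_def[symmetric] by (simp add: det_transpose)
  qed
  have gb: "genlog i \<in> zspan b" for i using genlog_in zb by simp
  \<comment> \<open>The nonsingular matrix of \<open>genlog\<close> factors through that of
    \<open>b\<close>.\<close>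
  have invb: "invertible (eigmat b)"
  proof -
    have "\<exists>m. genlog i = eigmat b *v int_vec m" for i using gb[of i] unfolding zspan_def by blast
    then obtain m where m: "\<And>i. genlog i = eigmat b *v int_vec (m i)" by metis
    have "genlog = (\<lambda>i. eigmat b *v int_vec (m i))" using m by blast
    then have "eigmat genlog = eigmat b ** eigmat (\<lambda>i. int_vec (m i))" by (simp add: eigmat_mult)
    then have "det (eigmat b) \<noteq> 0" using inv_genlog by (auto simp: invertible_det_nz det_mul)
    then show ?thesis by (simp add: invertible_det_nz)
  qed
  have fin: "finite (zspan b \<inter> fund_box genlog)"
  proof -
    obtain C where "\<And>x. x \<in> fund_box genlog \<Longrightarrow> norm x \<le> C" using bounded_fund_box[of genlog] by (auto simp: bounded_iff)
    then have "zspan b \<inter> fund_box genlog \<subseteq> {l \<in> log_lattice. norm l \<le> C}" using zb by auto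
    then show ?thesis using finite_ulog_bounded finite_subset by blast
  qed
  have "\<bar>det (eigmat genlog)\<bar> = real (card (zspan b \<inter> fund_box genlog)) * \<bar>det (eigmat b)\<bar>"
    by (rule det_sublattice[OF invb inv_genlog gb fin])
  then show ?thesis by (simp add: eigmat_genlog det_transpose unit_index_eq reg zb)
qed

end

text \<open>\<open>j1\<close> selects the eigenvalue generating the field and \<open>e\<close> the
  embedding left out; the formulas hold for every choice, and \<open>C\<close> is fixed before the
  action.\<close>

theorem mainTheorem18:
  assumes "CARD('n::finite) \<ge> 3" and "CARD('m::finite) = CARD('n) - 1"
  shows "\<exists>C::real. (real CARD('n) - 1) / 2 \<le> C \<and> C \<le> real CARD('n) - 1 \<and>
    (\<forall>(A :: 'm \<Rightarrow> int^'n^'n) (i0 :: 'm) (v :: 'n \<Rightarrow> real^'n) (mu :: 'm \<Rightarrow> 'n \<Rightarrow> real)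
        (j1 :: 'n) (e :: 'm \<Rightarrow> 'n).
      cartan_action A i0 \<and> common_eigenbasis A v mu \<and> inj e \<longrightarrow>
      (let R = \<bar>det (\<chi> i k. ln \<bar>mu i (e k)\<bar>)\<bar> in
        sh_alpha v A = ereal (C * R powr (1 / (real CARD('n) - 1))) \<and>
        R = real (unit_index (mu i0 j1) (\<lambda>i. mu i j1)) * regulator (mu i0 j1) (\<lambda>k. mu i0 (e k))))"
proof (rule exI[of _ "simplex_const TYPE('m)"], intro conjI allI impI)
  have m: "real CARD('m) = real CARD('n) - 1" using assms by simp
  show "(real CARD('n) - 1) / 2 \<le> simplex_const TYPE('m)" "simplex_const TYPE('m) \<le> real CARD('n) - 1"
    using simplex_const_bounds[where 'm='m] by (simp_all add: m)
  fix A :: "'m \<Rightarrow> int^'n^'n" and i0 and v :: "'n \<Rightarrow> real^'n" and mu :: "'m \<Rightarrow> 'n \<Rightarrow> real" and j1 :: 'n and e :: "'m \<Rightarrow> 'n"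
  assume a: "cartan_action A i0 \<and> common_eigenbasis A v mu \<and> inj e"
  then interpret cartan_log A v mu i0 j1 e
    using assms by unfold_locales (auto simp: cartan_action_def)
  show "let R = \<bar>det (\<chi> i k. ln \<bar>mu i (e k)\<bar>)\<bar> in
        sh_alpha v A = ereal (simplex_const TYPE('m) * R powr (1 / (real CARD('n) - 1))) \<and>
        R = real (unit_index (mu i0 j1) (\<lambda>i. mu i j1)) * regulator (mu i0 j1) (\<lambda>k. mu i0 (e k))"
    using sh_alpha_eq index_regulator by (simp add: Let_def logmat_def m)
qed

end
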